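(* Let $\Bbbk$ be a field. The contravariant adjunction $$\mathsf{NCoalg}(\mathsf{Alg}_\Bbbk)(A,C^{\bullet})\;\cong\;\mathsf{NAlg}(\mathsf{Coalg}_\Bbbk)(C,A^{\circ})$$ (natural in $A$ in $\mathsf{NCoalg}(\mathsf{Alg}_\Bbbk)$ and $C$ in $\mathsf{NAlg}(\mathsf{Coalg}_\Bbbk)$, with unit $\xi_A:A\to A^{\circ\bullet}$, $\xi_A(a)(f)=f(a)$, and counit $\vartheta_C:C\to C^{\bullet\circ}$, $\vartheta_C(x)(g)=g(x)$) induces a contravariant adjunction between the category $\mathsf{SDQBialg}_\Bbbk$ of split dual quasi-bialgebras and the category $\mathsf{QBialg}_\Bbbk$ of quasi-bialgebras, given by the contravariant functors $$(-)^{\bullet}:\mathsf{SDQBialg}_\Bbbk\longrightarrow\mathsf{QBialg}_\Bbbk,\qquad (-)^{\circ}:\mathsf{QBialg}_\Bbbk\longrightarrow\mathsf{SDQBialg}_\Bbbk .$$ Here $(-)^{\circ}$ sends a quasi-bialgebra $(H,m,u,\Delta,\varepsilon,\Phi)$ with $\Phi=\sum\Phi^1\otimes\Phi^2\otimes\Phi^3$ to $H^{\circ}$ with reassociator $\omega(f\otimes g\otimes h)=\sum f(\Phi^1)g(\Phi^2)h(\Phi^3)$, and $(-)^{\bullet}$ sends a split dual quasi-bialgebra $(U,\Delta,\varepsilon,m,u,\omega)$ to $U^{\bullet}$ with reassociator the invertible element $\Phi\in (U^{\bullet})^{\otimes 3}$ such that $\zeta(\Phi)=\omega$.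
   Context: All vector spaces are over the field $\Bbbk$, $\otimes=\otimes_\Bbbk$, $V^*=\mathrm{Hom}_\Bbbk(V,\Bbbk)$; $\varphi_{V,W}:V^*\otimes W^*\to(V\otimes W)^*$ is the canonical injection $f\otimes g\mapsto[v\otimes w\mapsto f(v)g(w)]$. In formulas, the name of a vector space also denotes its identity map. A non-associative algebra is a vector space with a bilinear multiplication having a two-sided unit, not necessarily associative. A non-coassociative coalgebra is a vector space with a comultiplication having a two-sided counit, not necessarily coassociative. $\mathsf{Alg}_\Bbbk$ and $\mathsf{Coalg}_\Bbbk$ are the monoidal categories of associative unital algebras and of coassociative counital coalgebras. $\mathsf{NAlg}(\mathsf{Coalg}_\Bbbk)$: objects are $(C,\Delta,\varepsilon,m,u)$ with $(C,\Delta,\varepsilon)$ a coassociative counital coalgebra and $m:C\otimes C\to C$, $u:\Bbbk\to C$ coalgebra maps such that $m$ is unital with unit $u$ ($m$ need not be associative). $\mathsf{NCoalg}(\mathsf{Alg}_\Bbbk)$: objects are $(A,m,u,\Delta,\varepsilon)$ with $(A,m,u)$ an associative unital algebra and $\Delta:A\to A\otimes A$, $\varepsilon:A\to\Bbbk$ algebra maps such that $\Delta$ is counital with counit $\varepsilon$ ($\Delta$ need not be coassociative). In both categories, morphisms are linear maps compatible with multiplication, unit, comultiplication and counit. For a non-associative algebra $(A,m,u)$, a subspace $V\subseteq A^*$ is good if $m^*(V)\subseteq\varphi_{A,A}(V\otimes V)$; $A^{\bullet}$ is the sum of all good subspaces of $A^*$ (it is the largest good subspace). It is a non-coassociative coalgebra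 with comultiplication determined by $f(ab)=\sum f_1(a)f_2(b)$ and counit $f\mapsto f(1)$. If $A$ is associative one writes $A^{\circ}$ for it; then $A^\circ=\{f\in A^*\mid \ker f$ contains a two-sided ideal of finite codimension$\}$ is the usual finite dual. If $C$ is in $\mathsf{NAlg}(\mathsf{Coalg}_\Bbbk)$, then $C^{\bullet}$ is an object of $\mathsf{NCoalg}(\mathsf{Alg}_\Bbbk)$ with comultiplication $f\mapsto\sum f_1\otimes f_2$ determined by $f(xy)=\sum f_1(x)f_2(y)$ for all $x,y\in C$, counit $f\mapsto f(1)$, convolution product $(f*g)(x)=\sum f(x_1)g(x_2)$ and unit $\varepsilon$. If $A$ is in $\mathsf{NCoalg}(\mathsf{Alg}_\Bbbk)$, then $A^{\circ}$ is an object of $\mathsf{NAlg}(\mathsf{Coalg}_\Bbbk)$ with comultiplication $f\mapsto\sum f_1\otimes f_2$ determined by $f(ab)=\sum f_1(a)f_2(b)$ for all $a,b\in A$, counit $f\mapsto f(1)$, convolution product $(f*g)(a)=\sum f(a_1)g(a_2)$ and unit $\varepsilon$. On morphisms both functors are given by (restriction of) the transpose $h\mapsto h\circ f$. A quasi-bialgebra is an object $(H,m,u,\Delta,\varepsilon)$ of $\mathsf{NCoalg}(\mathsf{Alg}_\Bbbk)$ together with an invertible element $\Phi$ of the algebra $H\otimes H\otimes H$ (the reassociator) such that $(H\otimes H\otimes\Delta)(\Phi)\cdot(\Delta\otimes H\otimes H)(\Phi)=(1\otimes\Phi)\cdot(H\otimes\Delta\otimes H)(\Phi)\cdot(\Phi\otimes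 1)$; $(\varepsilon\otimes H\otimes H)(\Phi)=(H\otimes\varepsilon\otimes H)(\Phi)=(H\otimes H\otimes\varepsilon)(\Phi)=1\otimes 1$; $\Phi\cdot(\Delta\otimes H)(\Delta(h))=(H\otimes\Delta)(\Delta(h))\cdot\Phi$ for all $h\in H$. A morphism of quasi-bialgebras $\mathfrak f:(H,\Phi)\to(H',\Phi')$ is a morphism in $\mathsf{NCoalg}(\mathsf{Alg}_\Bbbk)$ with $(\mathfrak f\otimes\mathfrak f\otimes\mathfrak f)(\Phi)=\Phi'$. This gives the category $\mathsf{QBialg}_\Bbbk$. A dual quasi-bialgebra is an object $(U,\Delta,\varepsilon,m,u)$ of $\mathsf{NAlg}(\mathsf{Coalg}_\Bbbk)$ together with a convolution invertible linear map $\omega:U^{\otimes 3}\to\Bbbk$ (the reassociator) such that, with $*$ the convolution product, $(\omega\circ(U\otimes U\otimes m))*(\omega\circ(m\otimes U\otimes U))=(\varepsilon\otimes\omega)*(\omega\circ(U\otimes m\otimes U))*(\omega\otimes\varepsilon)$; $\omega(h\otimes k\otimes l)=\varepsilon(h)\varepsilon(k)\varepsilon(l)$ whenever $1_U\in\{h,k,l\}$; $(u\circ\omega)*(m\circ(m\otimes U))=(m\circ(U\otimes m))*(u\circ\omega)$. A morphism of dual quasi-bialgebras $\mathfrak g:(U,\omega)\to(U',\omega')$ is a morphism in $\mathsf{NAlg}(\mathsf{Coalg}_\Bbbk)$ with $\omega'\circ(\mathfrak g\otimes\mathfrak g\otimes\mathfrak g)=\omega$. This gives the category $\mathsf{DQBialg}_\Bbbk$.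 For $U$ in $\mathsf{NAlg}(\mathsf{Coalg}_\Bbbk)$, $\zeta:(U^{\bullet})^{\otimes 3}\to(U^{\otimes 3})^*$ is the injective algebra map $\zeta(f\otimes g\otimes h)(x\otimes y\otimes z)=f(x)g(y)h(z)$. $\mathsf{SDQBialg}_\Bbbk$ is the full subcategory of $\mathsf{DQBialg}_\Bbbk$ whose objects, called split dual quasi-bialgebras, are those $(U,\Delta,\varepsilon,m,u,\omega)$ for which there exists an invertible element $\Phi\in(U^{\bullet})^{\otimes 3}$ with $\zeta(\Phi)=\omega$. *)

theory Defs
  imports Complex_Main "HOL-Library.Function_Algebras"
begin

section \<open>Vector spaces with carriers\<close>

text \<open>
  A vector space over the field \<^typ>\<open>'k\<close> is a linear subspace \<open>car\<close> of an ambient vector space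
  whose vectors form the type \<^typ>\<open>'a\<close>.  Carriers are needed because duals, finite duals and tensor
  products occur as subspaces of function types (with the pointwise operations).
  Linear maps are normalised to be \<open>0\<close> outside of the carrier of their domain, so that two linear
  maps are equal iff they agree on that carrier.
\<close>

record ('k, 'a) vspace =
  car :: "'a set"
  scl :: "'k \<Rightarrow> 'a \<Rightarrow> 'a"

definition is_vspace :: "('k::field, 'a::ab_group_add, 'm) vspace_scheme \<Rightarrow> bool" where
  "is_vspace V \<longleftrightarrow> vector_space (scl V) \<and> module.subspace (scl V) (car V)"

definition linear_on ::
  "('k::field, 'a::ab_group_add, 'm) vspace_scheme \<Rightarrow> ('k, 'b::ab_group_add, 'n) vspace_scheme
    \<Rightarrow> ('a \<Rightarrow> 'b) \<Rightarrow> bool" where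
  "linear_on V W f \<longleftrightarrow>
     (\<forall>x\<in>car V. f x \<in> car W) \<and>
     (\<forall>x\<in>car V. \<forall>y\<in>car V. f (x + y) = f x + f y) \<and>
     (\<forall>c. \<forall>x\<in>car V. f (scl V c x) = scl W c (f x))"

definition lhom ::
  "('k::field, 'a::ab_group_add, 'm) vspace_scheme \<Rightarrow> ('k, 'b::ab_group_add, 'n) vspace_scheme
    \<Rightarrow> ('a \<Rightarrow> 'b) set" where
  "lhom V W = {f. linear_on V W f \<and> (\<forall>x. x \<notin> car V \<longrightarrow> f x = 0)}"

definition bilinear_on ::
  "('k::field, 'a::ab_group_add, 'm) vspace_scheme \<Rightarrow> ('k, 'b::ab_group_add, 'n) vspace_scheme
    \<Rightarrow> ('k, 'c::ab_group_add, 'p) vspace_scheme \<Rightarrow> ('a \<Rightarrow> 'b \<Rightarrow> 'c) \<Rightarrow> bool" where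
  "bilinear_on V W X f \<longleftrightarrow>
     (\<forall>v\<in>car V. linear_on W X (f v)) \<and> (\<forall>w\<in>car W. linear_on V X (\<lambda>v. f v w))"

definition ident :: "('k::field, 'a::ab_group_add, 'm) vspace_scheme \<Rightarrow> 'a \<Rightarrow> 'a" where
  "ident V = (\<lambda>x. if x \<in> car V then x else 0)"

definition base_field :: "('k::field, 'k) vspace" where
  "base_field = \<lparr>car = UNIV, scl = (*)\<rparr>"

definition fscl :: "'k::field \<Rightarrow> ('x \<Rightarrow> 'k) \<Rightarrow> 'x \<Rightarrow> 'k" where
  "fscl c f = (\<lambda>x. c * f x)"

definition dual :: "('k::field, 'a::ab_group_add, 'm) vspace_scheme \<Rightarrow> ('k, 'a \<Rightarrow> 'k) vspace" where
  "dual V = \<lparr>car = lhom V base_field, scl = fscl\<rparr>"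


section \<open>Tensor products\<close>

text \<open>
  The tensor product of \<open>V\<close> and \<open>W\<close> is realised inside the dual of the space of bilinear forms on
  \<open>V \<times> W\<close>: the pure tensor of \<open>v\<close> and \<open>w\<close> is evaluation of bilinear forms at \<open>(v, w)\<close>.
  Over a field this is a tensor product; its universal property is
  proved below (\<open>tens_bilinear\<close>, \<open>tensor_universal\<close>).
\<close>

type_synonym ('k, 'a, 'b) tensor = "('a \<Rightarrow> 'b \<Rightarrow> 'k) \<Rightarrow> 'k"
type_synonym ('k, 'a) tensor2 = "('k, 'a, 'a) tensor"
type_synonym ('k, 'a) tensor3 = "('k, ('k, 'a) tensor2, 'a) tensor"
type_synonym ('k, 'a) tensor4 = "('k, ('k, 'a) tensor3, 'a) tensor"

definition tens ::
  "('k::field, 'a::ab_group_add, 'm) vspace_scheme \<Rightarrow> ('k, 'b::ab_group_add, 'n) vspace_scheme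
    \<Rightarrow> 'a \<Rightarrow> 'b \<Rightarrow> ('k, 'a, 'b) tensor" where
  "tens V W v w = (\<lambda>\<beta>. if bilinear_on V W base_field \<beta> then \<beta> v w else 0)"

definition vtensor ::
  "('k::field, 'a::ab_group_add, 'm) vspace_scheme \<Rightarrow> ('k, 'b::ab_group_add, 'n) vspace_scheme
    \<Rightarrow> ('k, ('k, 'a, 'b) tensor) vspace"  (infixl \<open>\<otimes>\<^sub>v\<close> 70) where
  "V \<otimes>\<^sub>v W = \<lparr>car = module.span fscl {tens V W v w | v w. v \<in> car V \<and> w \<in> car W}, scl = fscl\<rparr>"

text \<open>Only meaningful if \<open>f\<close> is bilinear on the carriers, see \<open>tensor_universal\<close>.\<close>

definition tlift ::
  "('k::field, 'a::ab_group_add, 'm) vspace_scheme \<Rightarrow> ('k, 'b::ab_group_add, 'n) vspace_scheme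
    \<Rightarrow> ('k, 'c::ab_group_add, 'p) vspace_scheme \<Rightarrow> ('a \<Rightarrow> 'b \<Rightarrow> 'c)
    \<Rightarrow> ('k, 'a, 'b) tensor \<Rightarrow> 'c" where
  "tlift V W X f =
     (THE F. F \<in> lhom (V \<otimes>\<^sub>v W) X \<and> (\<forall>v\<in>car V. \<forall>w\<in>car W. F (tens V W v w) = f v w))"

lemma vector_space_fscl: "vector_space (fscl :: 'k::field \<Rightarrow> ('x \<Rightarrow> 'k) \<Rightarrow> 'x \<Rightarrow> 'k)"
  by standard (auto simp: fscl_def fun_eq_iff algebra_simps)

lemma vector_space_field: "vector_space ((*) :: 'k::field \<Rightarrow> 'k \<Rightarrow> 'k)"
  by standard (auto simp: algebra_simps)

lemma is_vspace_vtensor: "is_vspace (V \<otimes>\<^sub>v W)"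
proof -
  interpret vector_space fscl by (rule vector_space_fscl)
  show ?thesis
    by (simp add: is_vspace_def vtensor_def vector_space_fscl subspace_span)
qed

lemma tens_mem: "v \<in> car V \<Longrightarrow> w \<in> car W \<Longrightarrow> tens V W v w \<in> car (V \<otimes>\<^sub>v W)"
proof -
  interpret vector_space fscl by (rule vector_space_fscl)
  assume "v \<in> car V" "w \<in> car W"
  then show ?thesis by (auto simp: vtensor_def intro!: span_base)
qed

lemma tens_bilinear: "bilinear_on V W (V \<otimes>\<^sub>v W) (tens V W)"
  unfolding bilinear_on_def linear_on_def using tens_mem[of _ V _ W]
  by (auto simp: vtensor_def tens_def fscl_def base_field_def fun_eq_iff
      bilinear_on_def linear_on_def)

lemma vtensor_induct [consumes 1, case_names zero step]:
  assumes "t \<in> car (V \<otimes>\<^sub>v W)"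
    and "P 0"
    and "\<And>c v w t. v \<in> car V \<Longrightarrow> w \<in> car W \<Longrightarrow> t \<in> car (V \<otimes>\<^sub>v W) \<Longrightarrow> P t
           \<Longrightarrow> P (fscl c (tens V W v w) + t)"
  shows "P t"
proof -
  interpret vector_space fscl by (rule vector_space_fscl)
  let ?S = "{tens V W v w | v w. v \<in> car V \<and> w \<in> car W}"
  from assms(1) have "t \<in> span ?S" by (simp add: vtensor_def)
  then have "t \<in> span ?S \<and> P t"
  proof (induction rule: span_induct_alt)
    case base
    show ?case by (intro conjI span_zero assms(2))
  next
    case (step c x y)
    then obtain v w where x: "x = tens V W v w" "v \<in> car V" "w \<in> car W" by blast
    have y: "y \<in> car (V \<otimes>\<^sub>v W)" using step by (simp add: vtensor_def)
    have "P (fscl c x + y)" using assms(3)[of v w y c] x y step by blast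
    moreover have "fscl c x + y \<in> span ?S"
      using step by (blast intro: span_add span_scale span_base)
    ultimately show ?case by blast
  qed
  then show ?thesis ..
qed

lemma functionals_separate:
  fixes s :: "'k::field \<Rightarrow> 'a::ab_group_add \<Rightarrow> 'a"
  assumes "vector_space s" and "\<And>g. Vector_Spaces.linear s (*) g \<Longrightarrow> g x = (g y :: 'k)"
  shows "x = y"
proof (rule ccontr)
  assume "x \<noteq> y"
  interpret A: vector_space s by fact
  interpret K: vector_space "(*) :: 'k \<Rightarrow> 'k \<Rightarrow> 'k" by (rule vector_space_field)
  interpret vector_space_pair s "(*) :: 'k \<Rightarrow> 'k \<Rightarrow> 'k" ..
  have "A.independent {x - y}" using \<open>x \<noteq> y\<close> by simp
  from linear_independent_extend[OF this, of "\<lambda>_. 1"]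
  obtain g where g: "Vector_Spaces.linear s (*) g" "g (x - y) = (1::'k)" by auto
  have "g (x - y) = g x - g y" by (rule linear_diff[OF g(1)])
  with assms(2)[OF g(1)] g(2) show False by simp
qed

theorem tensor_universal:
  assumes V: "is_vspace V" and W: "is_vspace W" and X: "is_vspace X"
    and f: "bilinear_on V W X f"
  shows "\<exists>!F. F \<in> lhom (V \<otimes>\<^sub>v W) X \<and> (\<forall>v\<in>car V. \<forall>w\<in>car W. F (tens V W v w) = f v w)"
proof (rule ex_ex1I)
  interpret T: vector_space fscl by (rule vector_space_fscl)
  interpret X: vector_space "scl X" using X by (simp add: is_vspace_def)
  have subX: "X.subspace (car X)" using X by (simp add: is_vspace_def)
  have subT: "T.subspace (car (V \<otimes>\<^sub>v W))" by (simp add: vtensor_def T.subspace_span)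
  let ?lin = "Vector_Spaces.linear (scl X) (*)"
  define R where "R t x \<longleftrightarrow> x \<in> car X \<and> (\<forall>g. ?lin g \<longrightarrow> g x = t (\<lambda>v w. g (f v w)))" for t x
  have bil: "bilinear_on V W base_field (\<lambda>v w. g (f v w))" if "?lin g" for g
  proof -
    interpret g: Vector_Spaces.linear "scl X" "(*)" g by fact
    show ?thesis using f
      by (auto simp: bilinear_on_def linear_on_def base_field_def g.add g.scale)
  qed
  have R_unique: "x = y" if "R t x" "R t y" for t x y
  proof (rule functionals_separate[OF X.vector_space_axioms])
    fix g assume "?lin g"
    with that have "g x = t (\<lambda>v w. g (f v w))" "g y = t (\<lambda>v w. g (f v w))"
      unfolding R_def by blast+
    then show "g x = g y" by (rule trans[OF _ sym])
  qed
  have R_zero: "R 0 0"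
  proof -
    have "g 0 = 0" if "?lin g" for g
    proof -
      interpret g: Vector_Spaces.linear "scl X" "(*)" g by fact
      show ?thesis by (rule g.zero)
    qed
    then show ?thesis by (auto simp: R_def X.subspace_0[OF subX])
  qed
  have R_add: "R (s + t) (x + y)" if "R s x" "R t y" for s t x y
  proof -
    have "g (x + y) = g x + g y" if "?lin g" for g
    proof -
      interpret g: Vector_Spaces.linear "scl X" "(*)" g by fact
      show ?thesis by (rule g.add)
    qed
    then show ?thesis using that by (auto simp: R_def X.subspace_add[OF subX])
  qed
  have R_scale: "R (fscl c t) (scl X c x)" if "R t x" for t c x
  proof -
    have "g (scl X c x) = c * g x" if "?lin g" for g
    proof -
      interpret g: Vector_Spaces.linear "scl X" "(*)" g by fact
      show ?thesis by (rule g.scale)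
    qed
    then show ?thesis using that by (auto simp: R_def fscl_def X.subspace_scale[OF subX])
  qed
  have R_tens: "R (tens V W v w) (f v w)" if "v \<in> car V" "w \<in> car W" for v w
    using that f bil by (auto simp: R_def tens_def bilinear_on_def linear_on_def)
  have R_ex: "\<exists>x. R t x" if "t \<in> car (V \<otimes>\<^sub>v W)" for t
    using that
  proof (induction rule: vtensor_induct)
    case zero
    show ?case using R_zero by blast
  next
    case (step c v w t)
    then show ?case using R_add R_scale R_tens by blast
  qed
  define F where "F t = (if t \<in> car (V \<otimes>\<^sub>v W) then THE x. R t x else 0)" for t
  have RF: "R t (F t)" if "t \<in> car (V \<otimes>\<^sub>v W)" for t
    using R_ex[OF that] R_unique theI[of "R t"] that by (auto simp: F_def)
  have F_eq: "F t = x" if "t \<in> car (V \<otimes>\<^sub>v W)" "R t x" for t x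
    using RF[OF that(1)] that(2) R_unique by blast
  have "F \<in> lhom (V \<otimes>\<^sub>v W) X"
    unfolding lhom_def linear_on_def
  proof (intro CollectI conjI ballI allI impI)
    fix t assume t: "t \<in> car (V \<otimes>\<^sub>v W)"
    show "F t \<in> car X" using RF[OF t] by (simp add: R_def)
    show "F (s + t) = F s + F t" if "s \<in> car (V \<otimes>\<^sub>v W)" for s
      using that t by (intro F_eq R_add RF T.subspace_add[OF subT])
    show "F (scl (V \<otimes>\<^sub>v W) c t) = scl X c (F t)" for c
    proof -
      have "scl (V \<otimes>\<^sub>v W) = fscl" by (simp add: vtensor_def)
      then show ?thesis using t by (auto intro!: F_eq R_scale RF T.subspace_scale[OF subT])
    qed
  next
    fix t assume "t \<notin> car (V \<otimes>\<^sub>v W)"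
    then show "F t = 0" by (simp add: F_def)
  qed
  moreover have "\<forall>v\<in>car V. \<forall>w\<in>car W. F (tens V W v w) = f v w"
    by (intro ballI F_eq R_tens tens_mem)
  ultimately show "\<exists>F. F \<in> lhom (V \<otimes>\<^sub>v W) X \<and> (\<forall>v\<in>car V. \<forall>w\<in>car W. F (tens V W v w) = f v w)"
    by blast
next
  interpret T: vector_space fscl by (rule vector_space_fscl)
  have subT: "T.subspace (car (V \<otimes>\<^sub>v W))" by (simp add: vtensor_def T.subspace_span)
  have sclT: "scl (V \<otimes>\<^sub>v W) = fscl" by (simp add: vtensor_def)
  fix F G
  assume "F \<in> lhom (V \<otimes>\<^sub>v W) X \<and> (\<forall>v\<in>car V. \<forall>w\<in>car W. F (tens V W v w) = f v w)"
    and "G \<in> lhom (V \<otimes>\<^sub>v W) X \<and> (\<forall>v\<in>car V. \<forall>w\<in>car W. G (tens V W v w) = f v w)"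
  then have F: "F \<in> lhom (V \<otimes>\<^sub>v W) X" and G: "G \<in> lhom (V \<otimes>\<^sub>v W) X"
    and FG: "\<And>v w. v \<in> car V \<Longrightarrow> w \<in> car W \<Longrightarrow> F (tens V W v w) = G (tens V W v w)"
    by auto
  have H0: "H 0 = 0" if "H \<in> lhom (V \<otimes>\<^sub>v W) X" for H
  proof -
    have "0 \<in> car (V \<otimes>\<^sub>v W)" by (rule T.subspace_0[OF subT])
    then have "H (0 + 0) = H 0 + H 0" using that unfolding lhom_def linear_on_def by blast
    then show ?thesis by simp
  qed
  have "F t = G t" if "t \<in> car (V \<otimes>\<^sub>v W)" for t
    using that
  proof (induction rule: vtensor_induct)
    case zero
    show ?case by (rule trans[OF H0[OF F] H0[OF G, symmetric]])
  next
    case (step c v w t)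
    have m: "tens V W v w \<in> car (V \<otimes>\<^sub>v W)" by (rule tens_mem) fact+
    have "H (fscl c (tens V W v w) + t) = scl X c (H (tens V W v w)) + H t"
      if "H \<in> lhom (V \<otimes>\<^sub>v W) X" for H
      using that m step.hyps(3) T.subspace_scale[OF subT m]
      unfolding lhom_def linear_on_def sclT by auto
    from this[OF F] this[OF G] show ?case by (simp only: FG[OF step.hyps(1,2)] step.IH)
  qed
  moreover have "F t = G t" if "t \<notin> car (V \<otimes>\<^sub>v W)" for t
    using F G that by (simp add: lhom_def)
  ultimately show "F = G" by blast
qed


section \<open>Algebras, coalgebras and their tensor products\<close>

text \<open>
  One record carries both an algebra and a coalgebra signature.  The algebra predicates below only
  refer to \<open>amult\<close> and \<open>aone\<close>, the coalgebra predicates only to \<open>comult\<close> and \<open>counit\<close>.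
  The multiplication is given as a bilinear map; \<open>mlin\<close> and \<open>ulin\<close> are the corresponding linear maps
  on the tensor square and on the base field.
\<close>

record ('k, 'a) bistruct = "('k, 'a) vspace" +
  amult :: "'a \<Rightarrow> 'a \<Rightarrow> 'a"
  aone :: 'a
  comult :: "'a \<Rightarrow> ('k, 'a) tensor2"
  counit :: "'a \<Rightarrow> 'k"

definition ground :: "('k::field, 'k) bistruct" where
  "ground = \<lparr>car = UNIV, scl = (*), amult = (*), aone = 1,
     comult = (\<lambda>c. fscl c (tens base_field base_field 1 1)), counit = (\<lambda>c. c)\<rparr>"

definition btensor ::
  "('k::field, 'a::ab_group_add) bistruct \<Rightarrow> ('k, 'b::ab_group_add) bistruct
    \<Rightarrow> ('k, ('k, 'a, 'b) tensor) bistruct"  (infixl \<open>\<otimes>\<^sub>b\<close> 70) where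
  "A \<otimes>\<^sub>b B = (let T = A \<otimes>\<^sub>v B; TT = T \<otimes>\<^sub>v T in
     \<lparr>car = car T, scl = scl T,
      amult = (\<lambda>s t. tlift A B T (\<lambda>a b. tlift A B T
                 (\<lambda>a' b'. tens A B (amult A a a') (amult B b b')) t) s),
      aone = tens A B (aone A) (aone B),
      comult = tlift A B TT (\<lambda>a b. tlift A A TT (\<lambda>a1 a2. tlift B B TT
                 (\<lambda>b1 b2. tens T T (tens A B a1 b1) (tens A B a2 b2)) (comult B b)) (comult A a)),
      counit = tlift A B base_field (\<lambda>a b. counit A a * counit B b)\<rparr>)"

text \<open>Iterated tensor powers are bracketed to the left.\<close>

definition tens3 ::
  "('k::field, 'a::ab_group_add, 'm) vspace_scheme \<Rightarrow> 'a \<Rightarrow> 'a \<Rightarrow> 'a \<Rightarrow> ('k, 'a) tensor3" where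
  "tens3 V x y z = tens (V \<otimes>\<^sub>v V) V (tens V V x y) z"

definition tens4 ::
  "('k::field, 'a::ab_group_add, 'm) vspace_scheme \<Rightarrow> 'a \<Rightarrow> 'a \<Rightarrow> 'a \<Rightarrow> 'a \<Rightarrow> ('k, 'a) tensor4" where
  "tens4 V x y z w = tens (V \<otimes>\<^sub>v V \<otimes>\<^sub>v V) V (tens3 V x y z) w"

definition tlift3 ::
  "('k::field, 'a::ab_group_add, 'm) vspace_scheme \<Rightarrow> ('k, 'c::ab_group_add, 'p) vspace_scheme
    \<Rightarrow> ('a \<Rightarrow> 'a \<Rightarrow> 'a \<Rightarrow> 'c) \<Rightarrow> ('k, 'a) tensor3 \<Rightarrow> 'c" where
  "tlift3 V X f = tlift (V \<otimes>\<^sub>v V) V X (\<lambda>t z. tlift V V X (\<lambda>x y. f x y z) t)"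

definition tlift4 ::
  "('k::field, 'a::ab_group_add, 'm) vspace_scheme \<Rightarrow> ('k, 'c::ab_group_add, 'p) vspace_scheme
    \<Rightarrow> ('a \<Rightarrow> 'a \<Rightarrow> 'a \<Rightarrow> 'a \<Rightarrow> 'c) \<Rightarrow> ('k, 'a) tensor4 \<Rightarrow> 'c" where
  "tlift4 V X f = tlift (V \<otimes>\<^sub>v V \<otimes>\<^sub>v V) V X (\<lambda>t w. tlift3 V X (\<lambda>x y z. f x y z w) t)"

definition tmap2 ::
  "('k::field, 'a::ab_group_add, 'm) vspace_scheme \<Rightarrow> ('k, 'b::ab_group_add, 'n) vspace_scheme
    \<Rightarrow> ('a \<Rightarrow> 'b) \<Rightarrow> ('k, 'a) tensor2 \<Rightarrow> ('k, 'b) tensor2" where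
  "tmap2 V W f = tlift V V (W \<otimes>\<^sub>v W) (\<lambda>x y. tens W W (f x) (f y))"

definition tmap3 ::
  "('k::field, 'a::ab_group_add, 'm) vspace_scheme \<Rightarrow> ('k, 'b::ab_group_add, 'n) vspace_scheme
    \<Rightarrow> ('a \<Rightarrow> 'b) \<Rightarrow> ('k, 'a) tensor3 \<Rightarrow> ('k, 'b) tensor3" where
  "tmap3 V W f = tlift3 V (W \<otimes>\<^sub>v W \<otimes>\<^sub>v W) (\<lambda>x y z. tens3 W (f x) (f y) (f z))"

definition mlin :: "('k::field, 'a::ab_group_add) bistruct \<Rightarrow> ('k, 'a) tensor2 \<Rightarrow> 'a" where
  "mlin A = tlift A A A (amult A)"

definition ulin :: "('k::field, 'a::ab_group_add) bistruct \<Rightarrow> 'k \<Rightarrow> 'a" where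
  "ulin A = (\<lambda>c. scl A c (aone A))"

definition nonassoc_algebra :: "('k::field, 'a::ab_group_add) bistruct \<Rightarrow> bool" where
  "nonassoc_algebra A \<longleftrightarrow> is_vspace A \<and> bilinear_on A A A (amult A) \<and> aone A \<in> car A \<and>
     (\<forall>a\<in>car A. amult A (aone A) a = a \<and> amult A a (aone A) = a)"

definition assoc_algebra :: "('k::field, 'a::ab_group_add) bistruct \<Rightarrow> bool" where
  "assoc_algebra A \<longleftrightarrow> nonassoc_algebra A \<and>
     (\<forall>a\<in>car A. \<forall>b\<in>car A. \<forall>c\<in>car A. amult A (amult A a b) c = amult A a (amult A b c))"

definition invertible_in :: "('k::field, 'a::ab_group_add) bistruct \<Rightarrow> 'a \<Rightarrow> bool" where
  "invertible_in A a \<longleftrightarrow> a \<in> car A \<and> (\<exists>b\<in>car A. amult A a b = aone A \<and> amult A b a = aone A)"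

definition comult_left ::
  "('k::field, 'a::ab_group_add) bistruct \<Rightarrow> ('k, 'a) tensor2 \<Rightarrow> ('k, 'a) tensor3" where
  "comult_left C = tlift C C (C \<otimes>\<^sub>v C \<otimes>\<^sub>v C) (\<lambda>a b.
     tlift C C (C \<otimes>\<^sub>v C \<otimes>\<^sub>v C) (\<lambda>a1 a2. tens3 C a1 a2 b) (comult C a))"

definition comult_right ::
  "('k::field, 'a::ab_group_add) bistruct \<Rightarrow> ('k, 'a) tensor2 \<Rightarrow> ('k, 'a) tensor3" where
  "comult_right C = tlift C C (C \<otimes>\<^sub>v C \<otimes>\<^sub>v C) (\<lambda>a b.
     tlift C C (C \<otimes>\<^sub>v C \<otimes>\<^sub>v C) (\<lambda>b1 b2. tens3 C a b1 b2) (comult C b))"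

definition noncoassoc_coalgebra :: "('k::field, 'a::ab_group_add) bistruct \<Rightarrow> bool" where
  "noncoassoc_coalgebra C \<longleftrightarrow> is_vspace C \<and>
     comult C \<in> lhom C (C \<otimes>\<^sub>v C) \<and> counit C \<in> lhom C base_field \<and>
     (\<forall>c\<in>car C. tlift C C C (\<lambda>a b. scl C (counit C a) b) (comult C c) = c \<and>
                tlift C C C (\<lambda>a b. scl C (counit C b) a) (comult C c) = c)"

definition coassoc_coalgebra :: "('k::field, 'a::ab_group_add) bistruct \<Rightarrow> bool" where
  "coassoc_coalgebra C \<longleftrightarrow> noncoassoc_coalgebra C \<and>
     (\<forall>c\<in>car C. comult_left C (comult C c) = comult_right C (comult C c))"

definition algebra_hom ::
  "('k::field, 'a::ab_group_add) bistruct \<Rightarrow> ('k, 'b::ab_group_add) bistruct \<Rightarrow> ('a \<Rightarrow> 'b) set" where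
  "algebra_hom A B = {f \<in> lhom A B. f (aone A) = aone B \<and>
     (\<forall>a\<in>car A. \<forall>a'\<in>car A. f (amult A a a') = amult B (f a) (f a'))}"

definition coalgebra_hom ::
  "('k::field, 'a::ab_group_add) bistruct \<Rightarrow> ('k, 'b::ab_group_add) bistruct \<Rightarrow> ('a \<Rightarrow> 'b) set" where
  "coalgebra_hom C D = {f \<in> lhom C D. (\<forall>c\<in>car C. counit D (f c) = counit C c \<and>
     comult D (f c) = tmap2 C D f (comult C c))}"

definition NAlgCoalg :: "('k::field, 'a::ab_group_add) bistruct set" where
  "NAlgCoalg = {C. coassoc_coalgebra C \<and> nonassoc_algebra C \<and>
     mlin C \<in> coalgebra_hom (C \<otimes>\<^sub>b C) C \<and> ulin C \<in> coalgebra_hom ground C}"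

definition NCoalgAlg :: "('k::field, 'a::ab_group_add) bistruct set" where
  "NCoalgAlg = {A. assoc_algebra A \<and> noncoassoc_coalgebra A \<and>
     comult A \<in> algebra_hom A (A \<otimes>\<^sub>b A) \<and> counit A \<in> algebra_hom A ground}"

text \<open>\<open>NAlgCoalg\<close> and \<open>NCoalgAlg\<close> share the same notion of morphism.\<close>

definition bihom ::
  "('k::field, 'a::ab_group_add) bistruct \<Rightarrow> ('k, 'b::ab_group_add) bistruct \<Rightarrow> ('a \<Rightarrow> 'b) set" where
  "bihom A B = algebra_hom A B \<inter> coalgebra_hom A B"

definition conv ::
  "('k::field, 'a::ab_group_add) bistruct \<Rightarrow> ('k, 'b::ab_group_add) bistruct
    \<Rightarrow> ('a \<Rightarrow> 'b) \<Rightarrow> ('a \<Rightarrow> 'b) \<Rightarrow> 'a \<Rightarrow> 'b" where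
  "conv C A f g = (\<lambda>x. tlift C C A (\<lambda>x1 x2. amult A (f x1) (g x2)) (comult C x))"

definition conv_invertible :: "('k::field, 'a::ab_group_add) bistruct \<Rightarrow> ('a \<Rightarrow> 'k) \<Rightarrow> bool" where
  "conv_invertible C f \<longleftrightarrow> f \<in> lhom C base_field \<and>
     (\<exists>g\<in>lhom C base_field. conv C ground f g = counit C \<and> conv C ground g f = counit C)"


section \<open>The finite dual\<close>

definition dual_subspace :: "('a \<Rightarrow> 'k::field) set \<Rightarrow> ('k, 'a \<Rightarrow> 'k) vspace" where
  "dual_subspace S = \<lparr>car = S, scl = fscl\<rparr>"

text \<open>
  For a subspace \<open>V\<close> of the dual of \<open>A\<close>: the canonical injection of the tensor square of the dual of \<open>A\<close>
  into the dual of \<open>A \<otimes> A\<close>, precomposed with the map induced by the inclusion of \<open>V\<close>.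
\<close>

definition phi ::
  "('k::field, 'a::ab_group_add, 'm) vspace_scheme \<Rightarrow> ('k, 'a \<Rightarrow> 'k, 'n) vspace_scheme
    \<Rightarrow> ('k, 'a \<Rightarrow> 'k) tensor2 \<Rightarrow> ('k, 'a) tensor2 \<Rightarrow> 'k" where
  "phi A V = tlift V V (dual (A \<otimes>\<^sub>v A)) (\<lambda>f g. tlift A A base_field (\<lambda>a b. f a * g b))"

definition good :: "('k::field, 'a::ab_group_add) bistruct \<Rightarrow> ('a \<Rightarrow> 'k) set \<Rightarrow> bool" where
  "good A S \<longleftrightarrow> S \<subseteq> car (dual A) \<and> module.subspace fscl S \<and>
     (\<forall>f\<in>S. f \<circ> mlin A \<in>
        phi A (dual_subspace S) ` car (dual_subspace S \<otimes>\<^sub>v dual_subspace S))"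

definition bullet_space :: "('k::field, 'a::ab_group_add) bistruct \<Rightarrow> ('k, 'a \<Rightarrow> 'k) vspace" where
  "bullet_space A = dual_subspace (module.span fscl (\<Union>{S. good A S}))"

text \<open>
  On objects, both contravariant functors are given by the same formulas; for an associative
  algebra \<open>A\<close>, \<open>bullet A\<close> is the structure usually written with a small circle instead of a bullet.
\<close>

definition bullet ::
  "('k::field, 'a::ab_group_add) bistruct \<Rightarrow> ('k, 'a \<Rightarrow> 'k) bistruct" where
  "bullet A = (let D = bullet_space A in
     \<lparr>car = car D, scl = scl D,
      amult = conv A ground,
      aone = counit A,
      comult = (\<lambda>f. if f \<in> car D then (THE t. t \<in> car (D \<otimes>\<^sub>v D) \<and> phi A D t = f \<circ> mlin A) else 0),
      counit = (\<lambda>f. if f \<in> car D then f (aone A) else 0)\<rparr>)"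

abbreviation (input) circ ::
  "('k::field, 'a::ab_group_add) bistruct \<Rightarrow> ('k, 'a \<Rightarrow> 'k) bistruct" where
  "circ A \<equiv> bullet A"

text \<open>
  The transpose of a map \<open>f\<close> with codomain \<open>B\<close>, restricted to the finite dual of \<open>B\<close>.
\<close>

definition transpose_map ::
  "('k::field, 'b::ab_group_add) bistruct \<Rightarrow> ('a \<Rightarrow> 'b) \<Rightarrow> ('b \<Rightarrow> 'k) \<Rightarrow> 'a \<Rightarrow> 'k" where
  "transpose_map B f = (\<lambda>h. if h \<in> car (bullet B) then h \<circ> f else 0)"

text \<open>Evaluation: the unit \<open>\<xi>\<close> and the counit \<open>\<vartheta>\<close> of the adjunction are both of this form.\<close>

definition evaluation ::
  "('k::field, 'a::ab_group_add) bistruct \<Rightarrow> 'a \<Rightarrow> ('a \<Rightarrow> 'k) \<Rightarrow> 'k" where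
  "evaluation A = (\<lambda>a f. if f \<in> car (bullet A) then f a else 0)"

text \<open>The adjunct of a map into (a subspace of) a dual: exchange of the two arguments.\<close>

definition adjunct :: "('a \<Rightarrow> 'b \<Rightarrow> 'k) \<Rightarrow> 'b \<Rightarrow> 'a \<Rightarrow> 'k" where
  "adjunct f = (\<lambda>x a. f a x)"


section \<open>Quasi-bialgebras and dual quasi-bialgebras\<close>

definition QBialg :: "(('k::field, 'a::ab_group_add) bistruct \<times> ('k, 'a) tensor3) set" where
  "QBialg = {(H, \<Phi>). H \<in> NCoalgAlg \<and>
     (let H2 = H \<otimes>\<^sub>b H; H3 = H \<otimes>\<^sub>b H \<otimes>\<^sub>b H; H4 = H \<otimes>\<^sub>b H \<otimes>\<^sub>b H \<otimes>\<^sub>b H;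
          \<Delta> = comult H; \<epsilon> = counit H; e = aone H in
      invertible_in H3 \<Phi> \<and>
      amult H4
        (tlift3 H H4 (\<lambda>a b c. tlift H H H4 (\<lambda>c1 c2. tens4 H a b c1 c2) (\<Delta> c)) \<Phi>)
        (tlift3 H H4 (\<lambda>a b c. tlift H H H4 (\<lambda>a1 a2. tens4 H a1 a2 b c) (\<Delta> a)) \<Phi>)
      = amult H4
         (amult H4
           (tlift3 H H4 (\<lambda>a b c. tens4 H e a b c) \<Phi>)
           (tlift3 H H4 (\<lambda>a b c. tlift H H H4 (\<lambda>b1 b2. tens4 H a b1 b2 c) (\<Delta> b)) \<Phi>))
         (tlift3 H H4 (\<lambda>a b c. tens4 H a b c e) \<Phi>) \<and>
      tlift3 H H2 (\<lambda>a b c. fscl (\<epsilon> a) (tens H H b c)) \<Phi> = tens H H e e \<and>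
      tlift3 H H2 (\<lambda>a b c. fscl (\<epsilon> b) (tens H H a c)) \<Phi> = tens H H e e \<and>
      tlift3 H H2 (\<lambda>a b c. fscl (\<epsilon> c) (tens H H a b)) \<Phi> = tens H H e e \<and>
      (\<forall>h\<in>car H. amult H3 \<Phi> (comult_left H (\<Delta> h)) = amult H3 (comult_right H (\<Delta> h)) \<Phi>))}"

definition QBialg_hom ::
  "('k::field, 'a::ab_group_add) bistruct \<times> ('k, 'a) tensor3
    \<Rightarrow> ('k, 'b::ab_group_add) bistruct \<times> ('k, 'b) tensor3 \<Rightarrow> ('a \<Rightarrow> 'b) set" where
  "QBialg_hom X Y = {f \<in> bihom (fst X) (fst Y). tmap3 (fst X) (fst Y) f (snd X) = snd Y}"

definition DQBialg :: "(('k::field, 'a::ab_group_add) bistruct \<times> (('k, 'a) tensor3 \<Rightarrow> 'k)) set" where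
  "DQBialg = {(U, \<omega>). U \<in> NAlgCoalg \<and>
     (let U3 = U \<otimes>\<^sub>b U \<otimes>\<^sub>b U; U4 = U \<otimes>\<^sub>b U \<otimes>\<^sub>b U \<otimes>\<^sub>b U;
          m = amult U; \<epsilon> = counit U; e = aone U in
      conv_invertible U3 \<omega> \<and>
      conv U4 ground
        (\<omega> \<circ> tlift4 U U3 (\<lambda>x y z w. tens3 U x y (m z w)))
        (\<omega> \<circ> tlift4 U U3 (\<lambda>x y z w. tens3 U (m x y) z w))
      = conv U4 ground
         (conv U4 ground
           (tlift4 U base_field (\<lambda>x y z w. \<epsilon> x * \<omega> (tens3 U y z w)))
           (\<omega> \<circ> tlift4 U U3 (\<lambda>x y z w. tens3 U x (m y z) w)))
         (tlift4 U base_field (\<lambda>x y z w. \<omega> (tens3 U x y z) * \<epsilon> w)) \<and>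
      (\<forall>h\<in>car U. \<forall>k\<in>car U. \<forall>l\<in>car U. e \<in> {h, k, l} \<longrightarrow>
         \<omega> (tens3 U h k l) = \<epsilon> h * \<epsilon> k * \<epsilon> l) \<and>
      conv U3 U (ulin U \<circ> \<omega>) (tlift3 U U (\<lambda>x y z. m (m x y) z))
      = conv U3 U (tlift3 U U (\<lambda>x y z. m x (m y z))) (ulin U \<circ> \<omega>))}"

definition DQBialg_hom ::
  "('k::field, 'a::ab_group_add) bistruct \<times> (('k, 'a) tensor3 \<Rightarrow> 'k)
    \<Rightarrow> ('k, 'b::ab_group_add) bistruct \<times> (('k, 'b) tensor3 \<Rightarrow> 'k) \<Rightarrow> ('a \<Rightarrow> 'b) set" where
  "DQBialg_hom X Y = {g \<in> bihom (fst X) (fst Y). snd Y \<circ> tmap3 (fst X) (fst Y) g = snd X}"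

definition zeta ::
  "('k::field, 'a::ab_group_add) bistruct \<Rightarrow> ('k, 'a \<Rightarrow> 'k) tensor3 \<Rightarrow> ('k, 'a) tensor3 \<Rightarrow> 'k" where
  "zeta U = tlift3 (bullet U) (dual (U \<otimes>\<^sub>v U \<otimes>\<^sub>v U))
     (\<lambda>f g h. tlift3 U base_field (\<lambda>x y z. f x * g y * h z))"

definition splits ::
  "('k::field, 'a::ab_group_add) bistruct \<Rightarrow> (('k, 'a) tensor3 \<Rightarrow> 'k)
    \<Rightarrow> ('k, 'a \<Rightarrow> 'k) tensor3 \<Rightarrow> bool" where
  "splits U \<omega> \<Phi> \<longleftrightarrow> invertible_in (bullet U \<otimes>\<^sub>b bullet U \<otimes>\<^sub>b bullet U) \<Phi> \<and> zeta U \<Phi> = \<omega>"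

text \<open>The full subcategory of split dual quasi-bialgebras; its morphisms are \<open>DQBialg_hom\<close>.\<close>

definition SDQBialg :: "(('k::field, 'a::ab_group_add) bistruct \<times> (('k, 'a) tensor3 \<Rightarrow> 'k)) set" where
  "SDQBialg = {(U, \<omega>). (U, \<omega>) \<in> DQBialg \<and> (\<exists>\<Phi>. splits U \<omega> \<Phi>)}"

definition QBialg_circ ::
  "('k::field, 'a::ab_group_add) bistruct \<times> ('k, 'a) tensor3
    \<Rightarrow> ('k, 'a \<Rightarrow> 'k) bistruct \<times> (('k, 'a \<Rightarrow> 'k) tensor3 \<Rightarrow> 'k)" where
  "QBialg_circ = (\<lambda>(H, \<Phi>). (circ H,
     tlift3 (circ H) base_field (\<lambda>f g h. tlift3 H base_field (\<lambda>x y z. f x * g y * h z) \<Phi>)))"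

definition SDQBialg_bullet ::
  "('k::field, 'a::ab_group_add) bistruct \<times> (('k, 'a) tensor3 \<Rightarrow> 'k)
    \<Rightarrow> ('k, 'a \<Rightarrow> 'k) bistruct \<times> ('k, 'a \<Rightarrow> 'k) tensor3" where
  "SDQBialg_bullet = (\<lambda>(U, \<omega>). (bullet U, THE \<Phi>. splits U \<omega> \<Phi>))"

end

theory Submission
  imports Defs
begin

text \<open>
  A homomorphism \<open>A \<rightarrow> C\<^sup>\<bullet>\<close> is the same thing as a bilinear pairing of \<open>A\<close> and \<open>C\<close> under which the product of each
  side is dual to the coproduct of the other.  This notion is symmetric and needs neither associativity nor
  coassociativity, so exchanging the two arguments gives the adjunction.  Such a pairing extends to tensor
  powers, where it again turns products into convolution, and the extension is nondegenerate if the pairing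
  is.  An element \<open>\<Phi>\<close> of \<open>A\<^sup>\<otimes>\<^sup>3\<close> thus becomes a functional \<open>\<omega>\<close> on \<open>C\<^sup>\<otimes>\<^sup>3\<close>, each side of a quasi-bialgebra axiom
  for \<open>\<Phi>\<close> becomes the same side of the dual axiom for \<open>\<omega>\<close>, and nondegeneracy allows one to go back.  This is used
  for the pairings of \<open>H\<close> with \<open>H\<^sup>\<circ>\<close> and of \<open>U\<^sup>\<bullet>\<close> with \<open>U\<close>.
\<close>


section \<open>Vector spaces\<close>

text \<open>Nondegeneracy is one-sided throughout. Functionals in a finite dual are separated by the
  vectors they act on, but \<open>H\<^sup>\<circ>\<close> may be too small to separate the points of
  \<open>H\<close>. From \<Phi> to \<omega>, invertibility, pentagon and normalisation of \<omega>
  are statements about functionals and follow by evaluation; only quasi-associativity, an equation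
  between elements of the coalgebra, needs separation, and \<open>H\<close> separates
  \<open>H\<^sup>\<circ>\<close>. From \<omega> to \<Phi>, the axioms are equations between tensors
  over \<open>U\<^sup>\<bullet>\<close> and rest on nondegeneracy of tensor powers, whose proof
  expands tensors in a basis. Invertibility does not come back in this way: a convolution inverse of
  \<omega> is not known to be represented by a tensor over \<open>U\<^sup>\<bullet>\<close>. Hence
  the split objects, and hence the duty to show that the dual of a quasi-bialgebra is split, which
  is done by carrying \<Phi> and its inverse along the unit \<xi>. The remaining obstacle is
  membership in a finite dual; it is obtained by exhibiting a good subspace that contains the
  functional.\<close>

abbreviation (input) tpow2 :: "('k::field, 'a::ab_group_add, 'm) vspace_scheme \<Rightarrow> ('k, ('k, 'a) tensor2) vspace" where
  "tpow2 V \<equiv> V \<otimes>\<^sub>v V"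

abbreviation (input) tpow3 :: "('k::field, 'a::ab_group_add, 'm) vspace_scheme \<Rightarrow> ('k, ('k, 'a) tensor3) vspace" where
  "tpow3 V \<equiv> V \<otimes>\<^sub>v V \<otimes>\<^sub>v V"

abbreviation (input) tpow4 :: "('k::field, 'a::ab_group_add, 'm) vspace_scheme \<Rightarrow> ('k, ('k, 'a) tensor4) vspace" where
  "tpow4 V \<equiv> V \<otimes>\<^sub>v V \<otimes>\<^sub>v V \<otimes>\<^sub>v V"

abbreviation (input) bpow3 :: "('k::field, 'a::ab_group_add) bistruct \<Rightarrow> ('k, ('k, 'a) tensor3) bistruct" where
  "bpow3 A \<equiv> A \<otimes>\<^sub>b A \<otimes>\<^sub>b A"

abbreviation (input) bpow4 :: "('k::field, 'a::ab_group_add) bistruct \<Rightarrow> ('k, ('k, 'a) tensor4) bistruct" where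
  "bpow4 A \<equiv> A \<otimes>\<^sub>b A \<otimes>\<^sub>b A \<otimes>\<^sub>b A"

lemma vs_0: "is_vspace V \<Longrightarrow> 0 \<in> car V"
  and vs_add: "is_vspace V \<Longrightarrow> x \<in> car V \<Longrightarrow> y \<in> car V \<Longrightarrow> x + y \<in> car V"
  and vs_scl: "is_vspace V \<Longrightarrow> x \<in> car V \<Longrightarrow> scl V c x \<in> car V"
  and vs_minus: "is_vspace V \<Longrightarrow> x \<in> car V \<Longrightarrow> y \<in> car V \<Longrightarrow> x - y \<in> car V"
  and vs_sum: "is_vspace V \<Longrightarrow> (\<And>i. i \<in> I \<Longrightarrow> h i \<in> car V) \<Longrightarrow> sum h I \<in> car V"
  and scl_add_right: "is_vspace V \<Longrightarrow> scl V c (x + y) = scl V c x + scl V c y"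
  and scl_add_left: "is_vspace V \<Longrightarrow> scl V (c + d) x = scl V c x + scl V d x"
  and scl_scl: "is_vspace V \<Longrightarrow> scl V c (scl V d x) = scl V (c * d) x"
  and scl_one: "is_vspace V \<Longrightarrow> scl V 1 x = x"
proof -
  assume V: "is_vspace V"
  then interpret vector_space "scl V" by (simp add: is_vspace_def)
  have sub: "subspace (car V)" using V by (simp add: is_vspace_def)
  show "0 \<in> car V" by (rule subspace_0[OF sub])
  show "x \<in> car V \<Longrightarrow> y \<in> car V \<Longrightarrow> x + y \<in> car V" by (rule subspace_add[OF sub])
  show "x \<in> car V \<Longrightarrow> y \<in> car V \<Longrightarrow> x - y \<in> car V" by (rule subspace_diff[OF sub])
  show "x \<in> car V \<Longrightarrow> scl V c x \<in> car V" by (rule subspace_scale[OF sub])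
  show "(\<And>i. i \<in> I \<Longrightarrow> h i \<in> car V) \<Longrightarrow> sum h I \<in> car V" by (rule subspace_sum[OF sub])
  show "scl V c (x + y) = scl V c x + scl V c y" by (rule scale_right_distrib)
  show "scl V (c + d) x = scl V c x + scl V d x" by (rule scale_left_distrib)
  show "scl V c (scl V d x) = scl V (c * d) x" by simp
  show "scl V 1 x = x" by simp
qed

lemma is_vspace_base_field [simp]: "is_vspace base_field"
proof -
  interpret vector_space "(*) :: 'a \<Rightarrow> 'a \<Rightarrow> 'a" by (rule vector_space_field)
  show ?thesis by (simp add: is_vspace_def base_field_def vector_space_field)
qed

lemma car_base_field [simp]: "car base_field = UNIV"
  and scl_base_field [simp]: "scl base_field = (*)"
  by (simp_all add: base_field_def)

lemma car_ground [simp]: "car ground = UNIV"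
  and scl_ground [simp]: "scl ground = (*)"
  and amult_ground [simp]: "amult ground = (*)"
  and aone_ground [simp]: "aone ground = 1"
  and counit_ground [simp]: "counit ground = (\<lambda>c. c)"
  and comult_ground [simp]: "comult ground = (\<lambda>c. fscl c (tens base_field base_field 1 1))"
  by (simp_all add: ground_def)

declare is_vspace_vtensor [simp]

lemma scl_vtensor [simp]: "scl (V \<otimes>\<^sub>v W) = fscl"
  by (simp add: vtensor_def)

lemma fscl_apply [simp]: "fscl c f x = c * f x"
  by (simp add: fscl_def)


section \<open>Linear maps\<close>

lemma linear_onI:
  assumes "\<And>x. x \<in> car V \<Longrightarrow> f x \<in> car W"
    and "\<And>x y. x \<in> car V \<Longrightarrow> y \<in> car V \<Longrightarrow> f (x + y) = f x + f y"
    and "\<And>c x. x \<in> car V \<Longrightarrow> f (scl V c x) = scl W c (f x)"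
  shows "linear_on V W f"
  using assms by (simp add: linear_on_def)

lemma linear_on_mem: "linear_on V W f \<Longrightarrow> x \<in> car V \<Longrightarrow> f x \<in> car W"
  and linear_on_add: "linear_on V W f \<Longrightarrow> x \<in> car V \<Longrightarrow> y \<in> car V \<Longrightarrow> f (x + y) = f x + f y"
  and linear_on_scale: "linear_on V W f \<Longrightarrow> x \<in> car V \<Longrightarrow> f (scl V c x) = scl W c (f x)"
  by (simp_all add: linear_on_def)

lemma linear_on_zero: "linear_on V W f \<Longrightarrow> is_vspace V \<Longrightarrow> f 0 = 0"
  using linear_on_add[of V W f 0 0] vs_0[of V] by simp

lemma linear_on_diff:
  assumes "linear_on V W f" "is_vspace V" "x \<in> car V" "y \<in> car V"
  shows "f (x - y) = f x - f y"
  using linear_on_add[OF assms(1) vs_minus[OF assms(2-4)] assms(4)] by (simp add: algebra_simps)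

lemma linear_on_sum:
  assumes "linear_on V W f" "is_vspace V" "\<And>i. i \<in> I \<Longrightarrow> x i \<in> car V"
  shows "f (sum x I) = (\<Sum>i\<in>I. f (x i))"
  using assms(3)
proof (induction I rule: infinite_finite_induct)
  case (insert i I)
  then show ?case
    using linear_on_add[OF assms(1), of "x i" "sum x I"] vs_sum[OF assms(2), of I x] by simp
qed (simp_all add: linear_on_zero[OF assms(1,2)])

lemma linear_on_cong:
  assumes "\<And>x. x \<in> car V \<Longrightarrow> f x = g x" "is_vspace V"
  shows "linear_on V W f \<longleftrightarrow> linear_on V W g"
  using assms vs_add[OF assms(2)] vs_scl[OF assms(2)] by (simp add: linear_on_def)

lemma linear_on_id: "linear_on V V (\<lambda>x. x)"
  by (simp add: linear_on_def)

lemma linear_on_comp: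
  assumes "linear_on W X g" "linear_on V W f"
  shows "linear_on V X (\<lambda>x. g (f x))"
  using assms by (simp add: linear_on_def)

lemma linear_on_plus:
  assumes "is_vspace W" "linear_on V W f" "linear_on V W g"
  shows "linear_on V W (\<lambda>x. f x + g x)"
  using assms by (auto simp: linear_on_def vs_add scl_add_right algebra_simps)

lemma linear_on_scl:
  assumes "is_vspace W" "linear_on V W f"
  shows "linear_on V W (\<lambda>x. scl W c (f x))"
  using assms by (auto simp: linear_on_def vs_scl scl_add_right scl_scl mult.commute)

lemma linear_on_scl_left:
  assumes "is_vspace W" "linear_on V base_field f" "w \<in> car W"
  shows "linear_on V W (\<lambda>x. scl W (f x) w)"
  using assms by (auto simp: linear_on_def vs_scl scl_add_left scl_scl)

lemma linear_on_mult_left: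
  "linear_on V base_field f \<Longrightarrow> linear_on V base_field (\<lambda>x. c * f x)"
  and linear_on_mult_right:
  "linear_on V base_field f \<Longrightarrow> linear_on V base_field (\<lambda>x. f x * c)"
  by (simp_all add: linear_on_def algebra_simps)

lemma lhom_linear: "f \<in> lhom V W \<Longrightarrow> linear_on V W f"
  and lhom_outside: "f \<in> lhom V W \<Longrightarrow> x \<notin> car V \<Longrightarrow> f x = 0"
  by (simp_all add: lhom_def)

lemma lhom_eqI:
  assumes "f \<in> lhom V W" "g \<in> lhom V W" "\<And>x. x \<in> car V \<Longrightarrow> f x = g x"
  shows "f = g"
proof
  fix x show "f x = g x"
    using assms by (cases "x \<in> car V") (simp_all add: lhom_outside)
qed

lemma bilinear_onI:
  assumes "\<And>v. v \<in> car V \<Longrightarrow> linear_on W X (\<lambda>w. f v w)"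
    and "\<And>w. w \<in> car W \<Longrightarrow> linear_on V X (\<lambda>v. f v w)"
  shows "bilinear_on V W X f"
  using assms by (simp add: bilinear_on_def)

lemma bilinear_on_left: "bilinear_on V W X f \<Longrightarrow> w \<in> car W \<Longrightarrow> linear_on V X (\<lambda>v. f v w)"
  and bilinear_on_right: "bilinear_on V W X f \<Longrightarrow> v \<in> car V \<Longrightarrow> linear_on W X (\<lambda>w. f v w)"
  by (simp_all add: bilinear_on_def)

lemma bilinear_on_mem:
  "bilinear_on V W X f \<Longrightarrow> v \<in> car V \<Longrightarrow> w \<in> car W \<Longrightarrow> f v w \<in> car X"
  using bilinear_on_right linear_on_mem by blast

lemma bilinear_on_cong:
  assumes "\<And>v w. v \<in> car V \<Longrightarrow> w \<in> car W \<Longrightarrow> f v w = g v w" "is_vspace V" "is_vspace W"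
  shows "bilinear_on V W X f \<longleftrightarrow> bilinear_on V W X g"
proof -
  have "linear_on W X (f v) \<longleftrightarrow> linear_on W X (g v)" if "v \<in> car V" for v
    using that assms by (intro linear_on_cong) auto
  moreover have "linear_on V X (\<lambda>v. f v w) \<longleftrightarrow> linear_on V X (\<lambda>v. g v w)" if "w \<in> car W" for w
    using that assms by (intro linear_on_cong) auto
  ultimately show ?thesis by (simp add: bilinear_on_def)
qed

lemma bilinear_on_comp:
  assumes "bilinear_on V W X f" "linear_on X Y g"
  shows "bilinear_on V W Y (\<lambda>v w. g (f v w))"
  using assms by (auto simp: bilinear_on_def intro: linear_on_comp)

lemma bilinear_on_product:
  assumes "linear_on V base_field f" "linear_on W base_field g"
  shows "bilinear_on V W base_field (\<lambda>v w. f v * g w)"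
  using assms by (intro bilinear_onI linear_on_mult_left linear_on_mult_right)


section \<open>Maps out of tensor products\<close>

lemma linear_on_tens_left:
  "linear_on U V g \<Longrightarrow> w \<in> car W \<Longrightarrow> linear_on U (V \<otimes>\<^sub>v W) (\<lambda>u. tens V W (g u) w)"
  by (rule linear_on_comp[OF bilinear_on_left[OF tens_bilinear]])

lemma linear_on_tens_right:
  "linear_on U W g \<Longrightarrow> v \<in> car V \<Longrightarrow> linear_on U (V \<otimes>\<^sub>v W) (\<lambda>u. tens V W v (g u))"
  by (rule linear_on_comp[OF bilinear_on_right[OF tens_bilinear]])

lemma tensor_ext:
  assumes "linear_on (V \<otimes>\<^sub>v W) X F" "linear_on (V \<otimes>\<^sub>v W) X G"
    and "\<And>v w. v \<in> car V \<Longrightarrow> w \<in> car W \<Longrightarrow> F (tens V W v w) = G (tens V W v w)"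
    and "t \<in> car (V \<otimes>\<^sub>v W)"
  shows "F t = G t"
  using assms(4)
proof (induction rule: vtensor_induct)
  case zero
  show ?case by (rule trans[OF linear_on_zero[OF assms(1)] linear_on_zero[OF assms(2), symmetric]]) simp_all
next
  case (step c v w t)
  have s: "fscl c (tens V W v w) \<in> car (V \<otimes>\<^sub>v W)"
    using vs_scl[OF is_vspace_vtensor tens_mem[OF step(1,2)]] by simp
  have e: "H (fscl c (tens V W v w) + t) = scl X c (H (tens V W v w)) + H t"
    if "linear_on (V \<otimes>\<^sub>v W) X H" for H
    using linear_on_add[OF that s step(3)] linear_on_scale[OF that tens_mem[OF step(1,2)], of c]
    by simp
  show ?case by (simp only: e[OF assms(1)] e[OF assms(2)] step.IH assms(3)[OF step(1,2)])
qed

lemma tlift_cong: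
  assumes "\<And>v w. v \<in> car V \<Longrightarrow> w \<in> car W \<Longrightarrow> f v w = g v w"
  shows "tlift V W X f = tlift V W X g"
proof -
  have "(\<forall>v\<in>car V. \<forall>w\<in>car W. F (tens V W v w) = f v w) \<longleftrightarrow>
    (\<forall>v\<in>car V. \<forall>w\<in>car W. F (tens V W v w) = g v w)" for F
    using assms by auto
  then show ?thesis by (simp add: tlift_def)
qed

section \<open>Lifts of bilinear maps and evaluation of tensors on forms\<close>

context
  fixes V :: "('k::field, 'a::ab_group_add, 'm) vspace_scheme"
    and W :: "('k, 'b::ab_group_add, 'n) vspace_scheme"
  assumes V: "is_vspace V" and W: "is_vspace W"
begin

lemma
  fixes X :: "('k, 'c::ab_group_add, 'p) vspace_scheme"
  assumes "is_vspace X" "bilinear_on V W X f"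
  shows tlift_lhom: "tlift V W X f \<in> lhom (V \<otimes>\<^sub>v W) X"
    and tlift_tens: "v \<in> car V \<Longrightarrow> w \<in> car W \<Longrightarrow> tlift V W X f (tens V W v w) = f v w"
  using theI'[OF tensor_universal[OF V W assms]] unfolding tlift_def[symmetric] by auto

lemma tlift_linear:
  fixes X :: "('k, 'c::ab_group_add, 'p) vspace_scheme"
  assumes "is_vspace X" "bilinear_on V W X f"
  shows "linear_on (V \<otimes>\<^sub>v W) X (tlift V W X f)"
  by (rule lhom_linear[OF tlift_lhom[OF assms]])

lemma tlift_comp:
  fixes X :: "('k, 'c::ab_group_add, 'p) vspace_scheme"
    and Y :: "('k, 'd::ab_group_add, 'q) vspace_scheme"
  assumes "is_vspace X" "is_vspace Y" "bilinear_on V W X f" "linear_on X Y g" "t \<in> car (V \<otimes>\<^sub>v W)"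
  shows "g (tlift V W X f t) = tlift V W Y (\<lambda>v w. g (f v w)) t"
  using assms(5)
  by (rule tensor_ext[OF linear_on_comp[OF assms(4) tlift_linear[OF assms(1,3)]]
        tlift_linear[OF assms(2) bilinear_on_comp[OF assms(3,4)]], rotated])
    (simp add: assms tlift_tens bilinear_on_comp[OF assms(3,4)])

text \<open>Linear maps out of a tensor product agree once they agree on pure tensors, and on pure
  tensors the dependence on \<open>u\<close> is that of \<open>F\<close>. This keeps lifts inside
  lifts multilinear.\<close>

lemma tlift_param:
  fixes X :: "('k, 'c::ab_group_add, 'p) vspace_scheme"
    and U :: "('k, 'd::ab_group_add, 'q) vspace_scheme"
  assumes U: "is_vspace U" and X: "is_vspace X" and b: "\<And>u. u \<in> car U \<Longrightarrow> bilinear_on V W X (F u)"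
    and l: "\<And>v w. v \<in> car V \<Longrightarrow> w \<in> car W \<Longrightarrow> linear_on U X (\<lambda>u. F u v w)"
    and t: "t \<in> car (V \<otimes>\<^sub>v W)"
  shows "linear_on U X (\<lambda>u. tlift V W X (F u) t)"
proof (rule linear_onI)
  note lin = tlift_linear[OF X b]
  fix u assume u: "u \<in> car U"
  show "tlift V W X (F u) t \<in> car X" by (rule linear_on_mem[OF lin[OF u] t])
  show "tlift V W X (F (u + u')) t = tlift V W X (F u) t + tlift V W X (F u') t"
    if u': "u' \<in> car U" for u'
    by (rule tensor_ext[OF lin linear_on_plus[OF X lin lin] _ t])
      (simp_all add: u u' vs_add[OF U] tlift_tens X b linear_on_add[OF l])
  show "tlift V W X (F (scl U c u)) t = scl X c (tlift V W X (F u) t)" for c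
    by (rule tensor_ext[OF lin linear_on_scl[OF X lin] _ t])
      (simp_all add: u vs_scl[OF U] tlift_tens X b linear_on_scale[OF l])
qed

text \<open>
  Scalar-valued lifts are plain application of the tensor, because a tensor is a functional
  on bilinear forms.  Thus \<open>comult C x (\<lambda>x\<^sub>1 x\<^sub>2. \<dots>)\<close> serves as Sweedler notation.
\<close>

lemma tens_apply: "bilinear_on V W base_field \<beta> \<Longrightarrow> tens V W v w \<beta> = \<beta> v w"
  by (simp add: tens_def)

lemma tensor_apply_linear: "linear_on (V \<otimes>\<^sub>v W) base_field (\<lambda>t. t \<beta>)"
  by (rule linear_onI) simp_all

text \<open>Forms that agree on the carriers are bilinear together or not at all, and in the second
  case both give \<open>0\<close> on every pure tensor. Integrands in Sweedler notation can
  therefore be rewritten without checking bilinearity.\<close>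

lemma tensor_apply_cong:
  assumes "t \<in> car (V \<otimes>\<^sub>v W)" "\<And>v w. v \<in> car V \<Longrightarrow> w \<in> car W \<Longrightarrow> \<beta> v w = \<gamma> v w"
  shows "t \<beta> = t \<gamma>"
  using assms(1)
proof (rule tensor_ext[OF tensor_apply_linear tensor_apply_linear, rotated])
  show "tens V W v w \<beta> = tens V W v w \<gamma>" if "v \<in> car V" "w \<in> car W" for v w
    using that assms(2) bilinear_on_cong[of V W \<beta> \<gamma> base_field, OF _ V W] by (simp add: tens_def)
qed

lemma tlift_base:
  assumes "bilinear_on V W base_field \<beta>" "t \<in> car (V \<otimes>\<^sub>v W)"
  shows "tlift V W base_field \<beta> t = t \<beta>"
  by (rule tensor_ext[OF tlift_linear tensor_apply_linear _ assms(2)])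
    (simp_all add: assms tlift_tens tens_apply)

lemma tlift_apply:
  fixes X :: "('k, 'c::ab_group_add, 'p) vspace_scheme"
  assumes "is_vspace X" "bilinear_on V W X f" "linear_on X base_field g" "t \<in> car (V \<otimes>\<^sub>v W)"
  shows "g (tlift V W X f t) = t (\<lambda>v w. g (f v w))"
  using assms by (simp add: tlift_comp[where Y = base_field] tlift_base bilinear_on_comp)

lemma tensor_apply_param:
  fixes U :: "('k, 'd::ab_group_add, 'q) vspace_scheme"
  assumes "is_vspace U" "\<And>u. u \<in> car U \<Longrightarrow> bilinear_on V W base_field (F u)"
    and "\<And>v w. v \<in> car V \<Longrightarrow> w \<in> car W \<Longrightarrow> linear_on U base_field (\<lambda>u. F u v w)"
    and "t \<in> car (V \<otimes>\<^sub>v W)"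
  shows "linear_on U base_field (\<lambda>u. t (F u))"
  using tlift_param[OF assms(1) is_vspace_base_field assms(2-4)] assms
  by (subst linear_on_cong[where g = "\<lambda>u. tlift V W base_field (F u) t"]) (auto simp: tlift_base)

lemma tensor_apply_mult:
  assumes "bilinear_on V W base_field \<beta>" "t \<in> car (V \<otimes>\<^sub>v W)"
  shows "t (\<lambda>v w. c * \<beta> v w) = c * t \<beta>"
  using tlift_apply[OF is_vspace_base_field assms(1) linear_on_mult_left[OF linear_on_id] assms(2)]
  by (simp add: tlift_base assms)

end


section \<open>Independence of the record type of a space\<close>

text \<open>The constructions read only \<open>car\<close> and \<open>scl\<close>, so records of
  different extension types that agree in these two fields are interchangeable. The instances below
  let the simplifier replace \<open>A \<otimes>\<^sub>b B\<close> by
  \<open>A \<otimes>\<^sub>v B\<close> wherever only the underlying space matters, and likewise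
  \<open>ground\<close> by \<open>base_field\<close>.\<close>

lemma
  fixes V :: "('k::field, 'a::ab_group_add, 'm) vspace_scheme"
    and V' :: "('k, 'a, 'n) vspace_scheme"
    and U :: "('k, 'b::ab_group_add, 'u) vspace_scheme"
    and X :: "('k, 'c::ab_group_add, 'x) vspace_scheme"
  assumes "car V = car V'" "scl V = scl V'"
  shows linear_on_vs_cong: "linear_on V U = linear_on V' U" "linear_on U V = linear_on U V'"
    and lhom_vs_cong: "lhom V U = lhom V' U" "lhom U V = lhom U V'"
    and bilinear_on_vs_cong: "bilinear_on V U X = bilinear_on V' U X"
      "bilinear_on U V X = bilinear_on U V' X" "bilinear_on U X V = bilinear_on U X V'"
    and tens_vs_cong: "tens V U = tens V' U" "tens U V = tens U V'"
    and vtensor_vs_cong: "V \<otimes>\<^sub>v U = V' \<otimes>\<^sub>v U" "U \<otimes>\<^sub>v V = U \<otimes>\<^sub>v V'"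
    and tlift_vs_cong: "tlift V U X = tlift V' U X" "tlift U V X = tlift U V' X"
      "tlift U X V = tlift U X V'"
    and is_vspace_vs_cong: "is_vspace V = is_vspace V'"
proof -
  show l1: "linear_on V U = linear_on V' U"
    for U :: "('k, 'z::ab_group_add, 'u) vspace_scheme" using assms by (simp add: fun_eq_iff linear_on_def)
  show l2: "linear_on U V = linear_on U V'"
    for U :: "('k, 'z::ab_group_add, 'u) vspace_scheme" using assms by (simp add: fun_eq_iff linear_on_def)
  show h1: "lhom V U = lhom V' U" for U :: "('k, 'z::ab_group_add, 'u) vspace_scheme"
    using assms by (simp add: lhom_def l1)
  show h2: "lhom U V = lhom U V'" for U :: "('k, 'z::ab_group_add, 'u) vspace_scheme"
    using assms by (simp add: lhom_def l2)
  show b1: "bilinear_on V U X = bilinear_on V' U X"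
    for U :: "('k, 'z::ab_group_add, 'u) vspace_scheme" and X :: "('k, 'w::ab_group_add, 'x) vspace_scheme"
    using assms by (simp add: fun_eq_iff bilinear_on_def linear_on_def)
  show b2: "bilinear_on U V X = bilinear_on U V' X"
    for U :: "('k, 'z::ab_group_add, 'u) vspace_scheme" and X :: "('k, 'w::ab_group_add, 'x) vspace_scheme"
    using assms by (simp add: fun_eq_iff bilinear_on_def linear_on_def)
  show b3: "bilinear_on U X V = bilinear_on U X V'"
    using assms by (simp add: fun_eq_iff bilinear_on_def linear_on_def)
  show t1: "tens V U = tens V' U"
    using assms by (simp add: fun_eq_iff tens_def bilinear_on_def linear_on_def)
  show t2: "tens U V = tens U V'"
    using assms by (simp add: fun_eq_iff tens_def bilinear_on_def linear_on_def)
  show v1: "V \<otimes>\<^sub>v U = V' \<otimes>\<^sub>v U" by (simp add: vtensor_def t1 assms)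
  show v2: "U \<otimes>\<^sub>v V = U \<otimes>\<^sub>v V'" by (simp add: vtensor_def t2 assms)
  show "tlift V U X = tlift V' U X"
    by (simp add: fun_eq_iff tlift_def t1 v1 assms)
  show "tlift U V X = tlift U V' X"
    by (simp add: fun_eq_iff tlift_def t2 v2 assms)
  show "tlift U X V = tlift U X V'"
    using assms by (simp add: fun_eq_iff tlift_def lhom_def linear_on_def)
  show "is_vspace V = is_vspace V'" by (simp add: is_vspace_def assms)
qed

lemmas vs_congs = linear_on_vs_cong lhom_vs_cong bilinear_on_vs_cong tens_vs_cong vtensor_vs_cong
  tlift_vs_cong is_vspace_vs_cong

lemma car_btensor [simp]: "car (A \<otimes>\<^sub>b B) = car (A \<otimes>\<^sub>v B)"
  and scl_btensor [simp]: "scl (A \<otimes>\<^sub>b B) = fscl"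
  by (simp_all add: btensor_def Let_def)

lemmas btensor_vs [simp] =
  vs_congs[of "A \<otimes>\<^sub>b B" "A \<otimes>\<^sub>v B" for A B, OF car_btensor trans[OF scl_btensor scl_vtensor[symmetric]]]

lemmas ground_vs [simp] =
  vs_congs[of ground base_field, OF trans[OF car_ground car_base_field[symmetric]]
    trans[OF scl_ground scl_base_field[symmetric]]]


section \<open>Triple and quadruple tensor products\<close>

definition trilinear_on ::
  "('k::field, 'a::ab_group_add, 'm) vspace_scheme \<Rightarrow> ('k, 'c::ab_group_add, 'p) vspace_scheme
    \<Rightarrow> ('a \<Rightarrow> 'a \<Rightarrow> 'a \<Rightarrow> 'c) \<Rightarrow> bool" where
  "trilinear_on V X f \<longleftrightarrow>
     (\<forall>x\<in>car V. \<forall>y\<in>car V. linear_on V X (\<lambda>z. f x y z)) \<and>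
     (\<forall>x\<in>car V. \<forall>z\<in>car V. linear_on V X (\<lambda>y. f x y z)) \<and>
     (\<forall>y\<in>car V. \<forall>z\<in>car V. linear_on V X (\<lambda>x. f x y z))"

definition quadrilinear_on ::
  "('k::field, 'a::ab_group_add, 'm) vspace_scheme \<Rightarrow> ('k, 'c::ab_group_add, 'p) vspace_scheme
    \<Rightarrow> ('a \<Rightarrow> 'a \<Rightarrow> 'a \<Rightarrow> 'a \<Rightarrow> 'c) \<Rightarrow> bool" where
  "quadrilinear_on V X f \<longleftrightarrow>
     (\<forall>w\<in>car V. trilinear_on V X (\<lambda>x y z. f x y z w)) \<and>
     (\<forall>x\<in>car V. \<forall>y\<in>car V. \<forall>z\<in>car V. linear_on V X (\<lambda>w. f x y z w))"

lemma trilinear_onI: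
  assumes "\<And>x y. x \<in> car V \<Longrightarrow> y \<in> car V \<Longrightarrow> linear_on V X (\<lambda>z. f x y z)"
    and "\<And>x z. x \<in> car V \<Longrightarrow> z \<in> car V \<Longrightarrow> linear_on V X (\<lambda>y. f x y z)"
    and "\<And>y z. y \<in> car V \<Longrightarrow> z \<in> car V \<Longrightarrow> linear_on V X (\<lambda>x. f x y z)"
  shows "trilinear_on V X f"
  using assms by (simp add: trilinear_on_def)

lemma quadrilinear_onI:
  assumes "\<And>x y z. x \<in> car V \<Longrightarrow> y \<in> car V \<Longrightarrow> z \<in> car V \<Longrightarrow> linear_on V X (\<lambda>w. f x y z w)"
    and "\<And>x y w. x \<in> car V \<Longrightarrow> y \<in> car V \<Longrightarrow> w \<in> car V \<Longrightarrow> linear_on V X (\<lambda>z. f x y z w)"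
    and "\<And>x z w. x \<in> car V \<Longrightarrow> z \<in> car V \<Longrightarrow> w \<in> car V \<Longrightarrow> linear_on V X (\<lambda>y. f x y z w)"
    and "\<And>y z w. y \<in> car V \<Longrightarrow> z \<in> car V \<Longrightarrow> w \<in> car V \<Longrightarrow> linear_on V X (\<lambda>x. f x y z w)"
  shows "quadrilinear_on V X f"
  using assms by (simp add: quadrilinear_on_def trilinear_on_def)

lemma trilinear_on_bilinear:
  "trilinear_on V X f \<Longrightarrow> z \<in> car V \<Longrightarrow> bilinear_on V V X (\<lambda>x y. f x y z)"
  by (simp add: trilinear_on_def bilinear_on_def)

lemma trilinear_on_comp:
  assumes "trilinear_on V X f" "linear_on X Y g"
  shows "trilinear_on V Y (\<lambda>x y z. g (f x y z))"
  using assms by (auto simp: trilinear_on_def intro: linear_on_comp)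

lemma tens3_mem:
  "x \<in> car V \<Longrightarrow> y \<in> car V \<Longrightarrow> z \<in> car V \<Longrightarrow> tens3 V x y z \<in> car (tpow3 V)"
  by (simp add: tens3_def tens_mem)

lemma tens4_mem:
  "x \<in> car V \<Longrightarrow> y \<in> car V \<Longrightarrow> z \<in> car V \<Longrightarrow> w \<in> car V \<Longrightarrow>
    tens4 V x y z w \<in> car (tpow4 V)"
  by (simp add: tens4_def tens_mem tens3_mem)

lemma tens3_trilinear: "trilinear_on V (tpow3 V) (tens3 V)"
  unfolding tens3_def
  by (intro trilinear_onI linear_on_tens_left linear_on_tens_right linear_on_id tens_mem)

lemma tens4_quadrilinear: "quadrilinear_on V (tpow4 V) (tens4 V)"
  unfolding tens4_def tens3_def
  by (intro quadrilinear_onI linear_on_tens_left linear_on_tens_right linear_on_id tens_mem)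

lemma tlift3_cong:
  assumes "\<And>x y z. x \<in> car V \<Longrightarrow> y \<in> car V \<Longrightarrow> z \<in> car V \<Longrightarrow> f x y z = g x y z"
  shows "tlift3 V X f = tlift3 V X g"
  unfolding tlift3_def
proof (rule tlift_cong)
  show "tlift V V X (\<lambda>x y. f x y z) t = tlift V V X (\<lambda>x y. g x y z) t" if "z \<in> car V" for t z
    using assms that tlift_cong[of V V "\<lambda>x y. f x y z" "\<lambda>x y. g x y z" X] by simp
qed

context
  fixes V :: "('k::field, 'a::ab_group_add, 'm) vspace_scheme"
  assumes V: "is_vspace V"
begin

lemma tensor3_ext:
  assumes F: "linear_on (tpow3 V) X F" and G: "linear_on (tpow3 V) X G"
    and eq: "\<And>x y z. x \<in> car V \<Longrightarrow> y \<in> car V \<Longrightarrow> z \<in> car V \<Longrightarrow> F (tens3 V x y z) = G (tens3 V x y z)"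
    and t: "t \<in> car (tpow3 V)"
  shows "F t = G t"
proof (rule tensor_ext[OF F G _ t])
  fix s z assume s: "s \<in> car (tpow2 V)" and z: "z \<in> car V"
  have l: "linear_on (tpow2 V) (tpow3 V) (\<lambda>s. tens (tpow2 V) V s z)"
    by (rule linear_on_tens_left[OF linear_on_id z])
  show "F (tens (tpow2 V) V s z) = G (tens (tpow2 V) V s z)"
    by (rule tensor_ext[OF linear_on_comp[OF F l] linear_on_comp[OF G l] _ s])
      (use eq z in \<open>auto simp: tens3_def\<close>)
qed

lemma tensor4_ext:
  assumes F: "linear_on (tpow4 V) X F" and G: "linear_on (tpow4 V) X G"
    and eq: "\<And>x y z w. x \<in> car V \<Longrightarrow> y \<in> car V \<Longrightarrow> z \<in> car V \<Longrightarrow> w \<in> car V \<Longrightarrow>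
      F (tens4 V x y z w) = G (tens4 V x y z w)"
    and t: "t \<in> car (tpow4 V)"
  shows "F t = G t"
proof (rule tensor_ext[OF F G _ t])
  fix s z assume s: "s \<in> car (tpow3 V)" and z: "z \<in> car V"
  have l: "linear_on (tpow3 V) (tpow4 V) (\<lambda>s. tens (tpow3 V) V s z)"
    by (rule linear_on_tens_left[OF linear_on_id z])
  show "F (tens (tpow3 V) V s z) = G (tens (tpow3 V) V s z)"
    by (rule tensor3_ext[OF linear_on_comp[OF F l] linear_on_comp[OF G l] _ s])
      (use eq z in \<open>auto simp: tens4_def\<close>)
qed

lemma tlift3_bilinear:
  fixes X :: "('k, 'c::ab_group_add, 'p) vspace_scheme"
  assumes X: "is_vspace X" and f: "trilinear_on V X f"
  shows "bilinear_on (tpow2 V) V X (\<lambda>t z. tlift V V X (\<lambda>x y. f x y z) t)"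
proof (rule bilinear_onI)
  show "linear_on V X (\<lambda>z. tlift V V X (\<lambda>x y. f x y z) t)" if "t \<in> car (tpow2 V)" for t
    using f by (intro tlift_param V X that trilinear_on_bilinear) (simp_all add: trilinear_on_def)
  show "linear_on (tpow2 V) X (\<lambda>t. tlift V V X (\<lambda>x y. f x y z) t)" if "z \<in> car V" for z
    using that f by (intro tlift_linear V X trilinear_on_bilinear)
qed

lemma
  fixes X :: "('k, 'c::ab_group_add, 'p) vspace_scheme"
  assumes X: "is_vspace X" and f: "trilinear_on V X f"
  shows tlift3_lhom: "tlift3 V X f \<in> lhom (tpow3 V) X"
    and tlift3_tens3: "x \<in> car V \<Longrightarrow> y \<in> car V \<Longrightarrow> z \<in> car V \<Longrightarrow> tlift3 V X f (tens3 V x y z) = f x y z"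
  using tlift_lhom[OF _ V X tlift3_bilinear[OF X f]]
  by (simp_all add: tlift3_def tens3_def tlift_tens[OF _ V X tlift3_bilinear[OF X f]] tens_mem
      tlift_tens[OF V V X trilinear_on_bilinear[OF f]])

lemma tlift3_linear:
  fixes X :: "('k, 'c::ab_group_add, 'p) vspace_scheme"
  assumes "is_vspace X" "trilinear_on V X f"
  shows "linear_on (tpow3 V) X (tlift3 V X f)"
  by (rule lhom_linear[OF tlift3_lhom[OF assms]])

lemma tlift4_bilinear:
  fixes X :: "('k, 'c::ab_group_add, 'p) vspace_scheme"
  assumes X: "is_vspace X" and f: "quadrilinear_on V X f"
  shows "bilinear_on (tpow3 V) V X (\<lambda>t w. tlift3 V X (\<lambda>x y z. f x y z w) t)"
proof (rule bilinear_onI)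
  have f3: "trilinear_on V X (\<lambda>x y z. f x y z w)" if "w \<in> car V" for w
    using f that by (simp add: quadrilinear_on_def)
  note lin = tlift3_linear[OF X f3]
  show "linear_on V X (\<lambda>w. tlift3 V X (\<lambda>x y z. f x y z w) t)"
    if t: "t \<in> car (tpow3 V)" for t
  proof (rule linear_onI)
    fix w assume w: "w \<in> car V"
    have l: "linear_on V X (\<lambda>w. f x y z w)" if "x \<in> car V" "y \<in> car V" "z \<in> car V" for x y z
      using f that by (simp add: quadrilinear_on_def)
    show "tlift3 V X (\<lambda>x y z. f x y z w) t \<in> car X" by (rule linear_on_mem[OF lin[OF w] t])
    show "tlift3 V X (\<lambda>x y z. f x y z (w + w')) t =
      tlift3 V X (\<lambda>x y z. f x y z w) t + tlift3 V X (\<lambda>x y z. f x y z w') t"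
      if w': "w' \<in> car V" for w'
      by (rule tensor3_ext[OF lin linear_on_plus[OF X lin lin] _ t])
        (simp_all add: w w' vs_add[OF V] tlift3_tens3[OF X f3] linear_on_add[OF l])
    show "tlift3 V X (\<lambda>x y z. f x y z (scl V c w)) t = scl X c (tlift3 V X (\<lambda>x y z. f x y z w) t)" for c
      by (rule tensor3_ext[OF lin linear_on_scl[OF X lin] _ t])
        (simp_all add: w vs_scl[OF V] tlift3_tens3[OF X f3] linear_on_scale[OF l])
  qed
  show "linear_on (tpow3 V) X (\<lambda>t. tlift3 V X (\<lambda>x y z. f x y z w) t)" if "w \<in> car V" for w
    by (rule lin[OF that])
qed

lemma
  fixes X :: "('k, 'c::ab_group_add, 'p) vspace_scheme"
  assumes X: "is_vspace X" and f: "quadrilinear_on V X f"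
  shows tlift4_lhom: "tlift4 V X f \<in> lhom (tpow4 V) X"
    and tlift4_tens4: "x \<in> car V \<Longrightarrow> y \<in> car V \<Longrightarrow> z \<in> car V \<Longrightarrow> w \<in> car V \<Longrightarrow>
      tlift4 V X f (tens4 V x y z w) = f x y z w"
proof -
  have f3: "trilinear_on V X (\<lambda>x y z. f x y z w)" if "w \<in> car V" for w
    using f that by (simp add: quadrilinear_on_def)
  show "tlift4 V X f \<in> lhom (tpow4 V) X"
    unfolding tlift4_def by (rule tlift_lhom[OF is_vspace_vtensor V X tlift4_bilinear[OF X f]])
  show "tlift4 V X f (tens4 V x y z w) = f x y z w"
    if "x \<in> car V" "y \<in> car V" "z \<in> car V" "w \<in> car V"
    using that by (simp add: tlift4_def tens4_def tens3_mem tlift3_tens3[OF X f3]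
        tlift_tens[OF is_vspace_vtensor V X tlift4_bilinear[OF X f]])
qed

end


section \<open>Pairings of tensor products\<close>

text \<open>The tensor product of two pairings. As tensors are functionals on bilinear forms, it is
  an iterated evaluation and takes no spaces as arguments; bilinearity of \<open>p\<close> and
  \<open>q\<close> enters only when it is computed on pure tensors.\<close>

definition tpair :: "('a \<Rightarrow> 'c \<Rightarrow> 'k::field) \<Rightarrow> ('b \<Rightarrow> 'd \<Rightarrow> 'k) \<Rightarrow> ('k, 'a, 'b) tensor \<Rightarrow> ('k, 'c, 'd) tensor \<Rightarrow> 'k"
  where "tpair p q t s = t (\<lambda>a b. s (\<lambda>c d. p a c * q b d))"

context
  fixes A :: "('k::field, 'a::ab_group_add, 'm) vspace_scheme"
    and B :: "('k, 'b::ab_group_add, 'n) vspace_scheme"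
    and C :: "('k, 'c::ab_group_add, 'mm) vspace_scheme"
    and D :: "('k, 'd::ab_group_add, 'nn) vspace_scheme"
    and p q
  assumes vs: "is_vspace A" "is_vspace B" "is_vspace C" "is_vspace D"
    and p: "bilinear_on A C base_field p" and q: "bilinear_on B D base_field q"
begin

lemma tpair_slice_bilinear:
  "a \<in> car A \<Longrightarrow> b \<in> car B \<Longrightarrow> bilinear_on C D base_field (\<lambda>c d. p a c * q b d)"
  "c \<in> car C \<Longrightarrow> d \<in> car D \<Longrightarrow> bilinear_on A B base_field (\<lambda>a b. p a c * q b d)"
  using bilinear_on_product[OF bilinear_on_right[OF p] bilinear_on_right[OF q]]
    bilinear_on_product[OF bilinear_on_left[OF p] bilinear_on_left[OF q]] by simp_all

lemma tpair_half_bilinear: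
  "s \<in> car (C \<otimes>\<^sub>v D) \<Longrightarrow> bilinear_on A B base_field (\<lambda>a b. s (\<lambda>c d. p a c * q b d))"
  by (intro bilinear_onI)
    (rule tensor_apply_param[OF vs(3,4)], use vs in
      \<open>simp_all add: tpair_slice_bilinear linear_on_mult_left linear_on_mult_right
        bilinear_on_left[OF p] bilinear_on_left[OF q]\<close>)+

lemma tpair_bilinear: "bilinear_on (A \<otimes>\<^sub>v B) (C \<otimes>\<^sub>v D) base_field (tpair p q)"
  unfolding tpair_def
proof (rule bilinear_onI)
  show "linear_on (A \<otimes>\<^sub>v B) base_field (\<lambda>t. t (\<lambda>a b. s (\<lambda>c d. p a c * q b d)))" for s
    by (rule tensor_apply_linear[OF vs(1,2)])
  show "linear_on (C \<otimes>\<^sub>v D) base_field (\<lambda>s. t (\<lambda>a b. s (\<lambda>c d. p a c * q b d)))"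
    if "t \<in> car (A \<otimes>\<^sub>v B)" for t
    by (rule tensor_apply_param[OF vs(1,2) is_vspace_vtensor tpair_half_bilinear
          tensor_apply_linear[OF vs(3,4)] that])
qed

lemma tpair_tens_left: "a \<in> car A \<Longrightarrow> b \<in> car B \<Longrightarrow> s \<in> car (C \<otimes>\<^sub>v D) \<Longrightarrow>
    tpair p q (tens A B a b) s = s (\<lambda>c d. p a c * q b d)"
  by (simp add: tpair_def tens_apply vs tpair_half_bilinear)

lemma tpair_tens_right:
  assumes "t \<in> car (A \<otimes>\<^sub>v B)" "c \<in> car C" "d \<in> car D"
  shows "tpair p q t (tens C D c d) = t (\<lambda>a b. p a c * q b d)"
  unfolding tpair_def
  by (rule tensor_apply_cong[OF vs(1,2) assms(1)]) (simp add: tens_apply vs tpair_slice_bilinear)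

lemma tpair_tens: "a \<in> car A \<Longrightarrow> b \<in> car B \<Longrightarrow> c \<in> car C \<Longrightarrow> d \<in> car D \<Longrightarrow>
    tpair p q (tens A B a b) (tens C D c d) = p a c * q b d"
  by (simp add: tpair_tens_right tens_mem tens_apply vs tpair_slice_bilinear)

end

section \<open>Nondegeneracy of tensor products of pairings\<close>

text \<open>One-sided by design: \<open>C\<close> separates the elements of \<open>A\<close>, with
  no claim about the converse. A finite dual is always separated by the algebra it comes from, but
  need not separate that algebra.\<close>

definition nondegenerate ::
  "('k::field, 'a::ab_group_add, 'm) vspace_scheme \<Rightarrow> ('k, 'c::ab_group_add, 'n) vspace_scheme
    \<Rightarrow> ('a \<Rightarrow> 'c \<Rightarrow> 'k) \<Rightarrow> bool" where
  "nondegenerate A C p \<longleftrightarrow> (\<forall>a\<in>car A. (\<forall>x\<in>car C. p a x = 0) \<longrightarrow> a = 0)"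

lemma nondegenerate_eqI:
  assumes "nondegenerate A C p" "bilinear_on A C base_field p" "is_vspace A" "a \<in> car A" "b \<in> car A"
    and "\<And>x. x \<in> car C \<Longrightarrow> p a x = p b x"
  shows "a = b"
proof -
  have "p (a - b) x = 0" if "x \<in> car C" for x
    using linear_on_diff[OF bilinear_on_left[OF assms(2) that] assms(3,4,5)] assms(6)[OF that] by simp
  moreover have "a - b \<in> car A" using assms by (simp add: vs_minus)
  ultimately have "a - b = 0" using assms(1) unfolding nondegenerate_def by blast
  then show ?thesis by simp
qed

text \<open>
  The slices of \<open>t\<close> by functionals on \<open>W\<close> determine \<open>t\<close>: they are its coefficients with respect to
  a basis of \<open>W\<close>.
\<close>

lemma tensor_zero_if_slices_zero:
  fixes V :: "('k::field, 'a::ab_group_add, 'm) vspace_scheme"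
    and W :: "('k, 'b::ab_group_add, 'n) vspace_scheme"
  assumes V: "is_vspace V" and W: "is_vspace W" and t: "t \<in> car (V \<otimes>\<^sub>v W)"
    and slices: "\<And>g. linear_on W base_field g \<Longrightarrow> tlift V W V (\<lambda>v w. scl V (g w) v) t = 0"
  shows "t = 0"
proof -
  interpret W: vector_space "scl W" using W by (simp add: is_vspace_def)
  obtain B where B: "B \<subseteq> car W" "W.independent B" "car W \<subseteq> W.span B"
    using W.maximal_independent_subset[of "car W"] by blast
  \<comment> \<open>\<open>g b\<close> is the coordinate functional of the basis vector
    \<open>b\<close>, and \<open>r b t\<close> is the coefficient of \<open>b\<close> in
    \<open>t\<close>. The aim is to write \<open>t\<close> as the finite sum of the tensors of
    \<open>r b t\<close> with \<open>b\<close>.\<close>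
  define g where "g b w = W.representation B w b" for b w
  define r where "r b = tlift V W V (\<lambda>v w. scl V (g b w) v)" for b
  have g: "linear_on W base_field (g b)" for b
    using B by (intro linear_onI)
      (auto simp: g_def W.representation_add W.representation_scale subset_iff)
  have gb: "bilinear_on V W V (\<lambda>v w. scl V (g b w) v)" for b
    by (intro bilinear_onI linear_on_scl_left V g linear_on_scl linear_on_id)
  have r: "linear_on (V \<otimes>\<^sub>v W) V (r b)" for b
    unfolding r_def by (rule tlift_linear[OF V W V gb])
  have r_tens: "r b (tens V W v w) = scl V (g b w) v" if "v \<in> car V" "w \<in> car W" for b v w
    using that by (simp add: r_def tlift_tens[OF V W V gb])
  \<comment> \<open>The expansion is claimed for every finite set of basis vectors containing
    \<open>B0\<close>. In the induction step the support \<open>S\<close> of \<open>w\<close> joins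
    the old set, and the induction hypothesis must remain applicable to the union.\<close>
  have "\<exists>B0. finite B0 \<and> B0 \<subseteq> B \<and>
    (\<forall>B1. finite B1 \<and> B0 \<subseteq> B1 \<and> B1 \<subseteq> B \<longrightarrow> t = (\<Sum>b\<in>B1. tens V W (r b t) b))"
    using t
  proof (induction rule: vtensor_induct)
    case zero
    have "tens V W (r b 0) b = 0" if "b \<in> B" for b
      using B that linear_on_zero[OF r, of b] linear_on_zero[OF bilinear_on_left[OF tens_bilinear, of b W V] V]
      by auto
    then have "0 = (\<Sum>b\<in>B1. tens V W (r b 0) b)" if "B1 \<subseteq> B" for B1
      by (intro sum.neutral[symmetric]) (use that in blast)
    then have "\<forall>B1. finite B1 \<and> {} \<subseteq> B1 \<and> B1 \<subseteq> B \<longrightarrow> 0 = (\<Sum>b\<in>B1. tens V W (r b 0) b)"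
      by iprover
    then show ?case by (intro exI[of _ "{}"] conjI finite.emptyI empty_subsetI)
  next
    case (step c v w t)
    from step.IH obtain B0 where B0: "finite B0" "B0 \<subseteq> B"
      "\<forall>B1. finite B1 \<and> B0 \<subseteq> B1 \<and> B1 \<subseteq> B \<longrightarrow> t = (\<Sum>b\<in>B1. tens V W (r b t) b)"
      by (elim exE conjE)
    define S where "S = {b. g b w \<noteq> 0}"
    have S: "finite S" "S \<subseteq> B"
      using W.finite_representation[of B w] W.representation_ne_zero[of B w] by (auto simp: S_def g_def)
    have vw: "tens V W v w \<in> car (V \<otimes>\<^sub>v W)" using step by (simp add: tens_mem)
    show ?case
    proof (intro exI[of _ "B0 \<union> S"] conjI allI impI)
      show "finite (B0 \<union> S)" "B0 \<union> S \<subseteq> B" using B0 S by auto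
      fix B1 assume B1: "finite B1 \<and> B0 \<union> S \<subseteq> B1 \<and> B1 \<subseteq> B"
      have w: "(\<Sum>b\<in>B1. scl W (g b w) b) = w"
      proof -
        have "(\<Sum>b\<in>B1. scl W (g b w) b) = (\<Sum>b\<in>S. scl W (g b w) b)"
          using B1 by (intro sum.mono_neutral_right) (auto simp: S_def)
        also have "\<dots> = w"
          unfolding S_def g_def using step B
          by (intro W.sum_nonzero_representation_eq) (auto simp: subset_iff)
        finally show ?thesis .
      qed
      have lin: "linear_on V (V \<otimes>\<^sub>v W) (\<lambda>v. tens V W v b)" if "b \<in> car W" for b
        by (rule bilinear_on_left[OF tens_bilinear that])
      have "tens V W (r b (fscl c (tens V W v w) + t)) b
        = fscl c (tens V W v (scl W (g b w) b)) + tens V W (r b t) b" if "b \<in> B1" for b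
      proof -
        have b: "b \<in> car W" using that B1 B by auto
        have "r b (fscl c (tens V W v w) + t) = scl V c (scl V (g b w) v) + r b t"
          using linear_on_add[OF r vs_scl[OF is_vspace_vtensor vw, of c] step(3)]
            linear_on_scale[OF r vw, of b c] r_tens[OF step(1,2)] by simp
        then have "tens V W (r b (fscl c (tens V W v w) + t)) b
          = tens V W (scl V c (scl V (g b w) v)) b + tens V W (r b t) b"
          using linear_on_add[OF lin[OF b], of "scl V c (scl V (g b w) v)" "r b t"]
            linear_on_mem[OF r step(3), of b] step V by (simp add: vs_scl)
        also have "tens V W (scl V c (scl V (g b w) v)) b = fscl c (tens V W v (scl W (g b w) b))"
          using linear_on_scale[OF lin[OF b]] step V b
            linear_on_scale[OF bilinear_on_right[OF tens_bilinear step(1), of W] b] by (simp add: vs_scl)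
        finally show ?thesis .
      qed
      then have "(\<Sum>b\<in>B1. tens V W (r b (fscl c (tens V W v w) + t)) b)
        = (\<Sum>b\<in>B1. fscl c (tens V W v (scl W (g b w) b))) + (\<Sum>b\<in>B1. tens V W (r b t) b)"
        by (simp only: sum.distrib cong: sum.cong)
      also have "(\<Sum>b\<in>B1. tens V W (r b t) b) = t"
        using B1 by (intro B0(3)[rule_format, symmetric]) simp
      also have "(\<Sum>b\<in>B1. fscl c (tens V W v (scl W (g b w) b))) = fscl c (tens V W v w)"
      proof -
        have "linear_on W (V \<otimes>\<^sub>v W) (\<lambda>w. fscl c (tens V W v w))"
          using linear_on_scl[OF is_vspace_vtensor bilinear_on_right[OF tens_bilinear step(1), of W]] by simp
        then have "(\<Sum>b\<in>B1. fscl c (tens V W v (scl W (g b w) b)))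
          = fscl c (tens V W v (\<Sum>b\<in>B1. scl W (g b w) b))"
          by (rule linear_on_sum[symmetric, OF _ W]) (use B1 B W in \<open>auto simp: vs_scl\<close>)
        then show ?thesis by (simp only: w)
      qed
      finally show "fscl c (tens V W v w) + t = (\<Sum>b\<in>B1. tens V W (r b (fscl c (tens V W v w) + t)) b)"
        by (rule sym)
    qed
  qed
  then obtain B0 where B0: "B0 \<subseteq> B" "t = (\<Sum>b\<in>B0. tens V W (r b t) b)" by blast
  have "tens V W (r b t) b = 0" if "b \<in> B0" for b
    using slices[OF g, of b] linear_on_zero[OF bilinear_on_left[OF tens_bilinear, of b W V] V] that B0 B
    by (auto simp: r_def)
  with B0(2) show ?thesis by (simp add: sum.neutral)
qed

text \<open>Contract one leg at a time. Contracting the first leg of \<open>t\<close> with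
  \<open>p\<close> at a fixed \<open>c\<close> gives an element of \<open>B\<close> that is
  orthogonal to all of \<open>D\<close>, hence \<open>0\<close>. Contracting the second leg with an
  arbitrary functional \<open>g\<close> gives an element of \<open>A\<close> whose pairing with
  \<open>c\<close> is \<open>g\<close> applied to the former contraction, hence again
  \<open>0\<close>. So all slices of \<open>t\<close> vanish.\<close>

lemma nondegenerate_tpair:
  assumes vs: "is_vspace A" "is_vspace B" "is_vspace C" "is_vspace D"
    and p: "bilinear_on A C base_field p" and q: "bilinear_on B D base_field q"
    and np: "nondegenerate A C p" and nq: "nondegenerate B D q"
  shows "nondegenerate (A \<otimes>\<^sub>v B) (C \<otimes>\<^sub>v D) (tpair p q)"
  unfolding nondegenerate_def
proof (intro ballI impI)
  fix t assume t: "t \<in> car (A \<otimes>\<^sub>v B)" and z: "\<forall>s\<in>car (C \<otimes>\<^sub>v D). tpair p q t s = 0"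
  have t0: "t (\<lambda>a b. p a c * q b d) = 0" if "c \<in> car C" "d \<in> car D" for c d
    using z that tpair_tens_right[OF vs p q t that] by (simp add: tens_mem)
  have b1: "bilinear_on A B B (\<lambda>a b. scl B (p a c) b)" if "c \<in> car C" for c
    by (intro bilinear_onI linear_on_scl_left linear_on_scl linear_on_id vs bilinear_on_left[OF p that])
  have s0: "tlift A B B (\<lambda>a b. scl B (p a c) b) t = 0" if c: "c \<in> car C" for c
  proof -
    have "q (tlift A B B (\<lambda>a b. scl B (p a c) b) t) d = 0" if d: "d \<in> car D" for d
    proof -
      have "q (tlift A B B (\<lambda>a b. scl B (p a c) b) t) d = t (\<lambda>a b. q (scl B (p a c) b) d)"
        by (rule tlift_apply[OF vs(1,2,2) b1[OF c] bilinear_on_left[OF q d] t])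
      also have "\<dots> = t (\<lambda>a b. p a c * q b d)"
        by (rule tensor_apply_cong[OF vs(1,2) t]) (simp add: linear_on_scale[OF bilinear_on_left[OF q d]])
      finally show ?thesis using t0 c d by simp
    qed
    moreover have "tlift A B B (\<lambda>a b. scl B (p a c) b) t \<in> car B"
      by (rule linear_on_mem[OF tlift_linear[OF vs(1,2,2) b1[OF c]] t])
    ultimately show ?thesis using nq unfolding nondegenerate_def by blast
  qed
  show "t = 0"
  proof (rule tensor_zero_if_slices_zero[OF vs(1,2) t])
    fix g assume g: "linear_on B base_field g"
    have b2: "bilinear_on A B A (\<lambda>a b. scl A (g b) a)"
      by (intro bilinear_onI linear_on_scl_left linear_on_scl linear_on_id vs g)
    have "p (tlift A B A (\<lambda>a b. scl A (g b) a) t) c = 0" if c: "c \<in> car C" for c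
    proof -
      have "p (tlift A B A (\<lambda>a b. scl A (g b) a) t) c = t (\<lambda>a b. p (scl A (g b) a) c)"
        by (rule tlift_apply[OF vs(1,2,1) b2 bilinear_on_left[OF p c] t])
      also have "\<dots> = t (\<lambda>a b. g (scl B (p a c) b))"
        by (rule tensor_apply_cong[OF vs(1,2) t])
          (simp add: linear_on_scale[OF bilinear_on_left[OF p c]] linear_on_scale[OF g])
      also have "\<dots> = g (tlift A B B (\<lambda>a b. scl B (p a c) b) t)"
        by (rule tlift_apply[OF vs(1,2,2) b1[OF c] g t, symmetric])
      also have "\<dots> = 0" by (simp add: s0[OF c] linear_on_zero[OF g vs(2)])
      finally show ?thesis .
    qed
    moreover have "tlift A B A (\<lambda>a b. scl A (g b) a) t \<in> car A"
      by (rule linear_on_mem[OF tlift_linear[OF vs(1,2,1) b2] t])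
    ultimately show "tlift A B A (\<lambda>a b. scl A (g b) a) t = 0"
      using np unfolding nondegenerate_def by blast
  qed
qed

abbreviation tpair3 :: "('a \<Rightarrow> 'c \<Rightarrow> 'k::field) \<Rightarrow> ('k, 'a) tensor3 \<Rightarrow> ('k, 'c) tensor3 \<Rightarrow> 'k" where
  "tpair3 p \<equiv> tpair (tpair p p) p"

abbreviation tpair4 :: "('a \<Rightarrow> 'c \<Rightarrow> 'k::field) \<Rightarrow> ('k, 'a) tensor4 \<Rightarrow> ('k, 'c) tensor4 \<Rightarrow> 'k" where
  "tpair4 p \<equiv> tpair (tpair3 p) p"

context
  fixes A :: "('k::field, 'a::ab_group_add, 'm) vspace_scheme"
    and C :: "('k, 'c::ab_group_add, 'mm) vspace_scheme"
    and p
  assumes A: "is_vspace A" and C: "is_vspace C" and p: "bilinear_on A C base_field p"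
begin

lemma tpair2_bilinear: "bilinear_on (tpow2 A) (tpow2 C) base_field (tpair p p)"
  by (rule tpair_bilinear[OF A A C C p p])

lemma tpair3_bilinear: "bilinear_on (tpow3 A) (tpow3 C) base_field (tpair3 p)"
  by (rule tpair_bilinear[OF is_vspace_vtensor A is_vspace_vtensor C tpair2_bilinear p])

lemma tpair4_bilinear:
  "bilinear_on (tpow4 A) (tpow4 C) base_field (tpair4 p)"
  by (rule tpair_bilinear[OF is_vspace_vtensor A is_vspace_vtensor C tpair3_bilinear p])

lemma tpair3_tens3:
  "a \<in> car A \<Longrightarrow> b \<in> car A \<Longrightarrow> c \<in> car A \<Longrightarrow> x \<in> car C \<Longrightarrow> y \<in> car C \<Longrightarrow> z \<in> car C \<Longrightarrow>
    tpair3 p (tens3 A a b c) (tens3 C x y z) = p a x * p b y * p c z"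
  by (simp add: tens3_def tens_mem tpair_tens[OF A A C C p p]
      tpair_tens[OF is_vspace_vtensor A is_vspace_vtensor C tpair2_bilinear p])

lemma tpair4_tens4:
  "a \<in> car A \<Longrightarrow> b \<in> car A \<Longrightarrow> c \<in> car A \<Longrightarrow> d \<in> car A \<Longrightarrow>
    x \<in> car C \<Longrightarrow> y \<in> car C \<Longrightarrow> z \<in> car C \<Longrightarrow> w \<in> car C \<Longrightarrow>
    tpair4 p (tens4 A a b c d) (tens4 C x y z w) = p a x * p b y * p c z * p d w"
  by (simp add: tens4_def tens3_mem tpair3_tens3
      tpair_tens[OF is_vspace_vtensor A is_vspace_vtensor C tpair3_bilinear p])

context
  assumes nd: "nondegenerate A C p"
begin

lemma tpair2_nondegenerate: "nondegenerate (tpow2 A) (tpow2 C) (tpair p p)"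
  by (rule nondegenerate_tpair[OF A A C C p p nd nd])

lemma tpair3_nondegenerate: "nondegenerate (tpow3 A) (tpow3 C) (tpair3 p)"
  by (rule nondegenerate_tpair[OF is_vspace_vtensor A is_vspace_vtensor C tpair2_bilinear p
        tpair2_nondegenerate nd])

lemma tpair4_nondegenerate: "nondegenerate (tpow4 A) (tpow4 C) (tpair4 p)"
  by (rule nondegenerate_tpair[OF is_vspace_vtensor A is_vspace_vtensor C tpair3_bilinear p
        tpair3_nondegenerate nd])

lemma tensor2_eqI:
  assumes "s \<in> car (tpow2 A)" "t \<in> car (tpow2 A)"
    and "\<And>x y. x \<in> car C \<Longrightarrow> y \<in> car C \<Longrightarrow> tpair p p s (tens C C x y) = tpair p p t (tens C C x y)"
  shows "s = t"
  by (rule nondegenerate_eqI[OF tpair2_nondegenerate tpair2_bilinear is_vspace_vtensor assms(1,2)])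
    (rule tensor_ext[OF bilinear_on_right[OF tpair2_bilinear assms(1)]
        bilinear_on_right[OF tpair2_bilinear assms(2)] assms(3)])

lemma tensor3_eqI:
  assumes "s \<in> car (tpow3 A)" "t \<in> car (tpow3 A)"
    and "\<And>x y z. x \<in> car C \<Longrightarrow> y \<in> car C \<Longrightarrow> z \<in> car C \<Longrightarrow>
      tpair3 p s (tens3 C x y z) = tpair3 p t (tens3 C x y z)"
  shows "s = t"
  by (rule nondegenerate_eqI[OF tpair3_nondegenerate tpair3_bilinear is_vspace_vtensor assms(1,2)])
    (rule tensor3_ext[OF C bilinear_on_right[OF tpair3_bilinear assms(1)]
        bilinear_on_right[OF tpair3_bilinear assms(2)] assms(3)])

text \<open>Agreement is asked on all tensors and not just on pure ones, because the sides of the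
  pentagon are identified with convolutions on the whole fourth tensor power.\<close>

lemma tensor4_eqI:
  assumes "s \<in> car (tpow4 A)" "t \<in> car (tpow4 A)"
    and "\<And>u. u \<in> car (tpow4 C) \<Longrightarrow> tpair4 p s u = tpair4 p t u"
  shows "s = t"
  by (rule nondegenerate_eqI[OF tpair4_nondegenerate tpair4_bilinear is_vspace_vtensor assms(1,2)])
    (rule assms(3))

end

end


section \<open>Lifts inside lifts\<close>

text \<open>The product of two tensors and the shuffled coproduct of a tensor product both have this
  shape: a map of four variables, lifted in two pairs of them. The first claim makes the outer lift
  legitimate, the second gives bilinearity in the two tensors.\<close>

lemma tlift_tlift_bilinear:
  fixes A :: "('k::field, 'a::ab_group_add, 'm) vspace_scheme"
    and A' :: "('k, 'b::ab_group_add, 'n) vspace_scheme"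
    and B :: "('k, 'c::ab_group_add, 'mm) vspace_scheme"
    and B' :: "('k, 'd::ab_group_add, 'nn) vspace_scheme"
    and X :: "('k, 'e::ab_group_add, 'x) vspace_scheme"
  assumes vs: "is_vspace A" "is_vspace A'" "is_vspace B" "is_vspace B'" "is_vspace X"
    and H1: "\<And>a a'. a \<in> car A \<Longrightarrow> a' \<in> car A' \<Longrightarrow> bilinear_on B B' X (H a a')"
    and H2: "\<And>b b'. b \<in> car B \<Longrightarrow> b' \<in> car B' \<Longrightarrow> bilinear_on A A' X (\<lambda>a a'. H a a' b b')"
  shows "t \<in> car (B \<otimes>\<^sub>v B') \<Longrightarrow> bilinear_on A A' X (\<lambda>a a'. tlift B B' X (H a a') t)"
    and "bilinear_on (A \<otimes>\<^sub>v A') (B \<otimes>\<^sub>v B') X (\<lambda>s t. tlift A A' X (\<lambda>a a'. tlift B B' X (H a a') t) s)"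
proof -
  show inner: "bilinear_on A A' X (\<lambda>a a'. tlift B B' X (H a a') t)" if "t \<in> car (B \<otimes>\<^sub>v B')" for t
    by (intro bilinear_onI)
      (rule tlift_param[OF vs(3,4)], use vs that in
        \<open>simp_all add: H1 bilinear_on_left[OF H2] bilinear_on_right[OF H2]\<close>)+
  show "bilinear_on (A \<otimes>\<^sub>v A') (B \<otimes>\<^sub>v B') X (\<lambda>s t. tlift A A' X (\<lambda>a a'. tlift B B' X (H a a') t) s)"
  proof (rule bilinear_onI)
    show "linear_on (B \<otimes>\<^sub>v B') X (\<lambda>t. tlift A A' X (\<lambda>a a'. tlift B B' X (H a a') t) s)"
      if "s \<in> car (A \<otimes>\<^sub>v A')" for s
      by (rule tlift_param[OF vs(1,2) is_vspace_vtensor vs(5) inner tlift_linear[OF vs(3-5) H1] that])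
    show "linear_on (A \<otimes>\<^sub>v A') X (\<lambda>s. tlift A A' X (\<lambda>a a'. tlift B B' X (H a a') t) s)"
      if "t \<in> car (B \<otimes>\<^sub>v B')" for t
      by (rule tlift_linear[OF vs(1,2,5) inner[OF that]])
  qed
qed

lemma tlift_tlift_comp:
  fixes A :: "('k::field, 'a::ab_group_add, 'm) vspace_scheme"
    and A' :: "('k, 'b::ab_group_add, 'n) vspace_scheme"
    and B :: "('k, 'c::ab_group_add, 'mm) vspace_scheme"
    and B' :: "('k, 'd::ab_group_add, 'nn) vspace_scheme"
    and X :: "('k, 'e::ab_group_add, 'x) vspace_scheme"
    and Y :: "('k, 'f::ab_group_add, 'y) vspace_scheme"
  assumes vs: "is_vspace A" "is_vspace A'" "is_vspace B" "is_vspace B'" "is_vspace X" "is_vspace Y"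
    and H1: "\<And>a a'. a \<in> car A \<Longrightarrow> a' \<in> car A' \<Longrightarrow> bilinear_on B B' X (H a a')"
    and H2: "\<And>b b'. b \<in> car B \<Longrightarrow> b' \<in> car B' \<Longrightarrow> bilinear_on A A' X (\<lambda>a a'. H a a' b b')"
    and g: "linear_on X Y g"
    and s: "s \<in> car (A \<otimes>\<^sub>v A')" and t: "t \<in> car (B \<otimes>\<^sub>v B')"
  shows "g (tlift A A' X (\<lambda>a a'. tlift B B' X (H a a') t) s)
    = tlift A A' Y (\<lambda>a a'. tlift B B' Y (\<lambda>b b'. g (H a a' b b')) t) s"
proof -
  have "g (tlift A A' X (\<lambda>a a'. tlift B B' X (H a a') t) s)
    = tlift A A' Y (\<lambda>a a'. g (tlift B B' X (H a a') t)) s"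
    by (rule tlift_comp[OF vs(1,2,5,6) tlift_tlift_bilinear(1)[OF vs(1-5) H1 H2 t] g s])
  also have "\<dots> = tlift A A' Y (\<lambda>a a'. tlift B B' Y (\<lambda>b b'. g (H a a' b b')) t) s"
    by (simp add: tlift_comp[OF vs(3-6) H1 g t] cong: tlift_cong)
  finally show ?thesis .
qed

lemma tlift_tlift_apply:
  fixes A :: "('k::field, 'a::ab_group_add, 'm) vspace_scheme"
    and A' :: "('k, 'b::ab_group_add, 'n) vspace_scheme"
    and B :: "('k, 'c::ab_group_add, 'mm) vspace_scheme"
    and B' :: "('k, 'd::ab_group_add, 'nn) vspace_scheme"
    and X :: "('k, 'e::ab_group_add, 'x) vspace_scheme"
  assumes vs: "is_vspace A" "is_vspace A'" "is_vspace B" "is_vspace B'" "is_vspace X"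
    and H1: "\<And>a a'. a \<in> car A \<Longrightarrow> a' \<in> car A' \<Longrightarrow> bilinear_on B B' X (H a a')"
    and H2: "\<And>b b'. b \<in> car B \<Longrightarrow> b' \<in> car B' \<Longrightarrow> bilinear_on A A' X (\<lambda>a a'. H a a' b b')"
    and g: "linear_on X base_field g"
    and s: "s \<in> car (A \<otimes>\<^sub>v A')" and t: "t \<in> car (B \<otimes>\<^sub>v B')"
  shows "g (tlift A A' X (\<lambda>a a'. tlift B B' X (H a a') t) s)
    = s (\<lambda>a a'. t (\<lambda>b b'. g (H a a' b b')))"
proof -
  have "g (tlift A A' X (\<lambda>a a'. tlift B B' X (H a a') t) s)
    = s (\<lambda>a a'. g (tlift B B' X (H a a') t))"
    by (rule tlift_apply[OF vs(1,2,5) tlift_tlift_bilinear(1)[OF vs(1-5) H1 H2 t] g s])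
  also have "\<dots> = s (\<lambda>a a'. t (\<lambda>b b'. g (H a a' b b')))"
    by (rule tensor_apply_cong[OF vs(1,2) s]) (rule tlift_apply[OF vs(3-5) H1 g t])
  finally show ?thesis .
qed


section \<open>Products and coproducts on tensor products\<close>

text \<open>The part of an algebra that passes to tensor products for free, and enough to form
  products and convolutions there. The laws are used on the factors and not on their tensor powers.
  The same holds for \<open>precoalgebra\<close>.\<close>

definition prealgebra :: "('k::field, 'a::ab_group_add) bistruct \<Rightarrow> bool" where
  "prealgebra A \<longleftrightarrow> is_vspace A \<and> bilinear_on A A A (amult A) \<and> aone A \<in> car A"

definition precoalgebra :: "('k::field, 'a::ab_group_add) bistruct \<Rightarrow> bool" where
  "precoalgebra C \<longleftrightarrow> is_vspace C \<and> comult C \<in> lhom C (tpow2 C) \<and> counit C \<in> lhom C base_field"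

lemma prealgebraD:
  assumes "prealgebra A"
  shows "is_vspace A" "bilinear_on A A A (amult A)" "aone A \<in> car A"
  using assms by (simp_all add: prealgebra_def)

lemma precoalgebraD:
  assumes "precoalgebra C"
  shows "is_vspace C" "linear_on C (tpow2 C) (comult C)" "linear_on C base_field (counit C)"
    and "x \<in> car C \<Longrightarrow> comult C x \<in> car (tpow2 C)"
    and "x \<notin> car C \<Longrightarrow> comult C x = 0" "x \<notin> car C \<Longrightarrow> counit C x = 0"
  using assms by (auto simp: precoalgebra_def lhom_def linear_on_def)

lemma aone_btensor [simp]: "aone (A \<otimes>\<^sub>b B) = tens A B (aone A) (aone B)"
  by (simp add: btensor_def Let_def)

text \<open>The factors are multiplied from \<open>A\<close> into a possibly different space
  \<open>A'\<close>, and from \<open>B\<close> into \<open>B'\<close>. The generality is for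
  convolution on a finite dual: until closure is known, products of its elements only lie in an
  auxiliary span.\<close>

definition tprod ::
  "('k::field, 'a::ab_group_add, 'm) vspace_scheme \<Rightarrow> ('k, 'a, 'm') vspace_scheme \<Rightarrow> ('a \<Rightarrow> 'a \<Rightarrow> 'a)
    \<Rightarrow> ('k, 'b::ab_group_add, 'n) vspace_scheme \<Rightarrow> ('k, 'b, 'n') vspace_scheme \<Rightarrow> ('b \<Rightarrow> 'b \<Rightarrow> 'b)
    \<Rightarrow> ('k, 'a, 'b) tensor \<Rightarrow> ('k, 'a, 'b) tensor \<Rightarrow> ('k, 'a, 'b) tensor" where
  "tprod A A' \<mu> B B' \<nu> s t = tlift A B (A' \<otimes>\<^sub>v B') (\<lambda>a b. tlift A B (A' \<otimes>\<^sub>v B')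
     (\<lambda>a' b'. tens A' B' (\<mu> a a') (\<nu> b b')) t) s"

context
  fixes A :: "('k::field, 'a::ab_group_add, 'm) vspace_scheme"
    and A' :: "('k, 'a, 'm') vspace_scheme"
    and B :: "('k, 'b::ab_group_add, 'n) vspace_scheme"
    and B' :: "('k, 'b, 'n') vspace_scheme"
    and \<mu> \<nu>
  assumes A: "is_vspace A" and B: "is_vspace B"
    and \<mu>: "bilinear_on A A A' \<mu>" and \<nu>: "bilinear_on B B B' \<nu>"
begin

lemma tprod_tens_bilinear:
  "a \<in> car A \<Longrightarrow> b \<in> car B \<Longrightarrow> bilinear_on A B (A' \<otimes>\<^sub>v B') (\<lambda>a' b'. tens A' B' (\<mu> a a') (\<nu> b b'))"
  "a' \<in> car A \<Longrightarrow> b' \<in> car B \<Longrightarrow> bilinear_on A B (A' \<otimes>\<^sub>v B') (\<lambda>a b. tens A' B' (\<mu> a a') (\<nu> b b'))"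
  by (intro bilinear_onI linear_on_tens_left linear_on_tens_right; simp add:
      bilinear_on_left[OF \<mu>] bilinear_on_right[OF \<mu>] bilinear_on_mem[OF \<mu>]
      bilinear_on_left[OF \<nu>] bilinear_on_right[OF \<nu>] bilinear_on_mem[OF \<nu>])+

lemma tprod_bilinear:
  "bilinear_on (A \<otimes>\<^sub>v B) (A \<otimes>\<^sub>v B) (A' \<otimes>\<^sub>v B') (tprod A A' \<mu> B B' \<nu>)"
  using tlift_tlift_bilinear(2)[OF A B A B is_vspace_vtensor tprod_tens_bilinear]
  unfolding tprod_def .

lemma tprod_tens:
  assumes "a \<in> car A" "a' \<in> car A" "b \<in> car B" "b' \<in> car B"
  shows "tprod A A' \<mu> B B' \<nu> (tens A B a b) (tens A B a' b') = tens A' B' (\<mu> a a') (\<nu> b b')"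
  using assms
    tlift_tens[OF A B is_vspace_vtensor tlift_tlift_bilinear(1)[OF A B A B
        is_vspace_vtensor tprod_tens_bilinear tens_mem[OF assms(2,4)]], of a b]
    tlift_tens[OF A B is_vspace_vtensor tprod_tens_bilinear(1)[OF assms(1,3)], of a' b']
  by (simp add: tprod_def)

end

lemma amult_btensor: "amult (A \<otimes>\<^sub>b B) = tprod A A (amult A) B B (amult B)"
  by (simp add: btensor_def Let_def tprod_def fun_eq_iff)

lemma prealgebra_btensor: "prealgebra A \<Longrightarrow> prealgebra B \<Longrightarrow> prealgebra (A \<otimes>\<^sub>b B)"
  by (simp add: prealgebra_def amult_btensor tprod_bilinear tens_mem)

section \<open>The coproduct of a tensor product\<close>

context
  fixes C :: "('k::field, 'a::ab_group_add) bistruct"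
    and D :: "('k, 'b::ab_group_add) bistruct"
  assumes C: "precoalgebra C" and D: "precoalgebra D"
begin

lemma shuffle_bilinear:
  "c1 \<in> car C \<Longrightarrow> c2 \<in> car C \<Longrightarrow> bilinear_on D D ((C \<otimes>\<^sub>v D) \<otimes>\<^sub>v (C \<otimes>\<^sub>v D))
    (\<lambda>d1 d2. tens (C \<otimes>\<^sub>v D) (C \<otimes>\<^sub>v D) (tens C D c1 d1) (tens C D c2 d2))"
  "d1 \<in> car D \<Longrightarrow> d2 \<in> car D \<Longrightarrow> bilinear_on C C ((C \<otimes>\<^sub>v D) \<otimes>\<^sub>v (C \<otimes>\<^sub>v D))
    (\<lambda>c1 c2. tens (C \<otimes>\<^sub>v D) (C \<otimes>\<^sub>v D) (tens C D c1 d1) (tens C D c2 d2))"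
  by (intro bilinear_onI linear_on_tens_left linear_on_tens_right linear_on_id; simp add: tens_mem)+

private lemmas btensor_covspaces = precoalgebraD(1)[OF C] precoalgebraD(1)[OF D]

lemma comult_btensor: "comult (C \<otimes>\<^sub>b D) = tlift C D ((C \<otimes>\<^sub>v D) \<otimes>\<^sub>v (C \<otimes>\<^sub>v D)) (\<lambda>c d.
    tlift C C ((C \<otimes>\<^sub>v D) \<otimes>\<^sub>v (C \<otimes>\<^sub>v D)) (\<lambda>c1 c2. tlift D D ((C \<otimes>\<^sub>v D) \<otimes>\<^sub>v (C \<otimes>\<^sub>v D))
      (\<lambda>d1 d2. tens (C \<otimes>\<^sub>v D) (C \<otimes>\<^sub>v D) (tens C D c1 d1) (tens C D c2 d2)) (comult D d)) (comult C c))"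
  by (simp add: btensor_def Let_def)

lemma counit_btensor: "counit (C \<otimes>\<^sub>b D) = tlift C D base_field (\<lambda>c d. counit C c * counit D d)"
  by (simp add: btensor_def Let_def)

lemma comult_btensor_bilinear:
  "bilinear_on C D ((C \<otimes>\<^sub>v D) \<otimes>\<^sub>v (C \<otimes>\<^sub>v D)) (\<lambda>c d.
    tlift C C ((C \<otimes>\<^sub>v D) \<otimes>\<^sub>v (C \<otimes>\<^sub>v D)) (\<lambda>c1 c2. tlift D D ((C \<otimes>\<^sub>v D) \<otimes>\<^sub>v (C \<otimes>\<^sub>v D))
      (\<lambda>d1 d2. tens (C \<otimes>\<^sub>v D) (C \<otimes>\<^sub>v D) (tens C D c1 d1) (tens C D c2 d2)) (comult D d)) (comult C c))"
proof -
  note b = tlift_tlift_bilinear(2)[OF btensor_covspaces(1,1,2,2) is_vspace_vtensor shuffle_bilinear]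
  show ?thesis
    using linear_on_comp[OF bilinear_on_right[OF b precoalgebraD(4)[OF C]] precoalgebraD(2)[OF D]]
      linear_on_comp[OF bilinear_on_left[OF b precoalgebraD(4)[OF D]] precoalgebraD(2)[OF C]]
    by (rule bilinear_onI)
qed

lemma comult_btensor_tens:
  assumes "c \<in> car C" "d \<in> car D"
  shows "comult (C \<otimes>\<^sub>b D) (tens C D c d)
    = tlift C C ((C \<otimes>\<^sub>v D) \<otimes>\<^sub>v (C \<otimes>\<^sub>v D)) (\<lambda>c1 c2. tlift D D ((C \<otimes>\<^sub>v D) \<otimes>\<^sub>v (C \<otimes>\<^sub>v D))
      (\<lambda>d1 d2. tens (C \<otimes>\<^sub>v D) (C \<otimes>\<^sub>v D) (tens C D c1 d1) (tens C D c2 d2)) (comult D d)) (comult C c)"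
  unfolding comult_btensor
  by (rule tlift_tens[OF btensor_covspaces is_vspace_vtensor comult_btensor_bilinear assms])

lemma comult_btensor_apply:
  assumes "c \<in> car C" "d \<in> car D"
    and \<beta>: "bilinear_on (C \<otimes>\<^sub>v D) (C \<otimes>\<^sub>v D) base_field \<beta>"
  shows "comult (C \<otimes>\<^sub>b D) (tens C D c d) \<beta>
    = comult C c (\<lambda>c1 c2. comult D d (\<lambda>d1 d2. \<beta> (tens C D c1 d1) (tens C D c2 d2)))"
  using tlift_tlift_apply[OF btensor_covspaces(1,1,2,2) is_vspace_vtensor shuffle_bilinear
      tensor_apply_linear[OF is_vspace_vtensor is_vspace_vtensor]
      precoalgebraD(4)[OF C assms(1)] precoalgebraD(4)[OF D assms(2)]]
  by (simp add: comult_btensor_tens assms tens_apply)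

lemma counit_btensor_tens:
  "c \<in> car C \<Longrightarrow> d \<in> car D \<Longrightarrow> counit (C \<otimes>\<^sub>b D) (tens C D c d) = counit C c * counit D d"
  unfolding counit_btensor
  by (intro tlift_tens btensor_covspaces is_vspace_base_field bilinear_on_product
      precoalgebraD(3) C D)

lemma precoalgebra_btensor: "precoalgebra (C \<otimes>\<^sub>b D)"
  using tlift_lhom[OF btensor_covspaces is_vspace_vtensor comult_btensor_bilinear]
    tlift_lhom[OF btensor_covspaces is_vspace_base_field
      bilinear_on_product[OF precoalgebraD(3)[OF C] precoalgebraD(3)[OF D]]]
  by (simp add: precoalgebra_def comult_btensor counit_btensor)

end

section \<open>Convolution\<close>

context
  fixes C :: "('k::field, 'a::ab_group_add) bistruct"
  assumes C: "precoalgebra C"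
begin

text \<open>A convolution with values in \<open>A\<close> is a genuine lift. Composing with a
  functional \<open>h\<close> turns it into evaluation on a form, so that Sweedler notation becomes
  available.\<close>

lemma conv_apply:
  assumes A: "prealgebra A" and f: "linear_on C A f" and g: "linear_on C A g"
    and h: "linear_on A base_field h" and x: "x \<in> car C"
  shows "h (conv C A f g x) = comult C x (\<lambda>x1 x2. h (amult A (f x1) (g x2)))"
    and "conv C A f g x \<in> car A"
proof -
  note m = prealgebraD(2)[OF A]
  have b: "bilinear_on C C A (\<lambda>x1 x2. amult A (f x1) (g x2))"
    by (intro bilinear_onI linear_on_comp[OF bilinear_on_left[OF m] f]
        linear_on_comp[OF bilinear_on_right[OF m] g] linear_on_mem[OF f] linear_on_mem[OF g])
  show "h (conv C A f g x) = comult C x (\<lambda>x1 x2. h (amult A (f x1) (g x2)))"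
    unfolding conv_def by (intro tlift_apply precoalgebraD(1,4) C prealgebraD(1) A b h x)
  show "conv C A f g x \<in> car A"
    unfolding conv_def
    by (intro linear_on_mem[OF tlift_linear] precoalgebraD(1,4) C prealgebraD(1) A b x)
qed

lemma conv_lhom:
  assumes A: "prealgebra A" and f: "linear_on C A f" and g: "linear_on C A g"
  shows "conv C A f g \<in> lhom C A"
proof -
  note m = prealgebraD(2)[OF A]
  have b: "bilinear_on C C A (\<lambda>x1 x2. amult A (f x1) (g x2))"
    by (intro bilinear_onI linear_on_comp[OF bilinear_on_left[OF m] f]
        linear_on_comp[OF bilinear_on_right[OF m] g] linear_on_mem[OF f] linear_on_mem[OF g])
  have l: "linear_on (tpow2 C) A (tlift C C A (\<lambda>x1 x2. amult A (f x1) (g x2)))"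
    by (intro tlift_linear precoalgebraD(1) C prealgebraD(1) A b)
  show ?thesis
    using linear_on_comp[OF l precoalgebraD(2)[OF C]] linear_on_zero[OF l is_vspace_vtensor]
      precoalgebraD(5)[OF C]
    by (auto simp: lhom_def conv_def)
qed

lemma prealgebra_ground: "prealgebra (ground :: ('k, 'k) bistruct)"
  by (simp add: prealgebra_def bilinear_on_product linear_on_id)

lemma conv_ground_apply:
  assumes "linear_on C base_field f" "linear_on C base_field g" "x \<in> car C"
  shows "conv C ground f g x = comult C x (\<lambda>x1 x2. f x1 * g x2)"
  using conv_apply(1)[OF prealgebra_ground, of f g "\<lambda>x. x" x] assms by (simp add: linear_on_id)

lemma conv_ground_lhom:
  assumes "linear_on C base_field f" "linear_on C base_field g"
  shows "conv C ground f g \<in> lhom C base_field"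
  using conv_lhom[OF prealgebra_ground, of f g] assms by simp

end


section \<open>Pairings of an algebra with a coalgebra\<close>

text \<open>Equivalently, \<open>p\<close> induces a map from \<open>A\<close> to the functionals on
  \<open>C\<close> that sends products to convolutions and the unit to the counit.\<close>

definition measuring ::
  "('k::field, 'a::ab_group_add) bistruct \<Rightarrow> ('k, 'c::ab_group_add) bistruct
    \<Rightarrow> ('a \<Rightarrow> 'c \<Rightarrow> 'k) \<Rightarrow> bool" where
  "measuring A C p \<longleftrightarrow> bilinear_on A C base_field p \<and>
     (\<forall>a\<in>car A. \<forall>b\<in>car A. \<forall>x\<in>car C.
        p (amult A a b) x = comult C x (\<lambda>x1 x2. p a x1 * p b x2)) \<and>
     (\<forall>x\<in>car C. p (aone A) x = counit C x)"

lemma measuringD: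
  assumes "measuring A C p"
  shows "bilinear_on A C base_field p"
    and "a \<in> car A \<Longrightarrow> b \<in> car A \<Longrightarrow> x \<in> car C \<Longrightarrow>
      p (amult A a b) x = comult C x (\<lambda>x1 x2. p a x1 * p b x2)"
    and "x \<in> car C \<Longrightarrow> p (aone A) x = counit C x"
  using assms by (simp_all add: measuring_def)

text \<open>On pure tensors the shuffled coproduct lets the double Sweedler sum separate into a sum
  over \<open>c\<close> and a sum over \<open>d\<close>, to which the hypotheses on
  \<open>\<mu>\<close> and \<open>\<nu>\<close> apply. Both sides are linear in each of
  \<open>s\<close>, \<open>t\<close> and \<open>u\<close>, so this suffices. With
  \<open>A' = A\<close> and \<open>B' = B\<close> it gives the tensor product of measurings; with
  other targets it serves to close the finite dual under convolution.\<close>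

lemma tprod_conv:
  fixes A :: "('k::field, 'a::ab_group_add, 'm) vspace_scheme"
    and A' :: "('k, 'a, 'm') vspace_scheme"
    and B :: "('k, 'b::ab_group_add, 'n) vspace_scheme"
    and B' :: "('k, 'b, 'n') vspace_scheme"
  assumes vsA: "is_vspace A" "is_vspace B" and vsA': "is_vspace A'" "is_vspace B'"
    and C: "precoalgebra C" and D: "precoalgebra D"
    and \<mu>: "bilinear_on A A A' \<mu>" and \<nu>: "bilinear_on B B B' \<nu>"
    and pb: "bilinear_on A C base_field p" and qb: "bilinear_on B D base_field q"
    and pb': "bilinear_on A' C base_field p" and qb': "bilinear_on B' D base_field q"
    and p: "\<And>a a' x. a \<in> car A \<Longrightarrow> a' \<in> car A \<Longrightarrow> x \<in> car C \<Longrightarrow>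
      p (\<mu> a a') x = comult C x (\<lambda>x1 x2. p a x1 * p a' x2)"
    and q: "\<And>b b' y. b \<in> car B \<Longrightarrow> b' \<in> car B \<Longrightarrow> y \<in> car D \<Longrightarrow>
      q (\<nu> b b') y = comult D y (\<lambda>y1 y2. q b y1 * q b' y2)"
    and s: "s \<in> car (A \<otimes>\<^sub>v B)" and t: "t \<in> car (A \<otimes>\<^sub>v B)" and u: "u \<in> car (C \<otimes>\<^sub>v D)"
  shows "tpair p q (tprod A A' \<mu> B B' \<nu> s t) u
    = comult (C \<otimes>\<^sub>b D) u (\<lambda>u1 u2. tpair p q s u1 * tpair p q t u2)"
proof -
  note vs = vsA precoalgebraD(1)[OF C] precoalgebraD(1)[OF D]
  note vs' = vsA' precoalgebraD(1)[OF C] precoalgebraD(1)[OF D]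
  note pq = tpair_bilinear[OF vs pb qb] and pq' = tpair_bilinear[OF vs' pb' qb']
  note pq_tens = tpair_tens[OF vs pb qb] and pq_tens' = tpair_tens[OF vs' pb' qb']
  note mb = tprod_bilinear[OF vs(1,2) \<mu> \<nu>]
  note \<Delta> = precoalgebraD(2,4)[OF precoalgebra_btensor[OF C D], simplified]
  have \<beta>: "bilinear_on (C \<otimes>\<^sub>v D) (C \<otimes>\<^sub>v D) base_field (\<lambda>u1 u2. tpair p q s u1 * tpair p q t u2)"
    if "s \<in> car (A \<otimes>\<^sub>v B)" "t \<in> car (A \<otimes>\<^sub>v B)" for s t
    by (intro bilinear_on_product bilinear_on_right[OF pq] that)
  show "tpair p q (tprod A A' \<mu> B B' \<nu> s t) u
      = comult (C \<otimes>\<^sub>b D) u (\<lambda>u1 u2. tpair p q s u1 * tpair p q t u2)"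
  proof -
    have pure: "tpair p q (tprod A A' \<mu> B B' \<nu> (tens A B a b) (tens A B a' b')) (tens C D c d)
      = comult (C \<otimes>\<^sub>b D) (tens C D c d) (\<lambda>u1 u2. tpair p q (tens A B a b) u1 * tpair p q (tens A B a' b') u2)"
      if el: "a \<in> car A" "b \<in> car B" "a' \<in> car A" "b' \<in> car B" "c \<in> car C" "d \<in> car D"
      for a b a' b' c d
    proof -
      note \<Delta>c = precoalgebraD(4)[OF C el(5)] and \<Delta>d = precoalgebraD(4)[OF D el(6)]
      have b1: "bilinear_on C C base_field (\<lambda>c1 c2. p a c1 * p a' c2)"
        by (intro bilinear_on_product bilinear_on_right[OF pb] el)
      have b2: "bilinear_on D D base_field (\<lambda>d1 d2. q b d1 * q b' d2)"
        by (intro bilinear_on_product bilinear_on_right[OF qb] el)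
      have "comult (C \<otimes>\<^sub>b D) (tens C D c d) (\<lambda>u1 u2. tpair p q (tens A B a b) u1 * tpair p q (tens A B a' b') u2)
        = comult C c (\<lambda>c1 c2. comult D d (\<lambda>d1 d2.
            tpair p q (tens A B a b) (tens C D c1 d1) * tpair p q (tens A B a' b') (tens C D c2 d2)))"
        by (rule comult_btensor_apply[OF C D el(5,6) \<beta>]) (simp_all add: tens_mem el)
      \<comment> \<open>The sum over \<open>d\<close> depends on \<open>c1\<close> and
        \<open>c2\<close> only through a scalar factor. Writing that sum on the left makes it the
        constant that \<open>tensor_apply_mult\<close> extracts from the sum over
        \<open>c\<close>.\<close>
      also have "\<dots> = comult C c (\<lambda>c1 c2. comult D d (\<lambda>d1 d2. q b d1 * q b' d2) * (p a c1 * p a' c2))"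
      proof (rule tensor_apply_cong[OF vs(3,3) \<Delta>c])
        fix c1 c2 assume c: "c1 \<in> car C" "c2 \<in> car C"
        have "comult D d (\<lambda>d1 d2.
            tpair p q (tens A B a b) (tens C D c1 d1) * tpair p q (tens A B a' b') (tens C D c2 d2))
          = comult D d (\<lambda>d1 d2. (p a c1 * p a' c2) * (q b d1 * q b' d2))"
          by (rule tensor_apply_cong[OF vs(4,4) \<Delta>d]) (simp add: pq_tens el c)
        also have "\<dots> = (p a c1 * p a' c2) * comult D d (\<lambda>d1 d2. q b d1 * q b' d2)"
          by (rule tensor_apply_mult[OF vs(4,4) b2 \<Delta>d])
        finally show "comult D d (\<lambda>d1 d2.
            tpair p q (tens A B a b) (tens C D c1 d1) * tpair p q (tens A B a' b') (tens C D c2 d2))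
          = comult D d (\<lambda>d1 d2. q b d1 * q b' d2) * (p a c1 * p a' c2)" by simp
      qed
      also have "\<dots> = comult D d (\<lambda>d1 d2. q b d1 * q b' d2) * comult C c (\<lambda>c1 c2. p a c1 * p a' c2)"
        by (rule tensor_apply_mult[OF vs(3,3) b1 \<Delta>c])
      also have "\<dots> = tpair p q (tprod A A' \<mu> B B' \<nu> (tens A B a b) (tens A B a' b')) (tens C D c d)"
        by (simp add: tprod_tens[OF vs(1,2) \<mu> \<nu>] pq_tens' el bilinear_on_mem[OF \<mu>] bilinear_on_mem[OF \<nu>] p q)
      finally show ?thesis by (rule sym)
    qed
    have lu: "linear_on (C \<otimes>\<^sub>v D) base_field (tpair p q (tprod A A' \<mu> B B' \<nu> s t))"
      "linear_on (C \<otimes>\<^sub>v D) base_field (\<lambda>u. comult (C \<otimes>\<^sub>b D) u (\<lambda>u1 u2. tpair p q s u1 * tpair p q t u2))"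
      if "s \<in> car (A \<otimes>\<^sub>v B)" "t \<in> car (A \<otimes>\<^sub>v B)" for s t
      by (rule bilinear_on_right[OF pq' bilinear_on_mem[OF mb that]],
          rule linear_on_comp[OF tensor_apply_linear[OF is_vspace_vtensor is_vspace_vtensor] \<Delta>(1)])
    have lt: "linear_on (A \<otimes>\<^sub>v B) base_field (\<lambda>t. tpair p q (tprod A A' \<mu> B B' \<nu> s t) u)"
      "linear_on (A \<otimes>\<^sub>v B) base_field (\<lambda>t. comult (C \<otimes>\<^sub>b D) u (\<lambda>u1 u2. tpair p q s u1 * tpair p q t u2))"
      if "s \<in> car (A \<otimes>\<^sub>v B)" "u \<in> car (C \<otimes>\<^sub>v D)" for s u
      by (rule linear_on_comp[OF bilinear_on_left[OF pq' that(2)] bilinear_on_right[OF mb that(1)]],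
          rule tensor_apply_param[OF is_vspace_vtensor is_vspace_vtensor is_vspace_vtensor \<beta>[OF that(1)]
            linear_on_mult_left[OF bilinear_on_left[OF pq]] \<Delta>(2)[OF that(2)]])
    have ls: "linear_on (A \<otimes>\<^sub>v B) base_field (\<lambda>s. tpair p q (tprod A A' \<mu> B B' \<nu> s t) u)"
      "linear_on (A \<otimes>\<^sub>v B) base_field (\<lambda>s. comult (C \<otimes>\<^sub>b D) u (\<lambda>u1 u2. tpair p q s u1 * tpair p q t u2))"
      if "t \<in> car (A \<otimes>\<^sub>v B)" "u \<in> car (C \<otimes>\<^sub>v D)" for t u
      by (rule linear_on_comp[OF bilinear_on_left[OF pq' that(2)] bilinear_on_left[OF mb that(1)]],
          rule tensor_apply_param[OF is_vspace_vtensor is_vspace_vtensor is_vspace_vtensor \<beta>[OF _ that(1)]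
            linear_on_mult_right[OF bilinear_on_left[OF pq]] \<Delta>(2)[OF that(2)]])
    show ?thesis
    proof (rule tensor_ext[OF ls[OF t u] _ s])
      fix a b assume ab: "a \<in> car A" "b \<in> car B"
      note abm = tens_mem[OF ab]
      show "tpair p q (tprod A A' \<mu> B B' \<nu> (tens A B a b) t) u
        = comult (C \<otimes>\<^sub>b D) u (\<lambda>u1 u2. tpair p q (tens A B a b) u1 * tpair p q t u2)"
      proof (rule tensor_ext[OF lt[OF abm u] _ t])
        fix a' b' assume ab': "a' \<in> car A" "b' \<in> car B"
        note ab'm = tens_mem[OF ab']
        show "tpair p q (tprod A A' \<mu> B B' \<nu> (tens A B a b) (tens A B a' b')) u
          = comult (C \<otimes>\<^sub>b D) u (\<lambda>u1 u2. tpair p q (tens A B a b) u1 * tpair p q (tens A B a' b') u2)"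
          by (rule tensor_ext[OF lu[OF abm ab'm] _ u]) (rule pure[OF ab ab'])
      qed
    qed
  qed
qed

text \<open>In terms of dual algebras: the tensor product of two multiplicative maps into
  convolution algebras, followed by the canonical map into the functionals on
  \<open>C \<otimes> D\<close>, is multiplicative again.\<close>

lemma measuring_btensor:
  assumes A: "prealgebra A" and B: "prealgebra B" and C: "precoalgebra C" and D: "precoalgebra D"
    and p: "measuring A C p" and q: "measuring B D q"
  shows "measuring (A \<otimes>\<^sub>b B) (C \<otimes>\<^sub>b D) (tpair p q)"
proof -
  note vs = prealgebraD(1)[OF A] prealgebraD(1)[OF B] precoalgebraD(1)[OF C] precoalgebraD(1)[OF D]
  note pb = measuringD(1)[OF p] and qb = measuringD(1)[OF q]
  note pq = tpair_bilinear[OF vs pb qb]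
  note pq_tens = tpair_tens[OF vs pb qb]
  have one: "tpair p q (aone (A \<otimes>\<^sub>b B)) u = counit (C \<otimes>\<^sub>b D) u" if u: "u \<in> car (C \<otimes>\<^sub>v D)" for u
  proof (rule tensor_ext[OF _ _ _ u])
    have "tens A B (aone A) (aone B) \<in> car (A \<otimes>\<^sub>v B)" by (simp add: tens_mem prealgebraD(3)[OF A] prealgebraD(3)[OF B])
    then show "linear_on (C \<otimes>\<^sub>v D) base_field (tpair p q (aone (A \<otimes>\<^sub>b B)))"
      using bilinear_on_right[OF pq] by simp
    show "linear_on (C \<otimes>\<^sub>v D) base_field (counit (C \<otimes>\<^sub>b D))"
      using precoalgebraD(3)[OF precoalgebra_btensor[OF C D]] by simp
    show "tpair p q (aone (A \<otimes>\<^sub>b B)) (tens C D c d) = counit (C \<otimes>\<^sub>b D) (tens C D c d)"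
      if "c \<in> car C" "d \<in> car D" for c d
      using that by (simp add: pq_tens prealgebraD(3)[OF A] prealgebraD(3)[OF B] counit_btensor_tens[OF C D]
          measuringD(3)[OF p] measuringD(3)[OF q])
  qed
  show ?thesis using pq one tprod_conv[OF vs(1,2,1,2) C D prealgebraD(2)[OF A] prealgebraD(2)[OF B] pb qb pb qb
        measuringD(2)[OF p] measuringD(2)[OF q]]
    by (simp add: measuring_def amult_btensor)
qed


section \<open>Bialgebras without associativity and coassociativity\<close>

text \<open>
  \<open>NAlgCoalg\<close> and \<open>NCoalgAlg\<close> are the coassociative and the associative instances of this notion, which
  is self-dual.
\<close>

definition prebialgebra :: "('k::field, 'a::ab_group_add) bistruct \<Rightarrow> bool" where
  "prebialgebra A \<longleftrightarrow> nonassoc_algebra A \<and> noncoassoc_coalgebra A \<and>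
     (\<forall>a\<in>car A. \<forall>b\<in>car A. comult A (amult A a b) = amult (A \<otimes>\<^sub>b A) (comult A a) (comult A b)) \<and>
     comult A (aone A) = tens A A (aone A) (aone A) \<and>
     (\<forall>a\<in>car A. \<forall>b\<in>car A. counit A (amult A a b) = counit A a * counit A b) \<and>
     counit A (aone A) = 1"

lemma nonassoc_algebra_prealgebra: "nonassoc_algebra A \<Longrightarrow> prealgebra A"
  by (simp add: nonassoc_algebra_def prealgebra_def)

lemma noncoassoc_coalgebra_precoalgebra: "noncoassoc_coalgebra A \<Longrightarrow> precoalgebra A"
  by (simp add: noncoassoc_coalgebra_def precoalgebra_def)

lemma prebialgebraD:
  assumes "prebialgebra A"
  shows "nonassoc_algebra A" "noncoassoc_coalgebra A" "prealgebra A" "precoalgebra A" "is_vspace A"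
    and "a \<in> car A \<Longrightarrow> b \<in> car A \<Longrightarrow> comult A (amult A a b) = amult (A \<otimes>\<^sub>b A) (comult A a) (comult A b)"
    and "comult A (aone A) = tens A A (aone A) (aone A)"
    and "a \<in> car A \<Longrightarrow> b \<in> car A \<Longrightarrow> counit A (amult A a b) = counit A a * counit A b"
    and "counit A (aone A) = 1"
    and "a \<in> car A \<Longrightarrow> amult A (aone A) a = a" "a \<in> car A \<Longrightarrow> amult A a (aone A) = a"
    and "aone A \<in> car A" "a \<in> car A \<Longrightarrow> b \<in> car A \<Longrightarrow> amult A a b \<in> car A"
  using assms bilinear_on_mem[of A A A "amult A" a b]
  by (auto simp: prebialgebra_def nonassoc_algebra_def noncoassoc_coalgebra_def prealgebra_def precoalgebra_def)

lemma NCoalgAlg_iff: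
  "A \<in> NCoalgAlg \<longleftrightarrow> prebialgebra A \<and>
     (\<forall>a\<in>car A. \<forall>b\<in>car A. \<forall>c\<in>car A. amult A (amult A a b) c = amult A a (amult A b c))"
  by (auto simp: NCoalgAlg_def assoc_algebra_def algebra_hom_def prebialgebra_def
      noncoassoc_coalgebra_def)

lemma counit_comult_apply:
  assumes C: "noncoassoc_coalgebra C" and f: "linear_on C base_field f" and c: "c \<in> car C"
  shows "comult C c (\<lambda>a b. counit C a * f b) = f c" and "comult C c (\<lambda>a b. f a * counit C b) = f c"
proof -
  note P = noncoassoc_coalgebra_precoalgebra[OF C]
  note vs = precoalgebraD(1)[OF P] and \<Delta> = precoalgebraD(4)[OF P c] and \<epsilon> = precoalgebraD(3)[OF P]
  have b1: "bilinear_on C C C (\<lambda>a b. scl C (counit C a) b)"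
    by (intro bilinear_onI linear_on_scl_left linear_on_scl linear_on_id vs \<epsilon>)
  have b2: "bilinear_on C C C (\<lambda>a b. scl C (counit C b) a)"
    by (intro bilinear_onI linear_on_scl_left linear_on_scl linear_on_id vs \<epsilon>)
  have "f c = f (tlift C C C (\<lambda>a b. scl C (counit C a) b) (comult C c))"
    using C c by (simp add: noncoassoc_coalgebra_def)
  also have "\<dots> = comult C c (\<lambda>a b. f (scl C (counit C a) b))"
    by (rule tlift_apply[OF vs vs vs b1 f \<Delta>])
  also have "\<dots> = comult C c (\<lambda>a b. counit C a * f b)"
    by (rule tensor_apply_cong[OF vs vs \<Delta>]) (simp add: linear_on_scale[OF f])
  finally show "comult C c (\<lambda>a b. counit C a * f b) = f c" by (rule sym)
  have "f c = f (tlift C C C (\<lambda>a b. scl C (counit C b) a) (comult C c))"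
    using C c by (simp add: noncoassoc_coalgebra_def)
  also have "\<dots> = comult C c (\<lambda>a b. f (scl C (counit C b) a))"
    by (rule tlift_apply[OF vs vs vs b2 f \<Delta>])
  also have "\<dots> = comult C c (\<lambda>a b. f a * counit C b)"
    by (rule tensor_apply_cong[OF vs vs \<Delta>]) (simp add: linear_on_scale[OF f] mult.commute)
  finally show "comult C c (\<lambda>a b. f a * counit C b) = f c" by (rule sym)
qed

section \<open>Multiplication and unit as coalgebra maps\<close>

lemma mlin_lhom: "prealgebra A \<Longrightarrow> mlin A \<in> lhom (tpow2 A) A"
  and mlin_tens: "prealgebra A \<Longrightarrow> a \<in> car A \<Longrightarrow> b \<in> car A \<Longrightarrow> mlin A (tens A A a b) = amult A a b"
  by (simp_all add: mlin_def prealgebra_def tlift_lhom tlift_tens)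

text \<open>Shuffling the coproducts of \<open>x\<close> and \<open>y\<close> and multiplying in
  both legs is the product of the coproducts in the tensor square. For this reason the
  multiplication respects coproducts exactly when the coproduct respects multiplication.\<close>

lemma tmap2_mlin_comult:
  assumes A: "prealgebra A" and C: "precoalgebra A" and x: "x \<in> car A" and y: "y \<in> car A"
  shows "tmap2 (A \<otimes>\<^sub>b A) A (mlin A) (comult (A \<otimes>\<^sub>b A) (tens A A x y))
    = amult (A \<otimes>\<^sub>b A) (comult A x) (comult A y)"
proof -
  let ?T = "A \<otimes>\<^sub>v A"
  note vs = prealgebraD(1)[OF A]
  note ml = lhom_linear[OF mlin_lhom[OF A]]
  have b: "bilinear_on ?T ?T ?T (\<lambda>u v. tens A A (mlin A u) (mlin A v))"
    by (intro bilinear_onI linear_on_tens_left linear_on_tens_right ml linear_on_mem[OF ml])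
  note lin = tlift_linear[OF is_vspace_vtensor is_vspace_vtensor is_vspace_vtensor b]
  have "tlift ?T ?T ?T (\<lambda>u v. tens A A (mlin A u) (mlin A v)) (comult (A \<otimes>\<^sub>b A) (tens A A x y))
    = tlift A A ?T (\<lambda>a1 a2. tlift A A ?T (\<lambda>b1 b2.
        tlift ?T ?T ?T (\<lambda>u v. tens A A (mlin A u) (mlin A v)) (tens ?T ?T (tens A A a1 b1) (tens A A a2 b2)))
        (comult A y)) (comult A x)"
    unfolding comult_btensor_tens[OF C C x y]
    by (rule tlift_tlift_comp[OF vs vs vs vs is_vspace_vtensor is_vspace_vtensor shuffle_bilinear[OF C C]
          lin precoalgebraD(4)[OF C x] precoalgebraD(4)[OF C y]])
  also have "\<dots> = tlift A A ?T (\<lambda>a1 a2. tlift A A ?T (\<lambda>b1 b2. tens A A (amult A a1 b1) (amult A a2 b2))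
        (comult A y)) (comult A x)"
    by (simp add: tlift_tens[OF is_vspace_vtensor is_vspace_vtensor is_vspace_vtensor b] tens_mem
        mlin_tens[OF A] cong: tlift_cong)
  finally show ?thesis by (simp add: tmap2_def amult_btensor tprod_def)
qed

lemma mlin_coalgebra_hom_iff:
  assumes A: "prealgebra A" and C: "precoalgebra A"
  shows "mlin A \<in> coalgebra_hom (A \<otimes>\<^sub>b A) A \<longleftrightarrow>
    (\<forall>a\<in>car A. \<forall>b\<in>car A. comult A (amult A a b) = amult (A \<otimes>\<^sub>b A) (comult A a) (comult A b)) \<and>
    (\<forall>a\<in>car A. \<forall>b\<in>car A. counit A (amult A a b) = counit A a * counit A b)" (is "?L \<longleftrightarrow> ?R1 \<and> ?R2")
proof
  assume L: ?L
  have "counit A (amult A a b) = counit A a * counit A b"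
    "comult A (amult A a b) = amult (A \<otimes>\<^sub>b A) (comult A a) (comult A b)"
    if "a \<in> car A" "b \<in> car A" for a b
  proof -
    have "tens A A a b \<in> car (A \<otimes>\<^sub>b A)" using that by (simp add: tens_mem)
    with L have "counit A (mlin A (tens A A a b)) = counit (A \<otimes>\<^sub>b A) (tens A A a b)"
      "comult A (mlin A (tens A A a b)) = tmap2 (A \<otimes>\<^sub>b A) A (mlin A) (comult (A \<otimes>\<^sub>b A) (tens A A a b))"
      unfolding coalgebra_hom_def by blast+
    then show "counit A (amult A a b) = counit A a * counit A b"
      "comult A (amult A a b) = amult (A \<otimes>\<^sub>b A) (comult A a) (comult A b)"
      using that by (simp_all add: mlin_tens[OF A] counit_btensor_tens[OF C C] tmap2_mlin_comult[OF A C])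
  qed
  then show "?R1 \<and> ?R2" by blast
next
  assume R: "?R1 \<and> ?R2"
  let ?T = "A \<otimes>\<^sub>v A"
  note ml = lhom_linear[OF mlin_lhom[OF A]]
  have b: "bilinear_on ?T ?T ?T (\<lambda>u v. tens A A (mlin A u) (mlin A v))"
    by (intro bilinear_onI linear_on_tens_left linear_on_tens_right ml linear_on_mem[OF ml])
  have tm: "linear_on (tpow2 ?T) ?T (tmap2 (A \<otimes>\<^sub>b A) A (mlin A))"
    using tlift_linear[OF is_vspace_vtensor is_vspace_vtensor is_vspace_vtensor b] by (simp add: tmap2_def)
  have \<Delta>T: "linear_on ?T (tpow2 ?T) (comult (A \<otimes>\<^sub>b A))" "linear_on ?T base_field (counit (A \<otimes>\<^sub>b A))"
    using precoalgebraD(2,3)[OF precoalgebra_btensor[OF C C]] by simp_all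
  have "counit A (mlin A u) = counit (A \<otimes>\<^sub>b A) u" if u: "u \<in> car ?T" for u
    by (rule tensor_ext[OF linear_on_comp[OF precoalgebraD(3)[OF C] ml] \<Delta>T(2) _ u])
      (simp add: R mlin_tens[OF A] counit_btensor_tens[OF C C])
  moreover have "comult A (mlin A u) = tmap2 (A \<otimes>\<^sub>b A) A (mlin A) (comult (A \<otimes>\<^sub>b A) u)"
    if u: "u \<in> car ?T" for u
    by (rule tensor_ext[OF linear_on_comp[OF precoalgebraD(2)[OF C] ml] linear_on_comp[OF tm \<Delta>T(1)] _ u])
      (simp add: R mlin_tens[OF A] tmap2_mlin_comult[OF A C])
  ultimately show ?L using mlin_lhom[OF A] by (simp add: coalgebra_hom_def)
qed

lemma ulin_coalgebra_hom_iff: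
  fixes A :: "('k::field, 'b::ab_group_add) bistruct"
  assumes A: "prealgebra A" and C: "precoalgebra A"
  shows "ulin A \<in> coalgebra_hom ground A \<longleftrightarrow>
    comult A (aone A) = tens A A (aone A) (aone A) \<and> counit A (aone A) = 1"
proof -
  note vs = prealgebraD(1)[OF A] and one = prealgebraD(3)[OF A]
  have u: "linear_on base_field A (ulin A)"
    unfolding ulin_def by (intro linear_on_scl_left vs linear_on_id one)
  have b: "bilinear_on base_field base_field (tpow2 A) (\<lambda>x y. tens A A (ulin A x) (ulin A y))"
    by (intro bilinear_onI linear_on_tens_left linear_on_tens_right u linear_on_mem[OF u])
  have "tmap2 ground A (ulin A) (fscl c (tens base_field base_field 1 1)) = fscl c (tens A A (aone A) (aone A))"
    for c
    using linear_on_scale[OF tlift_linear[OF is_vspace_base_field is_vspace_base_field is_vspace_vtensor b]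
        tens_mem[of 1 base_field 1 base_field], of c]
      tlift_tens[OF is_vspace_base_field is_vspace_base_field is_vspace_vtensor b, of 1 1]
    by (simp add: tmap2_def ulin_def scl_one[OF vs])
  moreover have "counit A (ulin A c) = c * counit A (aone A)" for c
    by (simp add: ulin_def linear_on_scale[OF precoalgebraD(3)[OF C] one])
  moreover have "comult A (ulin A c) = fscl c (comult A (aone A))" for c
    by (simp add: ulin_def linear_on_scale[OF precoalgebraD(2)[OF C] one])
  moreover have "fscl 1 t = t" for t :: "('k, 'b) tensor2"
    by (simp add: fscl_def)
  ultimately show ?thesis
    using u by (auto simp: coalgebra_hom_def lhom_def dest: spec[of _ 1])
qed

lemma NAlgCoalg_iff:
  "C \<in> NAlgCoalg \<longleftrightarrow> prebialgebra C \<and>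
     (\<forall>c\<in>car C. comult_left C (comult C c) = comult_right C (comult C c))"
  using mlin_coalgebra_hom_iff[of C] ulin_coalgebra_hom_iff[of C]
    nonassoc_algebra_prealgebra[of C] noncoassoc_coalgebra_precoalgebra[of C]
  unfolding NAlgCoalg_def coassoc_coalgebra_def prebialgebra_def by blast

lemma comult_amult_apply:
  assumes A: "prebialgebra A" and x: "x \<in> car A" and y: "y \<in> car A"
    and \<beta>: "bilinear_on A A base_field \<beta>"
  shows "comult A (amult A x y) \<beta>
    = comult A x (\<lambda>x1 x2. comult A y (\<lambda>y1 y2. \<beta> (amult A x1 y1) (amult A x2 y2)))"
proof -
  note vs = prebialgebraD(5)[OF A] and m = prealgebraD(2)[OF prebialgebraD(3)[OF A]]
  note \<Delta> = precoalgebraD(4)[OF prebialgebraD(4)[OF A]]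
  have "comult A (amult A x y) \<beta> = comult A x (\<lambda>x1 x2. comult A y (\<lambda>y1 y2.
      tens A A (amult A x1 y1) (amult A x2 y2) \<beta>))"
    unfolding prebialgebraD(6)[OF A x y] amult_btensor tprod_def
    by (rule tlift_tlift_apply[OF vs vs vs vs is_vspace_vtensor tprod_tens_bilinear[OF vs vs m m]
          tensor_apply_linear[OF vs vs] \<Delta>[OF x] \<Delta>[OF y]])
  then show ?thesis by (simp add: tens_apply[OF vs vs \<beta>])
qed


section \<open>Iterated coproducts\<close>

context
  fixes C :: "('k::field, 'a::ab_group_add) bistruct"
  assumes C: "precoalgebra C"
begin

lemma comult_left_right_bilinear:
  "bilinear_on C C (tpow3 C) (\<lambda>a b. tlift C C (tpow3 C) (\<lambda>a1 a2. tens3 C a1 a2 b) (comult C a))"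
  "bilinear_on C C (tpow3 C) (\<lambda>a b. tlift C C (tpow3 C) (\<lambda>b1 b2. tens3 C a b1 b2) (comult C b))"
proof -
  note vs = precoalgebraD(1)[OF C] and \<Delta> = precoalgebraD(2)[OF C] and \<Delta>m = precoalgebraD(4)[OF C]
  have t: "bilinear_on C C (tpow3 C) (\<lambda>x y. tens3 C x y z)"
    "bilinear_on C C (tpow3 C) (\<lambda>x y. tens3 C z x y)"
    "bilinear_on C C (tpow3 C) (\<lambda>x y. tens3 C x z y)" if "z \<in> car C" for z
    using tens3_trilinear[of C] that by (auto simp: trilinear_on_def bilinear_on_def)
  show "bilinear_on C C (tpow3 C) (\<lambda>a b. tlift C C (tpow3 C) (\<lambda>a1 a2. tens3 C a1 a2 b) (comult C a))"
    by (rule bilinear_onI, rule tlift_param[OF vs vs vs is_vspace_vtensor t(1) bilinear_on_right[OF t(3)] \<Delta>m],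
        assumption+, rule linear_on_comp[OF tlift_linear[OF vs vs is_vspace_vtensor t(1)] \<Delta>])
  show "bilinear_on C C (tpow3 C) (\<lambda>a b. tlift C C (tpow3 C) (\<lambda>b1 b2. tens3 C a b1 b2) (comult C b))"
    by (rule bilinear_onI, rule linear_on_comp[OF tlift_linear[OF vs vs is_vspace_vtensor t(2)] \<Delta>], assumption,
        rule tlift_param[OF vs vs vs is_vspace_vtensor t(2) bilinear_on_left[OF t(1)] \<Delta>m])
qed

lemma comult_left_linear: "linear_on (tpow2 C) (tpow3 C) (comult_left C)"
  and comult_right_linear: "linear_on (tpow2 C) (tpow3 C) (comult_right C)"
  unfolding comult_left_def comult_right_def
  by (intro tlift_linear precoalgebraD(1) C is_vspace_vtensor comult_left_right_bilinear)+

lemma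
  assumes t: "t \<in> car (tpow2 C)" and g: "linear_on (tpow3 C) base_field g"
  shows comult_left_apply: "g (comult_left C t) = t (\<lambda>a b. comult C a (\<lambda>a1 a2. g (tens3 C a1 a2 b)))"
    and comult_right_apply: "g (comult_right C t) = t (\<lambda>a b. comult C b (\<lambda>b1 b2. g (tens3 C a b1 b2)))"
proof -
  note vs = precoalgebraD(1)[OF C] and \<Delta>m = precoalgebraD(4)[OF C]
  have t1: "bilinear_on C C (tpow3 C) (\<lambda>x y. tens3 C x y z)"
    and t2: "bilinear_on C C (tpow3 C) (\<lambda>x y. tens3 C z x y)" if "z \<in> car C" for z
    using tens3_trilinear[of C] that by (auto simp: trilinear_on_def bilinear_on_def)
  have "g (comult_left C t)
    = t (\<lambda>a b. g (tlift C C (tpow3 C) (\<lambda>a1 a2. tens3 C a1 a2 b) (comult C a)))"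
    unfolding comult_left_def
    by (rule tlift_apply[OF vs vs is_vspace_vtensor comult_left_right_bilinear(1) g t])
  also have "\<dots> = t (\<lambda>a b. comult C a (\<lambda>a1 a2. g (tens3 C a1 a2 b)))"
    by (rule tensor_apply_cong[OF vs vs t]) (rule tlift_apply[OF vs vs is_vspace_vtensor t1 g \<Delta>m])
  finally show "g (comult_left C t) = t (\<lambda>a b. comult C a (\<lambda>a1 a2. g (tens3 C a1 a2 b)))" .
  have "g (comult_right C t)
    = t (\<lambda>a b. g (tlift C C (tpow3 C) (\<lambda>b1 b2. tens3 C a b1 b2) (comult C b)))"
    unfolding comult_right_def
    by (rule tlift_apply[OF vs vs is_vspace_vtensor comult_left_right_bilinear(2) g t])
  also have "\<dots> = t (\<lambda>a b. comult C b (\<lambda>b1 b2. g (tens3 C a b1 b2)))"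
    by (rule tensor_apply_cong[OF vs vs t]) (rule tlift_apply[OF vs vs is_vspace_vtensor t2 g \<Delta>m])
  finally show "g (comult_right C t) = t (\<lambda>a b. comult C b (\<lambda>b1 b2. g (tens3 C a b1 b2)))" .
qed

end


text \<open>The image is again a functional on forms, and applying it to a form is a linear
  functional of the image, which passes through the lift.\<close>

lemma tensor_image:
  assumes "is_vspace V" "is_vspace W" "bilinear_on V W (X \<otimes>\<^sub>v Y) F" "t \<in> car (V \<otimes>\<^sub>v W)"
    and "is_vspace X" "is_vspace Y"
  shows "tlift V W (X \<otimes>\<^sub>v Y) F t \<in> car (X \<otimes>\<^sub>v Y)"
    and "tlift V W (X \<otimes>\<^sub>v Y) F t \<beta> = t (\<lambda>v w. F v w \<beta>)"
  using tlift_apply[OF assms(1,2) is_vspace_vtensor assms(3) tensor_apply_linear[OF assms(5,6)] assms(4)]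
    linear_on_mem[OF tlift_linear[OF assms(1,2) is_vspace_vtensor assms(3)] assms(4)] by auto

section \<open>Good subspaces and the finite dual\<close>

abbreviation (input) app :: "('x \<Rightarrow> 'k) \<Rightarrow> 'x \<Rightarrow> 'k" where
  "app \<equiv> \<lambda>f x. f x"

lemma dual_simps [simp]: "car (dual V) = lhom V base_field" "scl (dual V) = fscl"
  by (simp_all add: dual_def)

lemma dual_subspace_simps [simp]: "car (dual_subspace S) = S" "scl (dual_subspace S) = fscl"
  by (simp_all add: dual_subspace_def)

lemma lhom_base_zero: "0 \<in> lhom V base_field"
  and lhom_base_add: "f \<in> lhom V base_field \<Longrightarrow> g \<in> lhom V base_field \<Longrightarrow> f + g \<in> lhom V base_field"
  and lhom_base_fscl: "f \<in> lhom V base_field \<Longrightarrow> fscl c f \<in> lhom V base_field"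
  by (auto simp: lhom_def linear_on_def algebra_simps)

lemma subspace_fsclI:
  assumes "0 \<in> S" "\<And>f g. f \<in> S \<Longrightarrow> g \<in> S \<Longrightarrow> f + g \<in> S" "\<And>c f. f \<in> S \<Longrightarrow> fscl c f \<in> S"
  shows "module.subspace fscl S"
proof -
  interpret vector_space fscl by (rule vector_space_fscl)
  show ?thesis by (rule subspaceI) (use assms in auto)
qed

lemma is_vspace_dual: "is_vspace (dual V)"
  unfolding is_vspace_def dual_simps
  by (intro conjI vector_space_fscl subspace_fsclI lhom_base_zero lhom_base_add lhom_base_fscl)

lemma is_vspace_dual_subspace: "is_vspace (dual_subspace S) \<longleftrightarrow> module.subspace fscl S"
  by (simp add: is_vspace_def vector_space_fscl)

lemma subspace_span_fscl: "module.subspace fscl (module.span fscl G)"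
  and span_fscl_base: "f \<in> G \<Longrightarrow> f \<in> module.span fscl G"
  and span_fscl_minimal: "G \<subseteq> S \<Longrightarrow> module.subspace fscl S \<Longrightarrow> module.span fscl G \<subseteq> S"
proof -
  interpret vector_space fscl by (rule vector_space_fscl)
  show "subspace (span G)" by (rule subspace_span)
  show "f \<in> G \<Longrightarrow> f \<in> span G" by (rule span_base)
  show "G \<subseteq> S \<Longrightarrow> subspace S \<Longrightarrow> span G \<subseteq> S" by (rule span_minimal)
qed

lemma app_bilinear:
  assumes "car D \<subseteq> lhom V base_field" "scl D = fscl"
  shows "bilinear_on D V base_field app"
  using assms by (auto intro!: bilinear_onI linear_onI simp: lhom_def linear_on_def)

lemma eval_linear: "scl D = fscl \<Longrightarrow> linear_on D base_field (\<lambda>f. f x)"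
  by (rule linear_onI) simp_all

lemma eval_product_bilinear:
  "scl D = fscl \<Longrightarrow> scl E = fscl \<Longrightarrow> bilinear_on D E base_field (\<lambda>f g. f x * g y)"
  by (intro bilinear_on_product eval_linear)

lemma app_nondegenerate:
  assumes "car D \<subseteq> lhom V base_field"
  shows "nondegenerate D V app"
  using assms by (auto simp: nondegenerate_def fun_eq_iff lhom_def subset_iff)

text \<open>Identifies \<open>phi\<close> with the pairing induced by evaluation, so that goodness
  can be expressed by values on pure tensors and injectivity becomes a matter of
  nondegeneracy.\<close>

lemma
  assumes V: "is_vspace V" and D: "is_vspace D" "car D \<subseteq> lhom V base_field" "scl D = fscl"
    and t: "t \<in> car (tpow2 D)"
  shows phi_lhom: "phi V D t \<in> lhom (tpow2 V) base_field"
    and phi_apply: "u \<in> car (tpow2 V) \<Longrightarrow> phi V D t u = tpair app app t u"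
proof -
  have b: "bilinear_on V V base_field (\<lambda>a b. f a * g b)" if "f \<in> car D" "g \<in> car D" for f g
    using that D by (intro bilinear_on_product) (auto simp: lhom_def)
  \<comment> \<open>Elements of the dual vanish off the carrier, so the pairing has to be cut off
    there. The cut-off pairing is visibly linear in the tensor, which gives the bilinearity behind
    the lift in \<open>phi\<close>.\<close>
  have eq: "tlift V V base_field (\<lambda>a b. f a * g b) = (\<lambda>u. if u \<in> car (tpow2 V) then tpair app app (tens D D f g) u else 0)"
    if "f \<in> car D" "g \<in> car D" for f g
    using lhom_outside[OF tlift_lhom[OF V V is_vspace_base_field b[OF that]]]
    by (auto simp: tlift_base[OF V V b] that tpair_tens_left[OF D(1,1) V V app_bilinear app_bilinear] D)
  have pb: "bilinear_on (tpow2 D) (tpow2 V) base_field (tpair app app)"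
    by (rule tpair_bilinear[OF D(1,1) V V app_bilinear app_bilinear]) (simp_all add: D)
  have db: "bilinear_on D D (dual (tpow2 V)) (\<lambda>f g. tlift V V base_field (\<lambda>a b. f a * g b))"
  proof (subst bilinear_on_cong[OF eq D(1,1)])
    have "linear_on (tpow2 D) (dual (tpow2 V))
      (\<lambda>s u. if u \<in> car (tpow2 V) then tpair app app s u else 0)"
    proof (rule linear_onI)
      fix s assume s: "s \<in> car (tpow2 D)"
      show "(\<lambda>u. if u \<in> car (tpow2 V) then tpair app app s u else 0) \<in> car (dual (tpow2 V))"
        using bilinear_on_right[OF pb s] linear_on_cong[OF _ is_vspace_vtensor,
            of V V "\<lambda>u. if u \<in> car (tpow2 V) then tpair app app s u else 0" "tpair app app s" base_field]
        by (simp add: lhom_def)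
    qed (auto simp: fun_eq_iff linear_on_add[OF bilinear_on_left[OF pb]]
        linear_on_scale[OF bilinear_on_left[OF pb], simplified])
    then show "bilinear_on D D (dual (tpow2 V))
      (\<lambda>f g u. if u \<in> car (tpow2 V) then tpair app app (tens D D f g) u else 0)"
      by (rule bilinear_on_comp[OF tens_bilinear])
  qed
  show "phi V D t \<in> lhom (tpow2 V) base_field"
    using linear_on_mem[OF tlift_linear[OF D(1,1) is_vspace_dual db] t] by (simp add: phi_def)
  show "phi V D t u = tpair app app t u" if u: "u \<in> car (tpow2 V)"
  proof -
    have "linear_on (dual (tpow2 V)) base_field (\<lambda>h. h u)" by (rule linear_onI) simp_all
    then have "phi V D t u = t (\<lambda>f g. tlift V V base_field (\<lambda>a b. f a * g b) u)"
      unfolding phi_def by (rule tlift_apply[OF D(1,1) is_vspace_dual db _ t])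
    also have "\<dots> = tpair app app t u"
      unfolding tpair_def by (rule tensor_apply_cong[OF D(1,1) t]) (simp add: tlift_base[OF V V b u])
    finally show ?thesis .
  qed
qed

section \<open>Good subspaces through generators\<close>

text \<open>The functionals whose value on a product splits with both legs in \<open>S\<close>. A
  subspace \<open>S\<close> is good iff it lies in \<open>representable A S\<close>; this is a
  condition on single functionals and is stable under linear combinations.\<close>

definition representable :: "('k::field, 'a::ab_group_add) bistruct \<Rightarrow> ('a \<Rightarrow> 'k) set \<Rightarrow> ('a \<Rightarrow> 'k) set" where
  "representable A S = {f \<in> lhom A base_field. \<exists>t\<in>car (dual_subspace S \<otimes>\<^sub>v dual_subspace S).
     \<forall>x\<in>car A. \<forall>y\<in>car A. t (\<lambda>g h. g x * h y) = f (amult A x y)}"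

lemma representableI:
  assumes "f \<in> lhom A base_field" "t \<in> car (dual_subspace S \<otimes>\<^sub>v dual_subspace S)"
    and "\<And>x y. x \<in> car A \<Longrightarrow> y \<in> car A \<Longrightarrow> t (\<lambda>g h. g x * h y) = f (amult A x y)"
  shows "f \<in> representable A S"
  using assms by (auto simp: representable_def)

lemma bullet_vs [simp]:
  "scl (bullet A) = fscl" "amult (bullet A) = conv A ground" "aone (bullet A) = counit A"
  by (simp_all add: bullet_def bullet_space_def Let_def)

lemma car_bullet: "car (bullet A) = module.span fscl (\<Union>{S. good A S})"
  by (simp add: bullet_def bullet_space_def Let_def)

lemma counit_bullet: "f \<in> car (bullet A) \<Longrightarrow> counit (bullet A) f = f (aone A)"
  by (simp add: bullet_def Let_def)

context
  fixes A :: "('k::field, 'a::ab_group_add) bistruct"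
  assumes A: "prealgebra A"
begin

lemma phi_eq_iff:
  assumes D: "is_vspace D" "car D \<subseteq> lhom A base_field" "scl D = fscl"
    and t: "t \<in> car (tpow2 D)" and f: "f \<in> lhom A base_field"
  shows "phi A D t = f \<circ> mlin A \<longleftrightarrow> (\<forall>x\<in>car A. \<forall>y\<in>car A. t (\<lambda>g h. g x * h y) = f (amult A x y))"
proof -
  note vs = prealgebraD(1)[OF A]
  have fm: "f \<circ> mlin A \<in> lhom (tpow2 A) base_field"
    using linear_on_comp[OF lhom_linear[OF f] lhom_linear[OF mlin_lhom[OF A]]]
      lhom_outside[OF mlin_lhom[OF A]] linear_on_zero[OF lhom_linear[OF f] vs]
    by (auto simp: lhom_def o_def)
  have ph: "phi A D t (tens A A x y) = t (\<lambda>g h. g x * h y)" if "x \<in> car A" "y \<in> car A" for x y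
    using that tpair_tens_right[OF D(1,1) vs vs app_bilinear app_bilinear t that] D
    by (simp add: phi_apply[OF vs D t] tens_mem)
  show ?thesis
  proof
    assume "phi A D t = f \<circ> mlin A"
    then show "\<forall>x\<in>car A. \<forall>y\<in>car A. t (\<lambda>g h. g x * h y) = f (amult A x y)"
      by (simp add: ph[symmetric] mlin_tens[OF A])
  next
    assume R: "\<forall>x\<in>car A. \<forall>y\<in>car A. t (\<lambda>g h. g x * h y) = f (amult A x y)"
    show "phi A D t = f \<circ> mlin A"
    proof (rule lhom_eqI[OF phi_lhom[OF vs D t] fm])
      show "phi A D t u = (f \<circ> mlin A) u" if "u \<in> car (tpow2 A)" for u
        by (rule tensor_ext[OF lhom_linear[OF phi_lhom[OF vs D t]] lhom_linear[OF fm] _ that])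
          (simp add: R ph mlin_tens[OF A])
    qed
  qed
qed

lemma good_iff:
  "good A S \<longleftrightarrow> module.subspace fscl S \<and> S \<subseteq> representable A S"
proof (cases "S \<subseteq> lhom A base_field \<and> module.subspace fscl S")
  case True
  have "(f \<circ> mlin A \<in> phi A (dual_subspace S) ` car (dual_subspace S \<otimes>\<^sub>v dual_subspace S)) \<longleftrightarrow>
    f \<in> representable A S" if "f \<in> S" for f
  proof -
    have f: "f \<in> lhom A base_field" using True that by auto
    have "(phi A (dual_subspace S) t = f \<circ> mlin A) \<longleftrightarrow>
      (\<forall>x\<in>car A. \<forall>y\<in>car A. t (\<lambda>g h. g x * h y) = f (amult A x y))"
      if "t \<in> car (dual_subspace S \<otimes>\<^sub>v dual_subspace S)" for t
      using phi_eq_iff[OF _ _ _ that f] True by (simp add: is_vspace_dual_subspace)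
    then have "(\<exists>t\<in>car (dual_subspace S \<otimes>\<^sub>v dual_subspace S). phi A (dual_subspace S) t = f \<circ> mlin A) \<longleftrightarrow>
      f \<in> representable A S"
      unfolding representable_def mem_Collect_eq using f by (simp cong: bex_cong)
    then show ?thesis unfolding image_iff by (metis (no_types))
  qed
  then show ?thesis using True unfolding good_def dual_simps by blast
next
  case False
  then show ?thesis unfolding good_def representable_def dual_simps by blast
qed

lemma subspace_representable:
  assumes S: "module.subspace fscl S"
  shows "module.subspace fscl (representable A S)"
proof (rule subspace_fsclI)
  let ?T = "dual_subspace S \<otimes>\<^sub>v dual_subspace S"
  show "0 \<in> representable A S"
    by (rule representableI[OF lhom_base_zero vs_0[OF is_vspace_vtensor]]) simp
  show "f + g \<in> representable A S" if f: "f \<in> representable A S" and g: "g \<in> representable A S" for f g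
  proof -
    from f obtain s where s: "s \<in> car ?T" "f \<in> lhom A base_field"
      "\<forall>x\<in>car A. \<forall>y\<in>car A. s (\<lambda>g h. g x * h y) = f (amult A x y)" by (auto simp: representable_def)
    from g obtain t where t: "t \<in> car ?T" "g \<in> lhom A base_field"
      "\<forall>x\<in>car A. \<forall>y\<in>car A. t (\<lambda>g h. g x * h y) = g (amult A x y)" by (auto simp: representable_def)
    show ?thesis
      by (rule representableI[OF lhom_base_add[OF s(2) t(2)] vs_add[OF is_vspace_vtensor s(1) t(1)]])
        (simp add: s t)
  qed
  show "fscl c f \<in> representable A S" if f: "f \<in> representable A S" for c f
  proof -
    from f obtain s where s: "s \<in> car ?T" "f \<in> lhom A base_field"
      "\<forall>x\<in>car A. \<forall>y\<in>car A. s (\<lambda>g h. g x * h y) = f (amult A x y)" by (auto simp: representable_def)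
    show ?thesis
      by (rule representableI[OF lhom_base_fscl[OF s(2)] vs_scl[OF is_vspace_vtensor s(1), of c]])
        (simp add: s)
  qed
qed

text \<open>\<open>representable A S\<close> is a subspace, so it contains a span as soon as it
  contains generators. Closure of the finite dual under sums, under convolution and its unit element
  are obtained from this.\<close>

lemma good_span:
  assumes "G \<subseteq> representable A (module.span fscl G)"
  shows "good A (module.span fscl G)"
  unfolding good_iff
  by (intro conjI subspace_span_fscl span_fscl_minimal assms subspace_representable)

text \<open>A tensor over \<open>S\<close> is a functional that tests bilinearity on
  \<open>S\<close>, so it is not literally a tensor over \<open>S'\<close>. It is transported along
  the inclusion, which does not change its values on products of evaluations, as these are bilinear
  on both spaces.\<close>

lemma representable_mono:
  assumes S: "module.subspace fscl S" and S': "module.subspace fscl S'" and sub: "S \<subseteq> S'"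
  shows "representable A S \<subseteq> representable A S'"
proof
  fix f assume "f \<in> representable A S"
  then obtain s where s: "s \<in> car (dual_subspace S \<otimes>\<^sub>v dual_subspace S)" "f \<in> lhom A base_field"
    "\<forall>x\<in>car A. \<forall>y\<in>car A. s (\<lambda>g h. g x * h y) = f (amult A x y)" by (auto simp: representable_def)
  let ?V = "dual_subspace S" and ?W = "dual_subspace S'"
  have vs: "is_vspace ?V" "is_vspace ?W" using S S' by (simp_all add: is_vspace_dual_subspace)
  have b: "bilinear_on ?V ?V (tpow2 ?W) (\<lambda>f g. tens ?W ?W f g)"
    by (intro bilinear_onI linear_on_tens_left linear_on_tens_right)
      (use sub in \<open>auto simp: linear_on_def\<close>)
  show "f \<in> representable A S'"
  proof (rule representableI[OF s(2) tensor_image(1)[OF vs(1,1) b s(1) vs(2,2)]])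
    fix x y assume xy: "x \<in> car A" "y \<in> car A"
    show "tlift ?V ?V (tpow2 ?W) (tens ?W ?W) s (\<lambda>g h. g x * h y) = f (amult A x y)"
      unfolding tensor_image(2)[OF vs(1,1) b s(1) vs(2,2)]
      using s(3) xy by (simp add: tens_def eval_product_bilinear)
  qed
qed

text \<open>A generator lies in some good \<open>S\<close>, hence splits with legs in
  \<open>S\<close>, hence with legs in the span of all good subspaces.\<close>

lemma good_bullet: "good A (car (bullet A))"
  unfolding car_bullet
proof (rule good_span)
  show "\<Union>{S. good A S} \<subseteq> representable A (module.span fscl (\<Union>{S. good A S}))"
  proof
    fix f assume "f \<in> \<Union>{S. good A S}"
    then obtain S where S: "good A S" "f \<in> S" by blast
    have "S \<subseteq> module.span fscl (\<Union>{S. good A S})" using S(1) by (auto intro: span_fscl_base)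
    from representable_mono[OF _ subspace_span_fscl this] S
    show "f \<in> representable A (module.span fscl (\<Union>{S. good A S}))" by (auto simp: good_iff)
  qed
qed

lemma good_subset_bullet: "good A S \<Longrightarrow> S \<subseteq> car (bullet A)"
  unfolding car_bullet by (auto intro: span_fscl_base)

lemma bullet_lhom: "car (bullet A) \<subseteq> lhom A base_field"
  using good_bullet by (auto simp: good_def)

lemma is_vspace_bullet: "is_vspace (bullet A)"
  using good_bullet by (simp add: is_vspace_def vector_space_fscl good_def)

lemma bullet_linear: "f \<in> car (bullet A) \<Longrightarrow> linear_on A base_field f"
  using bullet_lhom lhom_linear by blast

lemma app_bullet: "bilinear_on (bullet A) A base_field app" "nondegenerate (bullet A) A app"
  by (rule app_bilinear[OF bullet_lhom], simp) (rule app_nondegenerate[OF bullet_lhom])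

section \<open>The coalgebra structure of the finite dual\<close>

lemma bullet_eqI:
  "f \<in> car (bullet A) \<Longrightarrow> g \<in> car (bullet A) \<Longrightarrow> (\<And>x. x \<in> car A \<Longrightarrow> f x = g x) \<Longrightarrow> f = g"
  using bullet_lhom by (blast intro: lhom_eqI)

text \<open>Functionals are separated by vectors, hence tensors of functionals by pure tensors of
  vectors. This is the injectivity that makes the definite description in the coproduct of
  \<open>bullet A\<close> unique.\<close>

lemma bullet_tensor_eqI:
  assumes "s \<in> car (tpow2 (bullet A))" "t \<in> car (tpow2 (bullet A))"
    and "\<And>x y. x \<in> car A \<Longrightarrow> y \<in> car A \<Longrightarrow> s (\<lambda>g h. g x * h y) = t (\<lambda>g h. g x * h y)"
  shows "s = t"
proof -
  note vs = is_vspace_bullet prealgebraD(1)[OF A]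
  show ?thesis
    by (rule tensor2_eqI[OF vs app_bullet assms(1,2)])
      (simp add: tpair_tens_right[OF vs(1,1,2,2) app_bullet(1) app_bullet(1)] assms)
qed

lemma bullet_space_vs: "car (bullet_space A) = car (bullet A)" "scl (bullet_space A) = fscl"
  and bullet_space_vtensor: "(bullet_space A \<otimes>\<^sub>v bullet_space A) = (tpow2 (bullet A))"
  and phi_bullet_space: "phi A (bullet_space A) = phi A (bullet A)"
proof -
  show 1: "car (bullet_space A) = car (bullet A)" "scl (bullet_space A) = fscl"
    by (simp_all add: car_bullet bullet_space_def)
  note cong = 1(1) trans[OF 1(2) bullet_vs(1)[symmetric]]
  show "(bullet_space A \<otimes>\<^sub>v bullet_space A) = (tpow2 (bullet A))"
    by (simp only: vtensor_vs_cong[OF cong])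
  show "phi A (bullet_space A) = phi A (bullet A)"
    by (simp only: phi_def tlift_vs_cong(1,2)[OF cong])
qed

lemma comult_bullet_outside: "f \<notin> car (bullet A) \<Longrightarrow> comult (bullet A) f = 0"
  unfolding bullet_def by (simp add: Let_def)

text \<open>Coproducts in the finite dual are computed by guessing a tensor and testing it on pairs
  of vectors, without unfolding the definite description again.\<close>

lemma comult_bullet_eqI:
  assumes f: "f \<in> car (bullet A)" and t: "t \<in> car (tpow2 (bullet A))"
    and eq: "\<And>x y. x \<in> car A \<Longrightarrow> y \<in> car A \<Longrightarrow> t (\<lambda>g h. g x * h y) = f (amult A x y)"
  shows "comult (bullet A) f = t"
proof -
  have fl: "f \<in> lhom A base_field" using f bullet_lhom by blast
  have iff: "phi A (bullet A) s = f \<circ> mlin A \<longleftrightarrow>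
    (\<forall>x\<in>car A. \<forall>y\<in>car A. s (\<lambda>g h. g x * h y) = f (amult A x y))"
    if "s \<in> car (tpow2 (bullet A))" for s
    by (rule phi_eq_iff[OF is_vspace_bullet bullet_lhom _ that fl]) simp
  have "comult (bullet A) f = (THE s. s \<in> car (tpow2 (bullet A)) \<and> phi A (bullet A) s = f \<circ> mlin A)"
    using f by (subst bullet_def) (simp add: Let_def bullet_space_vs(1) bullet_space_vtensor phi_bullet_space)
  also have "\<dots> = t"
  proof (rule the_equality)
    show "t \<in> car (tpow2 (bullet A)) \<and> phi A (bullet A) t = f \<circ> mlin A"
      using t eq by (simp add: iff)
    show "s = t" if "s \<in> car (tpow2 (bullet A)) \<and> phi A (bullet A) s = f \<circ> mlin A" for s
    proof (rule bullet_tensor_eqI[OF conjunct1[OF that] t])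
      fix x y assume xy: "x \<in> car A" "y \<in> car A"
      show "s (\<lambda>g h. g x * h y) = t (\<lambda>g h. g x * h y)"
        unfolding eq[OF xy] using iff[OF conjunct1[OF that]] conjunct2[OF that] xy by simp
    qed
  qed
  finally show ?thesis .
qed

lemma
  assumes f: "f \<in> car (bullet A)"
  shows comult_bullet_mem: "comult (bullet A) f \<in> car (tpow2 (bullet A))"
    and comult_bullet_apply: "x \<in> car A \<Longrightarrow> y \<in> car A \<Longrightarrow>
      comult (bullet A) f (\<lambda>g h. g x * h y) = f (amult A x y)"
proof -
  have "(dual_subspace (car (bullet A)) \<otimes>\<^sub>v dual_subspace (car (bullet A))) = (tpow2 (bullet A))"
    by (simp add: vtensor_vs_cong[of "dual_subspace (car (bullet A))" "bullet A"])
  then obtain t where t: "t \<in> car (tpow2 (bullet A))"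
    "\<And>x y. x \<in> car A \<Longrightarrow> y \<in> car A \<Longrightarrow> t (\<lambda>g h. g x * h y) = f (amult A x y)"
    using good_bullet f by (auto simp: good_iff representable_def)
  from comult_bullet_eqI[OF f t] t show "comult (bullet A) f \<in> car (tpow2 (bullet A))"
    "x \<in> car A \<Longrightarrow> y \<in> car A \<Longrightarrow> comult (bullet A) f (\<lambda>g h. g x * h y) = f (amult A x y)"
    by simp_all
qed

lemma precoalgebra_bullet: "precoalgebra (bullet A)"
proof -
  note vs = is_vspace_bullet
  have "linear_on (bullet A) (tpow2 (bullet A)) (comult (bullet A))"
  proof (rule linear_onI)
    fix f assume f: "f \<in> car (bullet A)"
    show "comult (bullet A) f \<in> car (tpow2 (bullet A))" by (rule comult_bullet_mem[OF f])
    show "comult (bullet A) (f + g) = comult (bullet A) f + comult (bullet A) g"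
      if g: "g \<in> car (bullet A)" for g
      using vs_add[OF vs f g] vs_add[OF is_vspace_vtensor comult_bullet_mem[OF f] comult_bullet_mem[OF g]]
      by (rule comult_bullet_eqI) (simp add: comult_bullet_apply f g)
    show "comult (bullet A) (scl (bullet A) c f) = scl (tpow2 (bullet A)) c (comult (bullet A) f)" for c
      using vs_scl[OF vs f] vs_scl[OF is_vspace_vtensor comult_bullet_mem[OF f]]
      by (rule comult_bullet_eqI) (simp add: comult_bullet_apply f)
  qed
  moreover have "linear_on (bullet A) base_field (counit (bullet A))"
    by (rule linear_onI) (simp_all add: counit_bullet vs_add[OF vs] vs_scl[OF vs, simplified])
  moreover have "counit (bullet A) f = 0" if "f \<notin> car (bullet A)" for f
    using that by (simp add: bullet_def Let_def)
  ultimately show ?thesis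
    using comult_bullet_outside vs by (simp add: precoalgebra_def lhom_def)
qed

lemma noncoassoc_coalgebra_bullet:
  assumes "nonassoc_algebra A"
  shows "noncoassoc_coalgebra (bullet A)"
proof -
  let ?D = "bullet A"
  note vs = is_vspace_bullet and P = precoalgebra_bullet
  note \<epsilon> = precoalgebraD(3)[OF P]
  have one: "aone A \<in> car A" by (rule prealgebraD(3)[OF A])
  have b1: "bilinear_on ?D ?D ?D (\<lambda>a b. scl ?D (counit ?D a) b)"
    by (intro bilinear_onI linear_on_scl_left linear_on_scl linear_on_id vs \<epsilon>)
  have b2: "bilinear_on ?D ?D ?D (\<lambda>a b. scl ?D (counit ?D b) a)"
    by (intro bilinear_onI linear_on_scl_left linear_on_scl linear_on_id vs \<epsilon>)
  have ev: "linear_on ?D base_field (\<lambda>f. f x)" for x by (rule eval_linear) simp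
  have "tlift ?D ?D ?D (\<lambda>a b. scl ?D (counit ?D a) b) (comult ?D f) = f"
    "tlift ?D ?D ?D (\<lambda>a b. scl ?D (counit ?D b) a) (comult ?D f) = f" if f: "f \<in> car ?D" for f
  proof -
    note \<Delta> = comult_bullet_mem[OF f]
    show "tlift ?D ?D ?D (\<lambda>a b. scl ?D (counit ?D a) b) (comult ?D f) = f"
    proof (rule bullet_eqI[OF linear_on_mem[OF tlift_linear[OF vs vs vs b1] \<Delta>] f])
      fix x assume x: "x \<in> car A"
      have "tlift ?D ?D ?D (\<lambda>a b. scl ?D (counit ?D a) b) (comult ?D f) x
        = comult ?D f (\<lambda>g h. scl ?D (counit ?D g) h x)"
        by (rule tlift_apply[OF vs vs vs b1 ev \<Delta>])
      also have "\<dots> = comult ?D f (\<lambda>g h. g (aone A) * h x)"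
        by (rule tensor_apply_cong[OF vs vs \<Delta>]) (simp add: counit_bullet)
      also have "\<dots> = f x" using assms x by (simp add: comult_bullet_apply[OF f one x] nonassoc_algebra_def)
      finally show "tlift ?D ?D ?D (\<lambda>a b. scl ?D (counit ?D a) b) (comult ?D f) x = f x" .
    qed
    show "tlift ?D ?D ?D (\<lambda>a b. scl ?D (counit ?D b) a) (comult ?D f) = f"
    proof (rule bullet_eqI[OF linear_on_mem[OF tlift_linear[OF vs vs vs b2] \<Delta>] f])
      fix x assume x: "x \<in> car A"
      have "tlift ?D ?D ?D (\<lambda>a b. scl ?D (counit ?D b) a) (comult ?D f) x
        = comult ?D f (\<lambda>g h. scl ?D (counit ?D h) g x)"
        by (rule tlift_apply[OF vs vs vs b2 ev \<Delta>])
      also have "\<dots> = comult ?D f (\<lambda>g h. g x * h (aone A))"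
        by (rule tensor_apply_cong[OF vs vs \<Delta>]) (simp add: counit_bullet)
      also have "\<dots> = f x" using assms x by (simp add: comult_bullet_apply[OF f x one] nonassoc_algebra_def)
      finally show "tlift ?D ?D ?D (\<lambda>a b. scl ?D (counit ?D b) a) (comult ?D f) x = f x" .
    qed
  qed
  then show ?thesis using P by (simp add: noncoassoc_coalgebra_def precoalgebra_def)
qed

end

text \<open>The target \<open>S'\<close> is kept apart from the source \<open>S\<close>, so that
  convolution on the finite dual can be treated as a bilinear map into the span of its values before
  these are known to lie in the finite dual.\<close>

lemma conv_ground_bilinear:
  assumes C: "precoalgebra C" and S: "\<And>f. f \<in> S \<Longrightarrow> linear_on C base_field f" "module.subspace fscl S"
    and S': "\<And>f g. f \<in> S \<Longrightarrow> g \<in> S \<Longrightarrow> conv C ground f g \<in> S'" "module.subspace fscl S'"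
  shows "bilinear_on (dual_subspace S) (dual_subspace S) (dual_subspace S') (conv C ground)"
proof -
  have vS: "is_vspace (dual_subspace S)" using S by (simp add: is_vspace_dual_subspace)
  have out: "conv C ground f g x = 0" if "f \<in> S" "g \<in> S" "x \<notin> car C" for f g x
    by (rule lhom_outside[OF conv_ground_lhom[OF C S(1)[OF that(1)] S(1)[OF that(2)]] that(3)])
  note ap = conv_ground_apply[OF C S(1) S(1)]
  note vs = precoalgebraD(1)[OF C]
  have eqI: "conv C ground f g = r" if "f \<in> S" "g \<in> S"
    "\<And>x. x \<in> car C \<Longrightarrow> comult C x (\<lambda>x1 x2. f x1 * g x2) = r x" "\<And>x. x \<notin> car C \<Longrightarrow> r x = 0" for f g r
  proof
    show "conv C ground f g x = r x" for x
      using that by (cases "x \<in> car C") (simp_all add: ap out)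
  qed
  have par: "linear_on (dual_subspace S) base_field (\<lambda>g. comult C x (\<lambda>x1 x2. f x1 * g x2))"
    "linear_on (dual_subspace S) base_field (\<lambda>g. comult C x (\<lambda>x1 x2. g x1 * f x2))"
    if "f \<in> S" "x \<in> car C" for f x
    by (rule tensor_apply_param[OF vs vs vS bilinear_on_product linear_on_mult_left[OF eval_linear]
            precoalgebraD(4)[OF C that(2)]], simp_all add: S(1) that(1),
        rule tensor_apply_param[OF vs vs vS bilinear_on_product linear_on_mult_right[OF eval_linear]
            precoalgebraD(4)[OF C that(2)]], simp_all add: S(1) that(1))
  note add = vs_add[OF vS, simplified] and sc = vs_scl[OF vS, simplified]
  show ?thesis
  proof (rule bilinear_onI; rule linear_onI; unfold dual_subspace_simps)
    fix f g assume f: "f \<in> S" and g: "g \<in> S"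
    show "conv C ground f g \<in> S'" "conv C ground f g \<in> S'" by (rule S'(1)[OF f g])+
    show "conv C ground f (g + h) = conv C ground f g + conv C ground f h"
      "conv C ground (g + h) f = conv C ground g f + conv C ground h f" if h: "h \<in> S" for h
      using linear_on_add[OF par(1)[OF f], of _ g h] linear_on_add[OF par(2)[OF f], of _ g h]
      by (auto intro!: eqI simp: f g h add ap out)
    show "conv C ground f (fscl c g) = fscl c (conv C ground f g)"
      "conv C ground (fscl c g) f = fscl c (conv C ground g f)" for c
      using linear_on_scale[OF par(1)[OF f], of _ g c] linear_on_scale[OF par(2)[OF f], of _ g c]
      by (auto intro!: eqI simp: f g sc ap out)
  qed
qed


section \<open>The finite dual of a pre-bialgebra\<close>

context
  fixes A :: "('k::field, 'a::ab_group_add) bistruct"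
  assumes A: "prebialgebra A"
begin

private lemmas pre = prebialgebraD(3)[OF A]
private lemmas copre = prebialgebraD(4)[OF A]

text \<open>Both reduce to the sum of \<open>f (x_1 y_1) g (x_2 y_2)\<close>: the left side by the
  defining property of the coproducts of \<open>f\<close> and \<open>g\<close>, the right side
  because the coproduct of \<open>A\<close> is multiplicative. It is used both for closure under
  convolution and for multiplicativity of the dual coproduct.\<close>

lemma comult_tpair_comult_bullet:
  assumes f: "f \<in> car (bullet A)" and g: "g \<in> car (bullet A)" and x: "x \<in> car A" and y: "y \<in> car A"
  shows "comult (A \<otimes>\<^sub>b A) (tens A A x y) (\<lambda>u v. tpair app app (comult (bullet A) f) u *
      tpair app app (comult (bullet A) g) v) = conv A ground f g (amult A x y)"
proof -
  let ?D = "bullet A"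
  note vsA = prebialgebraD(5)[OF A] and vsD = is_vspace_bullet[OF pre]
  note ab = app_bullet(1)[OF pre]
  note pb = tpair_bilinear[OF vsD vsD vsA vsA ab ab]
  note fl = bullet_linear[OF pre f] and gl = bullet_linear[OF pre g]
  note \<Delta>f = comult_bullet_mem[OF pre f] and \<Delta>g = comult_bullet_mem[OF pre g]
  note \<Delta>x = precoalgebraD(4)[OF copre x] and \<Delta>y = precoalgebraD(4)[OF copre y]
  have "comult (A \<otimes>\<^sub>b A) (tens A A x y) (\<lambda>u v. tpair app app (comult ?D f) u * tpair app app (comult ?D g) v)
    = comult A x (\<lambda>x1 x2. comult A y (\<lambda>y1 y2. tpair app app (comult ?D f) (tens A A x1 y1) *
        tpair app app (comult ?D g) (tens A A x2 y2)))"
    by (rule comult_btensor_apply[OF copre copre x y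
          bilinear_on_product[OF bilinear_on_right[OF pb \<Delta>f] bilinear_on_right[OF pb \<Delta>g]]])
  also have "\<dots> = comult A x (\<lambda>x1 x2. comult A y (\<lambda>y1 y2. f (amult A x1 y1) * g (amult A x2 y2)))"
    by (rule tensor_apply_cong[OF vsA vsA \<Delta>x], rule tensor_apply_cong[OF vsA vsA \<Delta>y])
      (simp add: tpair_tens_right[OF vsD vsD vsA vsA ab ab] \<Delta>f \<Delta>g comult_bullet_apply[OF pre] f g)
  also have "\<dots> = comult A (amult A x y) (\<lambda>u v. f u * g v)"
    by (rule comult_amult_apply[OF A x y bilinear_on_product[OF fl gl], symmetric])
  also have "\<dots> = conv A ground f g (amult A x y)"
    by (rule conv_ground_apply[OF copre fl gl prebialgebraD(13)[OF A x y], symmetric])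
  finally show ?thesis .
qed

text \<open>The value of \<open>f * g\<close> on a product splits with legs \<open>f_1 * g_1\<close>
  and \<open>f_2 * g_2\<close>, which are again products of elements of the finite dual. So the span
  of all such products is good, and the finite dual contains every good subspace.\<close>

lemma conv_bullet_mem:
  assumes f: "f \<in> car (bullet A)" and g: "g \<in> car (bullet A)"
  shows "conv A ground f g \<in> car (bullet A)"
proof -
  let ?D = "bullet A"
  define G where "G = {conv A ground f g | f g. f \<in> car ?D \<and> g \<in> car ?D}"
  define S where "S = module.span fscl G"
  let ?S = "dual_subspace S"
  note vsA = prebialgebraD(5)[OF A] and vsD = is_vspace_bullet[OF pre]
  note ab = app_bullet(1)[OF pre]
  have conv_lhom: "conv A ground f g \<in> lhom A base_field" if "f \<in> car ?D" "g \<in> car ?D" for f g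
    by (intro conv_ground_lhom[OF copre] bullet_linear[OF pre] that)
  have vsS: "is_vspace ?S" by (simp add: is_vspace_dual_subspace S_def subspace_span_fscl)
  have "module.subspace fscl (lhom A base_field)"
    by (rule subspace_fsclI) (simp_all add: lhom_base_zero lhom_base_add lhom_base_fscl)
  then have "S \<subseteq> lhom A base_field"
    unfolding S_def by (intro span_fscl_minimal) (auto simp: G_def conv_lhom)
  then have abS: "bilinear_on ?S A base_field app" by (intro app_bilinear) simp_all
  \<comment> \<open>Convolution is read as a map into \<open>S\<close>, since its values are not yet
    known to lie in \<open>?D\<close>.\<close>
  have "bilinear_on (dual_subspace (car ?D)) (dual_subspace (car ?D)) ?S (conv A ground)"
  proof (rule conv_ground_bilinear[OF copre])
    show "module.subspace fscl (car ?D)" using vsD by (simp add: is_vspace_def)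
    show "conv A ground f g \<in> S" if "f \<in> car ?D" "g \<in> car ?D" for f g
      unfolding S_def using that by (intro span_fscl_base) (auto simp: G_def)
  qed (auto simp: S_def subspace_span_fscl intro: bullet_linear[OF pre])
  then have cb: "bilinear_on ?D ?D ?S (conv A ground)"
    by (simp add: bilinear_on_vs_cong[of "dual_subspace (car ?D)" ?D] pre)
  have "G \<subseteq> representable A S"
  proof
    fix h assume "h \<in> G"
    then obtain f g where h: "h = conv A ground f g" and f: "f \<in> car ?D" and g: "g \<in> car ?D"
      by (auto simp: G_def)
    note \<Delta>f = comult_bullet_mem[OF pre f] and \<Delta>g = comult_bullet_mem[OF pre g]
    \<comment> \<open>The representing tensor is the product of the coproducts of \<open>f\<close>
      and \<open>g\<close>, formed leg by leg with values in \<open>S\<close>.\<close>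
    note t = bilinear_on_mem[OF tprod_bilinear[OF vsD vsD cb cb] \<Delta>f \<Delta>g]
    show "h \<in> representable A S"
      unfolding h
    proof (rule representableI[OF conv_lhom[OF f g] t])
      fix x y assume x: "x \<in> car A" and y: "y \<in> car A"
      let ?t = "tprod ?D ?S (conv A ground) ?D ?S (conv A ground) (comult ?D f) (comult ?D g)"
      have ap: "conv A ground f g x = comult A x (\<lambda>x1 x2. f x1 * g x2)"
        if "f \<in> car ?D" "g \<in> car ?D" "x \<in> car A" for f g x
        by (rule conv_ground_apply[OF copre bullet_linear[OF pre that(1)] bullet_linear[OF pre that(2)] that(3)])
      have "?t (\<lambda>g h. g x * h y) = tpair app app ?t (tens A A x y)"
        by (rule tpair_tens_right[OF vsS vsS vsA vsA abS abS t x y, symmetric])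
      also have "\<dots> = comult (A \<otimes>\<^sub>b A) (tens A A x y) (\<lambda>u v. tpair app app (comult ?D f) u * tpair app app (comult ?D g) v)"
        by (rule tprod_conv[OF vsD vsD vsS vsS copre copre cb cb ab ab abS abS ap ap \<Delta>f \<Delta>g tens_mem[OF x y]])
      also have "\<dots> = conv A ground f g (amult A x y)"
        by (rule comult_tpair_comult_bullet[OF f g x y])
      finally show "?t (\<lambda>g h. g x * h y) = conv A ground f g (amult A x y)" .
    qed
  qed
  then have "good A S" unfolding S_def by (rule good_span[OF pre])
  moreover have "conv A ground f g \<in> S"
    unfolding S_def using f g by (intro span_fscl_base) (auto simp: G_def)
  ultimately show ?thesis using good_subset_bullet[OF pre] by blast
qed

text \<open>The counit is multiplicative, so the line through it is a good subspace.\<close>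

lemma counit_bullet_mem: "counit A \<in> car (bullet A)"
proof -
  let ?S = "dual_subspace (module.span fscl {counit A})"
  have \<epsilon>: "counit A \<in> lhom A base_field" using copre by (simp add: precoalgebra_def)
  have "counit A \<in> representable A (module.span fscl {counit A})"
  proof (rule representableI[OF \<epsilon>])
    show "tens ?S ?S (counit A) (counit A) \<in> car (tpow2 ?S)"
      by (rule tens_mem) (simp_all add: span_fscl_base)
    show "tens ?S ?S (counit A) (counit A) (\<lambda>g h. g x * h y) = counit A (amult A x y)"
      if "x \<in> car A" "y \<in> car A" for x y
      using that by (simp add: tens_def eval_product_bilinear prebialgebraD(8)[OF A])
  qed
  then have "good A (module.span fscl {counit A})" by (intro good_span pre) simp
  from good_subset_bullet[OF pre this] show ?thesis by (auto simp: span_fscl_base)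
qed

lemma prealgebra_bullet: "prealgebra (bullet A)"
proof -
  let ?D = "bullet A"
  have "bilinear_on (dual_subspace (car ?D)) (dual_subspace (car ?D)) (dual_subspace (car ?D)) (conv A ground)"
    by (rule conv_ground_bilinear[OF copre])
      (use is_vspace_bullet[OF pre] in \<open>auto simp: is_vspace_def pre conv_bullet_mem intro: bullet_linear[OF pre]\<close>)
  then show ?thesis
    by (simp add: prealgebra_def bilinear_on_vs_cong[of "dual_subspace (car ?D)" ?D] pre
        is_vspace_bullet[OF pre] counit_bullet_mem)
qed

lemma measuring_bullet: "measuring (bullet A) A app"
proof -
  have "conv A ground f g x = comult A x (\<lambda>x1 x2. f x1 * g x2)"
    if "f \<in> car (bullet A)" "g \<in> car (bullet A)" "x \<in> car A" for f g x
    by (rule conv_ground_apply[OF copre bullet_linear[OF pre that(1)] bullet_linear[OF pre that(2)] that(3)])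
  then show ?thesis by (simp add: measuring_def app_bullet pre)
qed

lemma nonassoc_algebra_bullet: "nonassoc_algebra (bullet A)"
proof -
  have "conv A ground (counit A) f = f" "conv A ground f (counit A) = f" if f: "f \<in> car (bullet A)" for f
    by (rule bullet_eqI[OF pre conv_bullet_mem[OF counit_bullet_mem f] f],
        simp add: conv_ground_apply[OF copre precoalgebraD(3)[OF copre] bullet_linear[OF pre f]]
          counit_comult_apply[OF prebialgebraD(2)[OF A] bullet_linear[OF pre f]],
        rule bullet_eqI[OF pre conv_bullet_mem[OF f counit_bullet_mem] f],
        simp add: conv_ground_apply[OF copre bullet_linear[OF pre f] precoalgebraD(3)[OF copre]]
          counit_comult_apply[OF prebialgebraD(2)[OF A] bullet_linear[OF pre f]])
  then show ?thesis using prealgebra_bullet by (simp add: nonassoc_algebra_def prealgebra_def pre)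
qed

lemma prebialgebra_bullet: "prebialgebra (bullet A)"
  unfolding prebialgebra_def
proof (intro conjI ballI)
  let ?D = "bullet A"
  note vsA = prebialgebraD(5)[OF A] and vsD = is_vspace_bullet[OF pre]
  note ab = app_bullet(1)[OF pre]
  have one: "aone A \<in> car A" by (rule prebialgebraD(12)[OF A])
  show "nonassoc_algebra ?D" by (rule nonassoc_algebra_bullet)
  show "noncoassoc_coalgebra ?D" by (rule noncoassoc_coalgebra_bullet[OF pre prebialgebraD(1)[OF A]])
  show "counit ?D (aone ?D) = 1" by (simp add: pre counit_bullet counit_bullet_mem prebialgebraD(9)[OF A])
  show "comult ?D (aone ?D) = tens ?D ?D (aone ?D) (aone ?D)"
    by (simp add: pre)
      (rule comult_bullet_eqI[OF pre counit_bullet_mem tens_mem[OF counit_bullet_mem counit_bullet_mem]],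
        simp add: tens_def eval_product_bilinear pre prebialgebraD(8)[OF A])
  fix f g assume f: "f \<in> car ?D" and g: "g \<in> car ?D"
  note fl = bullet_linear[OF pre f] and gl = bullet_linear[OF pre g]
  show "counit ?D (amult ?D f g) = counit ?D f * counit ?D g"
    by (simp add: pre counit_bullet conv_bullet_mem f g conv_ground_apply[OF copre fl gl one]
        prebialgebraD(7)[OF A] tens_apply[OF vsA vsA] bilinear_on_product fl gl)
  note \<Delta>f = comult_bullet_mem[OF pre f] and \<Delta>g = comult_bullet_mem[OF pre g]
  have mem: "amult (?D \<otimes>\<^sub>b ?D) (comult ?D f) (comult ?D g) \<in> car (tpow2 ?D)"
    using bilinear_on_mem[OF prealgebraD(2)[OF prealgebra_btensor[OF prealgebra_bullet prealgebra_bullet]]] \<Delta>f \<Delta>g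
    by simp
  \<comment> \<open>Tensors over the finite dual are compared on pairs of vectors. There the product
    of the coproducts is evaluated as a convolution on the tensor square of \<open>A\<close>, which
    is known to equal \<open>f * g\<close> on \<open>x y\<close>.\<close>
  have "comult ?D (conv A ground f g) = amult (?D \<otimes>\<^sub>b ?D) (comult ?D f) (comult ?D g)"
  proof (rule comult_bullet_eqI[OF pre conv_bullet_mem[OF f g] mem])
    fix x y assume x: "x \<in> car A" and y: "y \<in> car A"
    have "amult (?D \<otimes>\<^sub>b ?D) (comult ?D f) (comult ?D g) (\<lambda>g h. g x * h y)
      = tpair app app (amult (?D \<otimes>\<^sub>b ?D) (comult ?D f) (comult ?D g)) (tens A A x y)"
      by (rule tpair_tens_right[OF vsD vsD vsA vsA ab ab mem x y, symmetric])
    also have "\<dots> = comult (A \<otimes>\<^sub>b A) (tens A A x y) (\<lambda>u v. tpair app app (comult ?D f) u * tpair app app (comult ?D g) v)"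
      by (rule measuringD(2)[OF measuring_btensor[OF prealgebra_bullet prealgebra_bullet copre copre
              measuring_bullet measuring_bullet]]) (simp_all add: \<Delta>f \<Delta>g tens_mem x y)
    also have "\<dots> = conv A ground f g (amult A x y)"
      by (rule comult_tpair_comult_bullet[OF f g x y])
    finally show "amult (?D \<otimes>\<^sub>b ?D) (comult ?D f) (comult ?D g) (\<lambda>g h. g x * h y)
      = conv A ground f g (amult A x y)" .
  qed
  then show "comult ?D (amult ?D f g) = amult (?D \<otimes>\<^sub>b ?D) (comult ?D f) (comult ?D g)" by (simp add: pre)
qed

end


section \<open>The adjunction\<close>

definition bipairing ::
  "('k::field, 'a::ab_group_add) bistruct \<Rightarrow> ('k, 'c::ab_group_add) bistruct
    \<Rightarrow> ('a \<Rightarrow> 'c \<Rightarrow> 'k) \<Rightarrow> bool" where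
  "bipairing A C p \<longleftrightarrow> measuring A C p \<and> measuring C A (\<lambda>x a. p a x)"

lemma bipairing_flip: "bipairing A C p \<Longrightarrow> bipairing C A (\<lambda>x a. p a x)"
  by (simp add: bipairing_def)

lemma bipairing_app: "prebialgebra A \<Longrightarrow> bipairing (bullet A) A app"
  using app_bullet(1)[of A]
  by (auto simp: bipairing_def measuring_bullet measuring_def[of A] prebialgebraD bilinear_on_def
      comult_bullet_apply counit_bullet)

text \<open>The product of \<open>bullet C\<close> is convolution, so compatibility of
  \<open>f\<close> with products is the measuring condition of \<open>A\<close> on \<open>C\<close>.
  Compatibility with coproducts, evaluated at a pair \<open>x\<close>, \<open>y\<close>, is the
  measuring condition of \<open>C\<close> on \<open>A\<close>. Units and counits correspond
  likewise.\<close>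

lemma bihom_bullet_bipairing:
  assumes A: "prebialgebra A" and C: "prebialgebra C" and f: "f \<in> bihom A (bullet C)"
  shows "bipairing A C f" "\<And>a. a \<notin> car A \<Longrightarrow> f a = 0" "\<And>a x. x \<notin> car C \<Longrightarrow> f a x = 0"
proof -
  let ?D = "bullet C"
  note preA = prebialgebraD(3)[OF A] and copreA = prebialgebraD(4)[OF A] and vsA = prebialgebraD(5)[OF A]
  note preC = prebialgebraD(3)[OF C] and copreC = prebialgebraD(4)[OF C] and vsC = prebialgebraD(5)[OF C]
  note vsD = is_vspace_bullet[OF preC]
  have fl: "f \<in> lhom A ?D" and one: "f (aone A) = aone ?D"
    and mult: "\<And>a b. a \<in> car A \<Longrightarrow> b \<in> car A \<Longrightarrow> f (amult A a b) = amult ?D (f a) (f b)"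
    and co: "\<And>a. a \<in> car A \<Longrightarrow> counit ?D (f a) = counit A a"
      "\<And>a. a \<in> car A \<Longrightarrow> comult ?D (f a) = tmap2 A ?D f (comult A a)"
    using f by (auto simp: bihom_def algebra_hom_def coalgebra_hom_def)
  note lin = lhom_linear[OF fl] and mem = linear_on_mem[OF lhom_linear[OF fl]]
  note fal = bullet_linear[OF preC mem]
  show out: "f a = 0" if "a \<notin> car A" for a by (rule lhom_outside[OF fl that])
  show "f a x = 0" if "x \<notin> car C" for a x
    using bullet_lhom[OF preC] mem[of a] that out[of a] by (cases "a \<in> car A") (auto simp: lhom_def)
  have pb: "bilinear_on A C base_field f"
    by (rule bilinear_onI, erule fal) (rule linear_on_comp[OF eval_linear[OF bullet_vs(1)] lin])
  have b: "bilinear_on A A (tpow2 ?D) (\<lambda>a b. tens ?D ?D (f a) (f b))"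
    by (intro bilinear_onI linear_on_tens_left linear_on_tens_right lin mem)
  have "f a (amult C x y) = comult A a (\<lambda>a1 a2. f a1 x * f a2 y)"
    if a: "a \<in> car A" and x: "x \<in> car C" and y: "y \<in> car C" for a x y
  proof -
    have "f a (amult C x y) = comult ?D (f a) (\<lambda>g h. g x * h y)"
      by (simp add: comult_bullet_apply[OF preC mem[OF a] x y])
    also have "\<dots> = comult A a (\<lambda>a1 a2. tens ?D ?D (f a1) (f a2) (\<lambda>g h. g x * h y))"
      unfolding co(2)[OF a] tmap2_def
      by (rule tensor_image(2)[OF vsA vsA b precoalgebraD(4)[OF copreA a] vsD vsD])
    also have "\<dots> = comult A a (\<lambda>a1 a2. f a1 x * f a2 y)"
      by (simp add: tens_def eval_product_bilinear preC)
    finally show ?thesis .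
  qed
  then have m2: "measuring C A (\<lambda>x a. f a x)"
    using pb co(1) by (simp add: measuring_def bilinear_on_def counit_bullet[OF mem])
  have "measuring A C f"
    unfolding measuring_def
    using pb by (simp add: one mult preC conv_ground_apply[OF copreC fal fal])
  with m2 show "bipairing A C f" by (simp add: bipairing_def)
qed

text \<open>The point is that the values of \<open>f\<close> lie in the finite dual. The pairing
  writes \<open>f a (x y)\<close> as the sum of \<open>f a_1 x * f a_2 y\<close>, so the tensor
  obtained by applying \<open>f\<close> to both legs of the coproduct of \<open>a\<close> shows that
  the image of \<open>A\<close> is good.\<close>

lemma bipairing_bihom_bullet:
  assumes A: "prebialgebra A" and C: "prebialgebra C" and p: "bipairing A C f"
    and out: "\<And>a. a \<notin> car A \<Longrightarrow> f a = 0" "\<And>a x. x \<notin> car C \<Longrightarrow> f a x = 0"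
  shows "f \<in> bihom A (bullet C)"
proof -
  let ?D = "bullet C" and ?S = "dual_subspace (f ` car A)"
  note preA = prebialgebraD(3)[OF A] and copreA = prebialgebraD(4)[OF A] and vsA = prebialgebraD(5)[OF A]
  note preC = prebialgebraD(3)[OF C] and copreC = prebialgebraD(4)[OF C] and vsC = prebialgebraD(5)[OF C]
  note vsD = is_vspace_bullet[OF preC]
  have m1: "measuring A C f" and m2: "measuring C A (\<lambda>x a. f a x)" using p by (simp_all add: bipairing_def)
  note pb = measuringD(1)[OF m1]
  have fl: "f a \<in> lhom C base_field" if "a \<in> car A" for a
    using bilinear_on_right[OF pb that] out(2) by (simp add: lhom_def)
  have add: "f (a + b) = f a + f b" if "a \<in> car A" "b \<in> car A" for a b
  proof
    show "f (a + b) x = (f a + f b) x" for x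
      using linear_on_add[OF bilinear_on_left[OF pb] that, of x] by (cases "x \<in> car C") (simp_all add: out)
  qed
  have scale: "f (scl A c a) = fscl c (f a)" if "a \<in> car A" for a c
  proof
    show "f (scl A c a) x = fscl c (f a) x" for x
      using linear_on_scale[OF bilinear_on_left[OF pb] that, of x c] by (cases "x \<in> car C") (simp_all add: out)
  qed
  have zero: "f 0 = 0" using add[of 0 0] vs_0[OF vsA] by simp
  have subS: "module.subspace fscl (f ` car A)"
  proof (rule subspace_fsclI)
    show "0 \<in> f ` car A" using zero vs_0[OF vsA] by (metis image_eqI)
    show "g + h \<in> f ` car A" if "g \<in> f ` car A" "h \<in> f ` car A" for g h
      using that by (auto simp: add[symmetric] vs_add[OF vsA])
    show "fscl c g \<in> f ` car A" if "g \<in> f ` car A" for c g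
      using that by (auto simp: scale[symmetric] vs_scl[OF vsA])
  qed
  have vsS: "is_vspace ?S" using subS by (simp add: is_vspace_dual_subspace)
  have linS: "linear_on A ?S f" by (rule linear_onI) (simp_all add: add scale)
  have bS: "bilinear_on A A (tpow2 ?S) (\<lambda>a b. tens ?S ?S (f a) (f b))"
    by (intro bilinear_onI linear_on_tens_left linear_on_tens_right linS linear_on_mem[OF linS])
  have "f ` car A \<subseteq> representable C (f ` car A)"
  proof (clarify)
    fix a assume a: "a \<in> car A"
    note t = tensor_image[OF vsA vsA bS precoalgebraD(4)[OF copreA a] vsS vsS]
    show "f a \<in> representable C (f ` car A)"
    proof (rule representableI[OF fl[OF a] t(1)])
      fix x y assume xy: "x \<in> car C" "y \<in> car C"
      show "tlift A A (tpow2 ?S) (\<lambda>a b. tens ?S ?S (f a) (f b)) (comult A a) (\<lambda>g h. g x * h y) = f a (amult C x y)"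
        unfolding t(2) measuringD(2)[OF m2 xy a] by (simp add: tens_def eval_product_bilinear)
    qed
  qed
  then have "good C (f ` car A)" using subS by (simp add: good_iff[OF preC])
  then have mem: "f a \<in> car ?D" if "a \<in> car A" for a using good_subset_bullet[OF preC] that by blast
  have lin: "linear_on A ?D f" by (rule linear_onI) (simp_all add: add scale mem preC)
  have b: "bilinear_on A A (tpow2 ?D) (\<lambda>a b. tens ?D ?D (f a) (f b))"
    by (intro bilinear_onI linear_on_tens_left linear_on_tens_right lin mem)
  have "f (amult A a a') = conv C ground (f a) (f a')" if "a \<in> car A" "a' \<in> car A" for a a'
    by (rule bullet_eqI[OF preC mem conv_bullet_mem[OF C mem mem]])
      (use that in \<open>simp_all add: prebialgebraD(13)[OF A] measuringD(2)[OF m1]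
        conv_ground_apply[OF copreC bullet_linear[OF preC mem] bullet_linear[OF preC mem]]\<close>)
  moreover have "f (aone A) = counit C"
    by (rule bullet_eqI[OF preC mem counit_bullet_mem[OF C]])
      (simp_all add: prebialgebraD(12)[OF A] measuringD(3)[OF m1])
  moreover have "counit ?D (f a) = counit A a" if "a \<in> car A" for a
    using that by (simp add: counit_bullet[OF mem] measuringD(3)[OF m2])
  moreover have "comult ?D (f a) = tmap2 A ?D f (comult A a)" if a: "a \<in> car A" for a
  proof -
    note t = tensor_image[OF vsA vsA b precoalgebraD(4)[OF copreA a] vsD vsD]
    show ?thesis
      unfolding tmap2_def
    proof (rule comult_bullet_eqI[OF preC mem[OF a] t(1)])
      fix x y assume xy: "x \<in> car C" "y \<in> car C"
      show "tlift A A (tpow2 ?D) (\<lambda>a b. tens ?D ?D (f a) (f b)) (comult A a) (\<lambda>g h. g x * h y) = f a (amult C x y)"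
        unfolding t(2) measuringD(2)[OF m2 xy a] by (simp add: tens_def eval_product_bilinear preC)
    qed
  qed
  ultimately show ?thesis
    using lin out(1) by (simp add: bihom_def algebra_hom_def coalgebra_hom_def lhom_def preC)
qed

lemma adjunct_adjunct [simp]: "adjunct (adjunct f) = f"
  by (simp add: adjunct_def)

lemma adjunct_bihom:
  assumes A: "prebialgebra A" and C: "prebialgebra C" and f: "f \<in> bihom A (bullet C)"
  shows "adjunct f \<in> bihom C (bullet A)"
  unfolding adjunct_def using bihom_bullet_bipairing[OF A C f]
  by (intro bipairing_bihom_bullet[OF C A bipairing_flip]) (auto simp: fun_eq_iff)

lemma adjunct_bij_betw:
  assumes A: "prebialgebra A" and C: "prebialgebra C"
  shows "bij_betw adjunct (bihom A (bullet C)) (bihom C (bullet A))"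
  by (rule bij_betw_byWitness[of _ adjunct]) (auto intro: adjunct_bihom assms)

section \<open>Composition of pairings and functoriality of the transpose\<close>

text \<open>Homomorphisms and transposes are normalised to be \<open>0\<close> off the carriers, so
  pairings that arise from composition match them only on the carriers.\<close>

lemma bipairing_cong:
  assumes A: "precoalgebra A" and C: "precoalgebra C" and p: "bipairing A C p"
    and eq: "\<And>a x. a \<in> car A \<Longrightarrow> x \<in> car C \<Longrightarrow> p a x = q a x"
    and mem: "aone A \<in> car A" "aone C \<in> car C" "\<And>a b. a \<in> car A \<Longrightarrow> b \<in> car A \<Longrightarrow> amult A a b \<in> car A"
      "\<And>x y. x \<in> car C \<Longrightarrow> y \<in> car C \<Longrightarrow> amult C x y \<in> car C"
  shows "bipairing A C q"
proof -
  note vsA = precoalgebraD(1)[OF A] and vsC = precoalgebraD(1)[OF C]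
  have m1: "measuring A C p" and m2: "measuring C A (\<lambda>x a. p a x)" using p by (simp_all add: bipairing_def)
  have b: "bilinear_on A C base_field q" "bilinear_on C A base_field (\<lambda>x a. q a x)"
    using measuringD(1)[OF m1] measuringD(1)[OF m2] eq
      bilinear_on_cong[of A C p q base_field] bilinear_on_cong[of C A "\<lambda>x a. p a x" "\<lambda>x a. q a x" base_field]
      vsA vsC by blast+
  have "q (amult A a b) x = comult C x (\<lambda>x1 x2. q a x1 * q b x2)"
    if "a \<in> car A" "b \<in> car A" "x \<in> car C" for a b x
    using measuringD(2)[OF m1 that] that tensor_apply_cong[OF vsC vsC precoalgebraD(4)[OF C that(3)],
        of "\<lambda>x1 x2. p a x1 * p b x2" "\<lambda>x1 x2. q a x1 * q b x2"]
    by (simp add: eq mem)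
  moreover have "q a (amult C x y) = comult A a (\<lambda>a1 a2. q a1 x * q a2 y)"
    if "x \<in> car C" "y \<in> car C" "a \<in> car A" for a x y
    using measuringD(2)[OF m2 that] that tensor_apply_cong[OF vsA vsA precoalgebraD(4)[OF A that(3)],
        of "\<lambda>a1 a2. p a1 x * p a2 y" "\<lambda>a1 a2. q a1 x * q a2 y"]
    by (simp add: eq mem)
  ultimately show ?thesis
    using b measuringD(3)[OF m1] measuringD(3)[OF m2] by (simp add: bipairing_def measuring_def eq[symmetric] mem)
qed

lemma measuring_comp_left:
  assumes p: "measuring A C p" and g: "g \<in> algebra_hom A' A"
  shows "measuring A' C (\<lambda>a. p (g a))"
proof -
  have g': "linear_on A' A g" "g (aone A') = aone A"
    "\<And>a b. a \<in> car A' \<Longrightarrow> b \<in> car A' \<Longrightarrow> g (amult A' a b) = amult A (g a) (g b)"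
    using g by (auto simp: algebra_hom_def lhom_def)
  note pb = measuringD(1)[OF p] and mem = linear_on_mem[OF g'(1)]
  have "bilinear_on A' C base_field (\<lambda>a. p (g a))"
    by (intro bilinear_onI bilinear_on_right[OF pb] mem linear_on_comp[OF bilinear_on_left[OF pb] g'(1)])
  then show ?thesis
    by (simp add: measuring_def g' measuringD(2,3)[OF p] mem)
qed

lemma measuring_comp_right:
  assumes C: "precoalgebra C" and C': "precoalgebra C'"
    and p: "measuring A C p" and A: "aone A \<in> car A" "is_vspace A" and g: "g \<in> coalgebra_hom C' C"
  shows "measuring A C' (\<lambda>a x. p a (g x))"
proof -
  have g': "linear_on C' C g" "\<And>x. x \<in> car C' \<Longrightarrow> counit C (g x) = counit C' x"
    "\<And>x. x \<in> car C' \<Longrightarrow> comult C (g x) = tmap2 C' C g (comult C' x)"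
    using g by (auto simp: coalgebra_hom_def lhom_def)
  note pb = measuringD(1)[OF p] and mem = linear_on_mem[OF g'(1)]
  note vs = precoalgebraD(1)[OF C] and vs' = precoalgebraD(1)[OF C']
  have b: "bilinear_on C' C' (tpow2 C) (\<lambda>x y. tens C C (g x) (g y))"
    by (intro bilinear_onI linear_on_tens_left linear_on_tens_right g' mem)
  have "bilinear_on A C' base_field (\<lambda>a x. p a (g x))"
    by (intro bilinear_onI bilinear_on_left[OF pb] mem linear_on_comp[OF bilinear_on_right[OF pb] g'(1)])
  moreover have "p (amult A a b) (g x) = comult C' x (\<lambda>x1 x2. p a (g x1) * p b (g x2))"
    if a: "a \<in> car A" "b \<in> car A" and x: "x \<in> car C'" for a b x
    unfolding measuringD(2)[OF p a mem[OF x]] g'(3)[OF x] tmap2_def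
      tensor_image(2)[OF vs' vs' b precoalgebraD(4)[OF C' x] vs vs]
    by (simp add: tens_def bilinear_on_product bilinear_on_right[OF pb] a)
  ultimately show ?thesis
    by (simp add: measuring_def measuringD(3)[OF p] mem g')
qed

lemma bipairing_comp:
  assumes p: "bipairing A C p" and g: "g \<in> bihom A' A" and h: "h \<in> bihom C' C"
    and pre: "prebialgebra A" "prebialgebra A'" "prebialgebra C" "prebialgebra C'"
  shows "bipairing A' C' (\<lambda>a x. p (g a) (h x))"
proof -
  note D = prebialgebraD(4,12,5)
  have "measuring A C p" "measuring C A (\<lambda>x a. p a x)" using p by (simp_all add: bipairing_def)
  moreover have "g \<in> algebra_hom A' A" "g \<in> coalgebra_hom A' A" "h \<in> algebra_hom C' C" "h \<in> coalgebra_hom C' C"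
    using g h by (simp_all add: bihom_def)
  ultimately have m: "measuring A' C (\<lambda>a. p (g a))" "measuring C' A (\<lambda>x a. p a (h x))"
    and co: "h \<in> coalgebra_hom C' C" "g \<in> coalgebra_hom A' A"
    by (auto intro: measuring_comp_left)
  show ?thesis
    using measuring_comp_right[OF D(1)[OF pre(3)] D(1)[OF pre(4)] m(1) D(2,3)[OF pre(2)] co(1)]
      measuring_comp_right[OF D(1)[OF pre(1)] D(1)[OF pre(2)] m(2) D(2,3)[OF pre(4)] co(2)]
    by (simp add: bipairing_def)
qed

lemma ident_apply [simp]: "x \<in> car V \<Longrightarrow> ident V x = x"
  by (simp add: ident_def)

lemma ident_bihom: "prebialgebra A \<Longrightarrow> ident A \<in> bihom A A"
proof -
  assume A: "prebialgebra A"
  note vs = prebialgebraD(5)[OF A]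
  have lin: "linear_on A A (ident A)"
    by (rule linear_onI) (simp_all add: vs_add[OF vs] vs_scl[OF vs])
  have b: "bilinear_on A A (tpow2 A) (\<lambda>x y. tens A A (ident A x) (ident A y))"
    by (intro bilinear_onI linear_on_tens_left linear_on_tens_right lin linear_on_mem[OF lin])
  have "tmap2 A A (ident A) t = t" if "t \<in> car (tpow2 A)" for t
    unfolding tmap2_def
    by (rule tensor_ext[OF tlift_linear[OF vs vs is_vspace_vtensor b] linear_on_id _ that])
      (simp add: tlift_tens[OF vs vs is_vspace_vtensor b])
  then show ?thesis
    using lin precoalgebraD(4)[OF prebialgebraD(4)[OF A]] prebialgebraD(12,13)[OF A]
    by (simp add: bihom_def algebra_hom_def coalgebra_hom_def lhom_def) (simp add: ident_def)
qed

lemma bihom_mem: "f \<in> bihom A B \<Longrightarrow> a \<in> car A \<Longrightarrow> f a \<in> car B"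
  and bihom_outside: "f \<in> bihom A B \<Longrightarrow> a \<notin> car A \<Longrightarrow> f a = 0"
  by (auto simp: bihom_def algebra_hom_def lhom_def linear_on_mem)

lemma bullet_outside: "prebialgebra A \<Longrightarrow> f \<in> car (bullet A) \<Longrightarrow> x \<notin> car A \<Longrightarrow> f x = 0"
  and bullet_zero: "prebialgebra A \<Longrightarrow> f \<in> car (bullet A) \<Longrightarrow> f 0 = 0"
  using bullet_lhom[of A] bullet_linear[of A f] linear_on_zero[of A base_field f]
  by (auto simp: prebialgebraD lhom_def)

text \<open>As a pairing, the transpose of \<open>f\<close> is the evaluation pairing of
  \<open>bullet B\<close> and \<open>B\<close>, pulled back along \<open>f\<close> in the second
  argument. All compatibilities are inherited from the evaluation pairing.\<close>

lemma transpose_map_bihom: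
  assumes A: "prebialgebra A" and B: "prebialgebra B" and f: "f \<in> bihom A B"
  shows "transpose_map B f \<in> bihom (bullet B) (bullet A)"
proof (rule bipairing_bihom_bullet[OF prebialgebra_bullet[OF B] A])
  note D = prebialgebra_bullet[OF B]
  show "bipairing (bullet B) A (transpose_map B f)"
  proof (rule bipairing_cong)
    \<comment> \<open>\<open>bipairing_comp\<close> expects a homomorphism in each argument; the
      first one is the identity in its normalised form.\<close>
    show "bipairing (bullet B) A (\<lambda>h x. ident (bullet B) h (f x))"
      by (rule bipairing_comp[OF bipairing_app[OF B] ident_bihom[OF D] f D D B A])
  qed (use D A in \<open>auto simp: transpose_map_def prebialgebraD simp del: bullet_vs intro: prebialgebraD(12,13)\<close>)
  show "transpose_map B f h = 0" if "h \<notin> car (bullet B)" for h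
    using that by (simp add: transpose_map_def)
  show "transpose_map B f h x = 0" if "x \<notin> car A" for h x
    using that by (simp add: transpose_map_def bihom_outside[OF f] bullet_zero[OF B])
qed

text \<open>\<open>ident A\<close> is \<open>0\<close> off the carrier. Functionals in the finite
  dual vanish there too and send \<open>0\<close> to \<open>0\<close>, so composing with
  \<open>ident A\<close> changes nothing.\<close>

lemma transpose_map_ident:
  assumes "prebialgebra A" shows "transpose_map A (ident A) = ident (bullet A)"
proof -
  have "h (if x \<in> car A then x else 0) = h x" if "h \<in> car (bullet A)" for h x
    using bullet_zero[OF assms that] bullet_outside[OF assms that] by (cases "x \<in> car A") simp_all
  then show ?thesis by (auto simp: transpose_map_def ident_def fun_eq_iff)
qed

lemma transpose_map_comp:
  assumes "prebialgebra B" "prebialgebra C" "g \<in> bihom B C"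
  shows "transpose_map C (g \<circ> f) = transpose_map B f \<circ> transpose_map C g"
proof
  show "transpose_map C (g \<circ> f) h = (transpose_map B f \<circ> transpose_map C g) h" for h
    using bihom_mem[OF transpose_map_bihom[OF assms], of h]
    by (auto simp: transpose_map_def fun_eq_iff)
qed

lemma adjunct_ident_bullet: "adjunct (ident (bullet A)) = evaluation A"
  and adjunct_evaluation: "adjunct (evaluation A) = ident (bullet A)"
  by (simp_all add: adjunct_def evaluation_def ident_def fun_eq_iff)

lemma evaluation_bihom: "prebialgebra A \<Longrightarrow> evaluation A \<in> bihom A (bullet (bullet A))"
  unfolding adjunct_ident_bullet[symmetric]
  by (intro adjunct_bihom ident_bihom prebialgebra_bullet)

lemma adjunct_comp_left:
  assumes "prebialgebra A" "prebialgebra C" "f \<in> bihom A (bullet C)"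
  shows "adjunct (f \<circ> p) = transpose_map A p \<circ> adjunct f"
proof
  fix x
  show "adjunct (f \<circ> p) x = (transpose_map A p \<circ> adjunct f) x"
    using bihom_mem[OF adjunct_bihom[OF assms], of x] bihom_outside[OF adjunct_bihom[OF assms], of x]
    by (cases "x \<in> car C") (auto simp: transpose_map_def adjunct_def fun_eq_iff)
qed

lemma adjunct_comp_right:
  assumes "prebialgebra A" "prebialgebra C" "f \<in> bihom A (bullet C)"
  shows "adjunct (transpose_map C q \<circ> f) = adjunct f \<circ> q"
proof -
  have "transpose_map C q (f a) = f a \<circ> q" for a
    using bihom_mem[OF assms(3), of a] bihom_outside[OF assms(3), of a]
    by (cases "a \<in> car A") (auto simp: transpose_map_def fun_eq_iff)
  then show ?thesis by (simp add: adjunct_def fun_eq_iff)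
qed

section \<open>Associativity against coassociativity\<close>

text \<open>Each coproduct on the side of \<open>A\<close> becomes a product on the side of
  \<open>C\<close>, and the bracketing is preserved. This exchanges associativity with
  coassociativity, and their weakened forms when a reassociator is present.\<close>

lemma tpair3_comult_left_right:
  assumes A: "prebialgebra A" and C: "prebialgebra C" and p: "bipairing A C p"
    and a: "a \<in> car A" and el: "x \<in> car C" "y \<in> car C" "z \<in> car C"
  shows "tpair3 p (comult_left A (comult A a)) (tens3 C x y z) = p a (amult C (amult C x y) z)"
    and "tpair3 p (comult_right A (comult A a)) (tens3 C x y z) = p a (amult C x (amult C y z))"
proof -
  note vsA = prebialgebraD(5)[OF A] and vsC = prebialgebraD(5)[OF C]
  note coA = prebialgebraD(4)[OF A]
  note \<Delta> = precoalgebraD(4)[OF coA]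
  have m1: "measuring A C p" and m2: "measuring C A (\<lambda>x a. p a x)" using p by (simp_all add: bipairing_def)
  note pb = measuringD(1)[OF m1]
  have lin: "linear_on (tpow3 A) base_field (\<lambda>t. tpair3 p t (tens3 C x y z))"
    by (rule bilinear_on_left[OF tpair3_bilinear[OF vsA vsC pb] tens3_mem[OF el]])
  have b: "bilinear_on A A base_field (\<lambda>a b. p a x * p b y)" if "x \<in> car C" "y \<in> car C" for x y
    by (intro bilinear_on_product bilinear_on_left[OF pb] that)
  have "comult A b (\<lambda>a1 a2. tpair3 p (tens3 A a1 a2 c) (tens3 C x y z)) = p b (amult C x y) * p c z"
    if bc: "b \<in> car A" "c \<in> car A" for b c
  proof -
    have "comult A b (\<lambda>a1 a2. tpair3 p (tens3 A a1 a2 c) (tens3 C x y z))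
      = comult A b (\<lambda>a1 a2. p c z * (p a1 x * p a2 y))"
      by (rule tensor_apply_cong[OF vsA vsA \<Delta>[OF bc(1)]]) (simp add: tpair3_tens3[OF vsA vsC pb] el bc)
    also have "\<dots> = p b (amult C x y) * p c z"
      by (simp add: tensor_apply_mult[OF vsA vsA b \<Delta>] el bc measuringD(2)[OF m2])
    finally show ?thesis .
  qed
  then have "tpair3 p (comult_left A (comult A a)) (tens3 C x y z)
    = comult A a (\<lambda>b c. p b (amult C x y) * p c z)"
    unfolding comult_left_apply[OF coA \<Delta>[OF a] lin] by (rule tensor_apply_cong[OF vsA vsA \<Delta>[OF a]])
  then show "tpair3 p (comult_left A (comult A a)) (tens3 C x y z) = p a (amult C (amult C x y) z)"
    by (simp add: measuringD(2)[OF m2] el a prebialgebraD(13)[OF C])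
  have "comult A c (\<lambda>a1 a2. tpair3 p (tens3 A b a1 a2) (tens3 C x y z)) = p b x * p c (amult C y z)"
    if bc: "b \<in> car A" "c \<in> car A" for b c
  proof -
    have "comult A c (\<lambda>a1 a2. tpair3 p (tens3 A b a1 a2) (tens3 C x y z))
      = comult A c (\<lambda>a1 a2. p b x * (p a1 y * p a2 z))"
      by (rule tensor_apply_cong[OF vsA vsA \<Delta>[OF bc(2)]]) (simp add: tpair3_tens3[OF vsA vsC pb] el bc)
    also have "\<dots> = p b x * p c (amult C y z)"
      by (simp add: tensor_apply_mult[OF vsA vsA b \<Delta>] el bc measuringD(2)[OF m2])
    finally show ?thesis .
  qed
  then have "tpair3 p (comult_right A (comult A a)) (tens3 C x y z)
    = comult A a (\<lambda>b c. p b x * p c (amult C y z))"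
    unfolding comult_right_apply[OF coA \<Delta>[OF a] lin] by (rule tensor_apply_cong[OF vsA vsA \<Delta>[OF a]])
  then show "tpair3 p (comult_right A (comult A a)) (tens3 C x y z) = p a (amult C x (amult C y z))"
    by (simp add: measuringD(2)[OF m2] el a prebialgebraD(13)[OF C])
qed

lemma bullet_NAlgCoalg:
  assumes "A \<in> NCoalgAlg"
  shows "bullet A \<in> NAlgCoalg"
proof -
  have A: "prebialgebra A" and assoc: "\<And>a b c. a \<in> car A \<Longrightarrow> b \<in> car A \<Longrightarrow> c \<in> car A \<Longrightarrow>
      amult A (amult A a b) c = amult A a (amult A b c)"
    using assms by (auto simp: NCoalgAlg_iff)
  note D = prebialgebra_bullet[OF A] and pre = prebialgebraD(3)[OF A]
  note lr = comult_left_linear[OF prebialgebraD(4)[OF D]] comult_right_linear[OF prebialgebraD(4)[OF D]]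
  have "comult_left (bullet A) (comult (bullet A) f) = comult_right (bullet A) (comult (bullet A) f)"
    if f: "f \<in> car (bullet A)" for f
    by (rule tensor3_eqI[OF prebialgebraD(5)[OF D] prebialgebraD(5)[OF A] app_bullet[OF pre]
          linear_on_mem[OF lr(1) comult_bullet_mem[OF pre f]] linear_on_mem[OF lr(2) comult_bullet_mem[OF pre f]]])
      (simp add: tpair3_comult_left_right[OF D A bipairing_app[OF A] f] assoc)
  then show ?thesis using D by (simp add: NAlgCoalg_iff)
qed

lemma conv_ground_assoc:
  assumes C: "precoalgebra C" and coassoc: "comult_left C (comult C x) = comult_right C (comult C x)"
    and x: "x \<in> car C"
    and lin: "linear_on C base_field f" "linear_on C base_field g" "linear_on C base_field h"
  shows "conv C ground (conv C ground f g) h x = conv C ground f (conv C ground g h) x"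
proof -
  note vs = precoalgebraD(1)[OF C] and \<Delta> = precoalgebraD(4)[OF C]
  \<comment> \<open>The product functional of \<open>f\<close>, \<open>g\<close> and
    \<open>h\<close> on the third tensor power. The two bracketings of the convolution are its
    values on the two iterated coproducts of \<open>x\<close>.\<close>
  define F where "F = tlift3 C base_field (\<lambda>x y z. f x * g y * h z)"
  have tri: "trilinear_on C base_field (\<lambda>x y z. f x * g y * h z)"
    by (intro trilinear_onI linear_on_mult_left linear_on_mult_right lin)
  have F: "linear_on (tpow3 C) base_field F"
    unfolding F_def by (rule tlift3_linear[OF vs is_vspace_base_field tri])
  have F3: "F (tens3 C a b c) = f a * g b * h c" if "a \<in> car C" "b \<in> car C" "c \<in> car C" for a b c
    unfolding F_def by (rule tlift3_tens3[OF vs is_vspace_base_field tri that])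
  have conv_lin: "linear_on C base_field (conv C ground f g)" if "linear_on C base_field f" "linear_on C base_field g" for f g
    by (rule lhom_linear[OF conv_ground_lhom[OF C that]])
  have mult: "comult C a (\<lambda>x y. c * (f x * g y)) = c * conv C ground f g a"
    if "linear_on C base_field f" "linear_on C base_field g" "a \<in> car C" for a c f g
    using tensor_apply_mult[OF vs vs bilinear_on_product[OF that(1,2)] \<Delta>[OF that(3)]]
    by (simp add: conv_ground_apply[OF C that])
  have L: "comult C a (\<lambda>a1 a2. F (tens3 C a1 a2 b)) = conv C ground f g a * h b"
    and R: "comult C b (\<lambda>b1 b2. F (tens3 C a b1 b2)) = f a * conv C ground g h b"
    if ab: "a \<in> car C" "b \<in> car C" for a b
  proof -
    have "comult C a (\<lambda>a1 a2. F (tens3 C a1 a2 b)) = comult C a (\<lambda>a1 a2. h b * (f a1 * g a2))"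
      by (rule tensor_apply_cong[OF vs vs \<Delta>[OF ab(1)]]) (simp add: F3 ab)
    then show "comult C a (\<lambda>a1 a2. F (tens3 C a1 a2 b)) = conv C ground f g a * h b"
      by (simp add: mult lin ab)
    have "comult C b (\<lambda>b1 b2. F (tens3 C a b1 b2)) = comult C b (\<lambda>b1 b2. f a * (g b1 * h b2))"
      by (rule tensor_apply_cong[OF vs vs \<Delta>[OF ab(2)]]) (simp add: F3 ab)
    then show "comult C b (\<lambda>b1 b2. F (tens3 C a b1 b2)) = f a * conv C ground g h b"
      by (simp add: mult lin ab)
  qed
  have "conv C ground (conv C ground f g) h x = comult C x (\<lambda>a b. conv C ground f g a * h b)"
    by (rule conv_ground_apply[OF C conv_lin lin(3) x]) (rule lin)+
  also have "\<dots> = F (comult_left C (comult C x))"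
    unfolding comult_left_apply[OF C \<Delta>[OF x] F]
    by (rule tensor_apply_cong[OF vs vs \<Delta>[OF x]]) (simp add: L)
  also have "\<dots> = comult C x (\<lambda>a b. f a * conv C ground g h b)"
    unfolding coassoc comult_right_apply[OF C \<Delta>[OF x] F]
    by (rule tensor_apply_cong[OF vs vs \<Delta>[OF x]]) (simp add: R)
  also have "\<dots> = conv C ground f (conv C ground g h) x"
    by (rule conv_ground_apply[OF C lin(1) conv_lin x, symmetric]) (rule lin)+
  finally show ?thesis .
qed

lemma bullet_NCoalgAlg:
  assumes "C \<in> NAlgCoalg"
  shows "bullet C \<in> NCoalgAlg"
proof -
  have C: "prebialgebra C" and coassoc: "\<And>x. x \<in> car C \<Longrightarrow>
      comult_left C (comult C x) = comult_right C (comult C x)"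
    using assms by (auto simp: NAlgCoalg_iff)
  note pre = prebialgebraD(3)[OF C] and lin = bullet_linear[OF prebialgebraD(3)[OF C]]
  have "conv C ground (conv C ground f g) h = conv C ground f (conv C ground g h)"
    if f: "f \<in> car (bullet C)" and g: "g \<in> car (bullet C)" and h: "h \<in> car (bullet C)" for f g h
    by (rule bullet_eqI[OF pre conv_bullet_mem[OF C conv_bullet_mem[OF C f g] h]
          conv_bullet_mem[OF C f conv_bullet_mem[OF C g h]]])
      (rule conv_ground_assoc[OF prebialgebraD(4)[OF C] coassoc _ lin[OF f] lin[OF g] lin[OF h]])
  then show ?thesis using prebialgebra_bullet[OF C] by (simp add: NCoalgAlg_iff)
qed


section \<open>Reassociators\<close>

lemma tlift3_vs [simp]:
  "tlift3 V (A \<otimes>\<^sub>b B) = tlift3 V (A \<otimes>\<^sub>v B)"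
  by (simp add: tlift3_def fun_eq_iff)

lemma tlift4_vs [simp]:
  "tlift4 V (A \<otimes>\<^sub>b B) = tlift4 V (A \<otimes>\<^sub>v B)"
  by (simp add: tlift4_def fun_eq_iff)

lemma tpair_cong:
  assumes vs: "is_vspace A" "is_vspace B" "is_vspace C" "is_vspace D"
    and t: "t \<in> car (A \<otimes>\<^sub>v B)" and s: "s \<in> car (C \<otimes>\<^sub>v D)"
    and eq: "\<And>a c. a \<in> car A \<Longrightarrow> c \<in> car C \<Longrightarrow> p a c = p' a c"
      "\<And>b d. b \<in> car B \<Longrightarrow> d \<in> car D \<Longrightarrow> q b d = q' b d"
  shows "tpair p q t s = tpair p' q' t s"
  unfolding tpair_def
  by (rule tensor_apply_cong[OF vs(1,2) t], rule tensor_apply_cong[OF vs(3,4) s]) (simp add: eq)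

lemma tpair3_cong:
  assumes A: "is_vspace A" and C: "is_vspace C"
    and t: "t \<in> car (tpow3 A)" and s: "s \<in> car (tpow3 C)"
    and eq: "\<And>a c. a \<in> car A \<Longrightarrow> c \<in> car C \<Longrightarrow> p a c = p' a c"
  shows "tpair3 p t s = tpair3 p' t s"
  by (rule tpair_cong[OF is_vspace_vtensor A is_vspace_vtensor C t s tpair_cong[OF A A C C _ _ eq eq] eq])

section \<open>Transport of triple tensors along linear maps\<close>

lemma tmap3_trilinear:
  assumes f: "linear_on A B f"
  shows "trilinear_on A (tpow3 B) (\<lambda>x y z. tens3 B (f x) (f y) (f z))"
  unfolding tens3_def
  by (intro trilinear_onI linear_on_tens_left linear_on_tens_right f tens_mem linear_on_mem[OF f])

context
  fixes A :: "('k::field, 'a::ab_group_add, 'm) vspace_scheme"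
    and B :: "('k, 'b::ab_group_add, 'n) vspace_scheme"
    and f
  assumes A: "is_vspace A" and B: "is_vspace B" and f: "linear_on A B f"
begin

lemma tmap3_lhom: "tmap3 A B f \<in> lhom (tpow3 A) (tpow3 B)"
  unfolding tmap3_def by (rule tlift3_lhom[OF A is_vspace_vtensor tmap3_trilinear[OF f]])

lemma tmap3_tens3: "x \<in> car A \<Longrightarrow> y \<in> car A \<Longrightarrow> z \<in> car A \<Longrightarrow>
    tmap3 A B f (tens3 A x y z) = tens3 B (f x) (f y) (f z)"
  unfolding tmap3_def by (rule tlift3_tens3[OF A is_vspace_vtensor tmap3_trilinear[OF f]])

lemma
  assumes C: "is_vspace C" and t: "t \<in> car (tpow3 A)" and u: "u \<in> car (tpow3 C)"
  shows tpair3_tmap3_left: "bilinear_on B C base_field p \<Longrightarrow>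
      tpair3 p (tmap3 A B f t) u = tpair3 (\<lambda>a. p (f a)) t u"
    and tpair3_tmap3_right: "bilinear_on C B base_field q \<Longrightarrow>
      tpair3 q u (tmap3 A B f t) = tpair3 (\<lambda>c a. q c (f a)) u t"
proof -
  note mem = linear_on_mem[OF f]
  show "tpair3 p (tmap3 A B f t) u = tpair3 (\<lambda>a. p (f a)) t u" if p: "bilinear_on B C base_field p"
  proof -
    have pf: "bilinear_on A C base_field (\<lambda>a. p (f a))"
      by (intro bilinear_onI bilinear_on_right[OF p] mem linear_on_comp[OF bilinear_on_left[OF p] f])
    note b = tpair3_bilinear[OF B C p] and b' = tpair3_bilinear[OF A C pf]
    show ?thesis
    proof (rule tensor3_ext[OF A linear_on_comp[OF bilinear_on_left[OF b u] lhom_linear[OF tmap3_lhom]]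
          bilinear_on_left[OF b' u] _ t])
      fix x y z assume x: "x \<in> car A" "y \<in> car A" "z \<in> car A"
      show "tpair3 p (tmap3 A B f (tens3 A x y z)) u = tpair3 (\<lambda>a. p (f a)) (tens3 A x y z) u"
        unfolding tmap3_tens3[OF x]
        by (rule tensor3_ext[OF C bilinear_on_right[OF b tens3_mem] bilinear_on_right[OF b' tens3_mem] _ u])
          (simp_all add: mem x tpair3_tens3[OF B C p] tpair3_tens3[OF A C pf])
    qed
  qed
  show "tpair3 q u (tmap3 A B f t) = tpair3 (\<lambda>c a. q c (f a)) u t" if q: "bilinear_on C B base_field q"
  proof -
    have qf: "bilinear_on C A base_field (\<lambda>c a. q c (f a))"
      by (intro bilinear_onI bilinear_on_left[OF q] mem linear_on_comp[OF bilinear_on_right[OF q] f])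
    note b = tpair3_bilinear[OF C B q] and b' = tpair3_bilinear[OF C A qf]
    show ?thesis
    proof (rule tensor3_ext[OF A linear_on_comp[OF bilinear_on_right[OF b u] lhom_linear[OF tmap3_lhom]]
          bilinear_on_right[OF b' u] _ t])
      fix x y z assume x: "x \<in> car A" "y \<in> car A" "z \<in> car A"
      show "tpair3 q u (tmap3 A B f (tens3 A x y z)) = tpair3 (\<lambda>c a. q c (f a)) u (tens3 A x y z)"
        unfolding tmap3_tens3[OF x]
        by (rule tensor3_ext[OF C bilinear_on_left[OF b tens3_mem] bilinear_on_left[OF b' tens3_mem] _ u])
          (simp_all add: mem x tpair3_tens3[OF C B q] tpair3_tens3[OF C A qf])
    qed
  qed
qed

end

text \<open>If \<open>s\<close> and \<open>t\<close> represent \<open>F\<close> and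
  \<open>G\<close>, their product represents the convolution. \<open>F\<close> and \<open>G\<close>
  need only agree with the pairing on the carrier, so they may be the very functionals that occur in
  the axioms for \<omega>.\<close>

lemma measuring_conv:
  assumes C: "precoalgebra C" and p: "measuring A C p" and s: "s \<in> car A" and t: "t \<in> car A"
    and F: "linear_on C base_field F" "\<And>x. x \<in> car C \<Longrightarrow> p s x = F x"
    and G: "linear_on C base_field G" "\<And>x. x \<in> car C \<Longrightarrow> p t x = G x"
    and x: "x \<in> car C"
  shows "p (amult A s t) x = conv C ground F G x"
  unfolding measuringD(2)[OF p s t x] conv_ground_apply[OF C F(1) G(1) x]
  by (rule tensor_apply_cong[OF precoalgebraD(1)[OF C] precoalgebraD(1)[OF C] precoalgebraD(4)[OF C x]])
    (simp add: F G)

section \<open>The pentagon axiom and its dual\<close>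

text \<open>These four definitions copy the sides of the pentagon axioms in \<open>QBialg\<close>
  and \<open>DQBialg\<close>, so that each side can be carried across the pairing by itself.\<close>

definition pentagon_lhs :: "('k::field, 'a::ab_group_add) bistruct \<Rightarrow> ('k, 'a) tensor3 \<Rightarrow> ('k, 'a) tensor4" where
  "pentagon_lhs H \<Phi> = (let H4 = H \<otimes>\<^sub>b H \<otimes>\<^sub>b H \<otimes>\<^sub>b H; \<Delta> = comult H in
     amult H4
        (tlift3 H H4 (\<lambda>a b c. tlift H H H4 (\<lambda>c1 c2. tens4 H a b c1 c2) (\<Delta> c)) \<Phi>)
        (tlift3 H H4 (\<lambda>a b c. tlift H H H4 (\<lambda>a1 a2. tens4 H a1 a2 b c) (\<Delta> a)) \<Phi>))"

definition pentagon_rhs :: "('k::field, 'a::ab_group_add) bistruct \<Rightarrow> ('k, 'a) tensor3 \<Rightarrow> ('k, 'a) tensor4" where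
  "pentagon_rhs H \<Phi> = (let H4 = H \<otimes>\<^sub>b H \<otimes>\<^sub>b H \<otimes>\<^sub>b H; \<Delta> = comult H; e = aone H in
     amult H4
         (amult H4
           (tlift3 H H4 (\<lambda>a b c. tens4 H e a b c) \<Phi>)
           (tlift3 H H4 (\<lambda>a b c. tlift H H H4 (\<lambda>b1 b2. tens4 H a b1 b2 c) (\<Delta> b)) \<Phi>))
         (tlift3 H H4 (\<lambda>a b c. tens4 H a b c e) \<Phi>))"

definition copentagon_lhs ::
  "('k::field, 'a::ab_group_add) bistruct \<Rightarrow> (('k, 'a) tensor3 \<Rightarrow> 'k) \<Rightarrow> ('k, 'a) tensor4 \<Rightarrow> 'k" where
  "copentagon_lhs U \<omega> = (let U3 = U \<otimes>\<^sub>b U \<otimes>\<^sub>b U; U4 = U \<otimes>\<^sub>b U \<otimes>\<^sub>b U \<otimes>\<^sub>b U; m = amult U in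
     conv U4 ground
        (\<omega> \<circ> tlift4 U U3 (\<lambda>x y z w. tens3 U x y (m z w)))
        (\<omega> \<circ> tlift4 U U3 (\<lambda>x y z w. tens3 U (m x y) z w)))"

definition copentagon_rhs ::
  "('k::field, 'a::ab_group_add) bistruct \<Rightarrow> (('k, 'a) tensor3 \<Rightarrow> 'k) \<Rightarrow> ('k, 'a) tensor4 \<Rightarrow> 'k" where
  "copentagon_rhs U \<omega> = (let U3 = U \<otimes>\<^sub>b U \<otimes>\<^sub>b U; U4 = U \<otimes>\<^sub>b U \<otimes>\<^sub>b U \<otimes>\<^sub>b U; m = amult U; \<epsilon> = counit U in
     conv U4 ground
         (conv U4 ground
           (tlift4 U base_field (\<lambda>x y z w. \<epsilon> x * \<omega> (tens3 U y z w)))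
           (\<omega> \<circ> tlift4 U U3 (\<lambda>x y z w. tens3 U x (m y z) w)))
         (tlift4 U base_field (\<lambda>x y z w. \<omega> (tens3 U x y z) * \<epsilon> w)))"

context
  fixes A :: "('k::field, 'a::ab_group_add) bistruct"
    and C :: "('k, 'c::ab_group_add) bistruct"
    and p :: "'a \<Rightarrow> 'c \<Rightarrow> 'k" and \<Phi> :: "('k, 'a) tensor3" and \<omega> :: "('k, 'c) tensor3 \<Rightarrow> 'k"
  assumes A: "prebialgebra A" and C: "prebialgebra C" and p: "bipairing A C p"
    and \<Phi>: "\<Phi> \<in> car (tpow3 A)" and \<omega>: "\<omega> \<in> lhom (tpow3 C) base_field"
    and \<Phi>\<omega>: "\<And>u. u \<in> car (tpow3 C) \<Longrightarrow> tpair3 p \<Phi> u = \<omega> u"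
begin

private lemma m1: "measuring A C p" and m2: "measuring C A (\<lambda>x a. p a x)"
  using p by (simp_all add: bipairing_def)

private lemmas pb = measuringD(1)[OF m1]
private lemmas vsA = prebialgebraD(5)[OF A]
private lemmas vsC = prebialgebraD(5)[OF C]
private lemmas preA = prebialgebraD(3)[OF A]
private lemmas coA = prebialgebraD(4)[OF A]
private lemmas preC = prebialgebraD(3)[OF C]
private lemmas coC = prebialgebraD(4)[OF C]
private lemmas p3 = tpair3_bilinear[OF vsA vsC pb]
private lemmas p4 = tpair4_bilinear[OF vsA vsC pb]

private lemmas pre3 = prealgebra_btensor[OF prealgebra_btensor[OF preA preA] preA]
private lemmas co3 = precoalgebra_btensor[OF precoalgebra_btensor[OF coC coC] coC]
private lemmas pre4 = prealgebra_btensor[OF pre3 preA]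
private lemmas co4 = precoalgebra_btensor[OF co3 coC]

lemma measuring3: "measuring (bpow3 A) (bpow3 C) (tpair3 p)"
  by (intro measuring_btensor prealgebra_btensor precoalgebra_btensor preA coC m1)

lemma measuring4: "measuring (bpow4 A) (bpow4 C) (tpair4 p)"
  by (intro measuring_btensor prealgebra_btensor precoalgebra_btensor preA coC m1)

lemma tens4_slices:
  assumes "x \<in> car A" "y \<in> car A"
  shows "bilinear_on A A (tpow4 A) (\<lambda>z w. tens4 A x y z w)"
    "bilinear_on A A (tpow4 A) (\<lambda>z w. tens4 A x z y w)"
    "bilinear_on A A (tpow4 A) (\<lambda>z w. tens4 A x z w y)"
    "bilinear_on A A (tpow4 A) (\<lambda>z w. tens4 A z x y w)"
    "bilinear_on A A (tpow4 A) (\<lambda>z w. tens4 A z x w y)"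
    "bilinear_on A A (tpow4 A) (\<lambda>z w. tens4 A z w x y)"
  using tens4_quadrilinear[of A] assms
  by (simp_all add: quadrilinear_on_def trilinear_on_def bilinear_on_def)

lemma pentagon_trilinear:
  "trilinear_on A (tpow4 A)
    (\<lambda>a b c. tlift A A (tpow4 A) (\<lambda>c1 c2. tens4 A a b c1 c2) (comult A c))" (is ?t1)
  "trilinear_on A (tpow4 A)
    (\<lambda>a b c. tlift A A (tpow4 A) (\<lambda>a1 a2. tens4 A a1 a2 b c) (comult A a))" (is ?t2)
  "trilinear_on A (tpow4 A)
    (\<lambda>a b c. tlift A A (tpow4 A) (\<lambda>b1 b2. tens4 A a b1 b2 c) (comult A b))" (is ?t3)
  "trilinear_on A (tpow4 A) (\<lambda>a b c. tens4 A (aone A) a b c)" (is ?t4)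
  "trilinear_on A (tpow4 A) (\<lambda>a b c. tens4 A a b c (aone A))" (is ?t5)
proof -
  note \<Delta> = precoalgebraD(2)[OF coA] and \<Delta>m = precoalgebraD(4)[OF coA]
  note lin = linear_on_comp[OF tlift_linear[OF vsA vsA is_vspace_vtensor] \<Delta>]
  note par = tlift_param[OF vsA vsA vsA is_vspace_vtensor _ _ \<Delta>m]
  note sl = tens4_slices
  note L = bilinear_on_left[OF sl(1)] bilinear_on_left[OF sl(2)] bilinear_on_left[OF sl(3)]
    bilinear_on_left[OF sl(4)] bilinear_on_left[OF sl(5)] bilinear_on_left[OF sl(6)]
    bilinear_on_right[OF sl(1)] bilinear_on_right[OF sl(3)]
  show ?t1
    by (rule trilinear_onI, rule lin, simp add: sl, (rule par; simp add: sl L)+)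
  show ?t2
    by (rule trilinear_onI, (rule par; simp add: sl L), (rule par; simp add: sl L), rule lin, simp add: sl)
  show ?t3
    by (rule trilinear_onI, (rule par; simp add: sl L), rule lin, simp add: sl, (rule par; simp add: sl L))
  show ?t4 ?t5
    by (rule trilinear_onI; simp add: L prebialgebraD(12)[OF A])+
qed

text \<open>The common pattern of the five factors of the pentagon. Where \<open>G\<close> applies a
  coproduct, \<open>K\<close> multiplies two neighbouring entries and \<open>k\<close> is
  \<open>1\<close>; where \<open>G\<close> inserts the unit, \<open>K\<close> drops an entry and
  \<open>k\<close> is the counit of that entry. Pure tensors suffice on both sides.\<close>

lemma tpair4_tlift3:
  assumes G: "trilinear_on A (tpow4 A) G" and F: "linear_on (tpow4 C) base_field F"
    and K: "\<And>x y z w. x \<in> car C \<Longrightarrow> y \<in> car C \<Longrightarrow> z \<in> car C \<Longrightarrow> w \<in> car C \<Longrightarrow> K x y z w \<in> car (tpow3 C)"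
    and FK: "\<And>x y z w. x \<in> car C \<Longrightarrow> y \<in> car C \<Longrightarrow> z \<in> car C \<Longrightarrow> w \<in> car C \<Longrightarrow>
      F (tens4 C x y z w) = k x y z w * \<omega> (K x y z w)"
    and eq: "\<And>a b c x y z w. a \<in> car A \<Longrightarrow> b \<in> car A \<Longrightarrow> c \<in> car A \<Longrightarrow>
      x \<in> car C \<Longrightarrow> y \<in> car C \<Longrightarrow> z \<in> car C \<Longrightarrow> w \<in> car C \<Longrightarrow>
      tpair4 p (G a b c) (tens4 C x y z w) = k x y z w * tpair3 p (tens3 A a b c) (K x y z w)"
    and u: "u \<in> car (tpow4 C)"
  shows "tpair4 p (tlift3 A (tpow4 A) G \<Phi>) u = F u"
proof (rule tensor4_ext[OF vsC _ F _ u])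
  note tl = tlift3_linear[OF vsA is_vspace_vtensor G]
  show "linear_on (tpow4 C) base_field (tpair4 p (tlift3 A (tpow4 A) G \<Phi>))"
    by (rule bilinear_on_right[OF p4 linear_on_mem[OF tl \<Phi>]])
  fix x y z w assume el: "x \<in> car C" "y \<in> car C" "z \<in> car C" "w \<in> car C"
  have "tpair4 p (tlift3 A (tpow4 A) G \<Phi>) (tens4 C x y z w) = k x y z w * tpair3 p \<Phi> (K x y z w)"
    by (rule tensor3_ext[OF vsA linear_on_comp[OF bilinear_on_left[OF p4 tens4_mem[OF el]] tl]
          linear_on_mult_left[OF bilinear_on_left[OF p3 K[OF el]]] _ \<Phi>])
      (simp add: tlift3_tens3[OF vsA is_vspace_vtensor G] eq el)
  then show "tpair4 p (tlift3 A (tpow4 A) G \<Phi>) (tens4 C x y z w) = F (tens4 C x y z w)"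
    by (simp add: FK el \<Phi>\<omega> K)
qed

lemma copentagon_quadrilinear:
  "quadrilinear_on C (tpow3 C) (\<lambda>x y z w. tens3 C x y (amult C z w))"
  "quadrilinear_on C (tpow3 C) (\<lambda>x y z w. tens3 C (amult C x y) z w)"
  "quadrilinear_on C (tpow3 C) (\<lambda>x y z w. tens3 C x (amult C y z) w)"
  "quadrilinear_on C base_field (\<lambda>x y z w. counit C x * \<omega> (tens3 C y z w))"
  "quadrilinear_on C base_field (\<lambda>x y z w. \<omega> (tens3 C x y z) * counit C w)"
proof -
  note m = prealgebraD(2)[OF preC] and mem = bilinear_on_mem[OF prealgebraD(2)[OF preC]]
  note w3 = trilinear_on_comp[OF tens3_trilinear lhom_linear[OF \<omega>]]
  note l = bilinear_on_left[OF m] bilinear_on_right[OF m] linear_on_id mem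
  show "quadrilinear_on C (tpow3 C) (\<lambda>x y z w. tens3 C x y (amult C z w))"
    "quadrilinear_on C (tpow3 C) (\<lambda>x y z w. tens3 C (amult C x y) z w)"
    "quadrilinear_on C (tpow3 C) (\<lambda>x y z w. tens3 C x (amult C y z) w)"
    unfolding tens3_def
    by (intro quadrilinear_onI linear_on_tens_left linear_on_tens_right tens_mem; simp add: l)+
  show "quadrilinear_on C base_field (\<lambda>x y z w. counit C x * \<omega> (tens3 C y z w))"
    "quadrilinear_on C base_field (\<lambda>x y z w. \<omega> (tens3 C x y z) * counit C w)"
    using w3 precoalgebraD(3)[OF coC]
    by (auto intro!: quadrilinear_onI linear_on_mult_left linear_on_mult_right simp: trilinear_on_def)
qed

lemma copentagon_linear:
  "linear_on (tpow4 C) base_field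
    (\<omega> \<circ> tlift4 C (tpow3 C) (\<lambda>x y z w. tens3 C x y (amult C z w)))"
  "linear_on (tpow4 C) base_field
    (\<omega> \<circ> tlift4 C (tpow3 C) (\<lambda>x y z w. tens3 C (amult C x y) z w))"
  "linear_on (tpow4 C) base_field
    (\<omega> \<circ> tlift4 C (tpow3 C) (\<lambda>x y z w. tens3 C x (amult C y z) w))"
  "linear_on (tpow4 C) base_field (tlift4 C base_field (\<lambda>x y z w. counit C x * \<omega> (tens3 C y z w)))"
  "linear_on (tpow4 C) base_field (tlift4 C base_field (\<lambda>x y z w. \<omega> (tens3 C x y z) * counit C w))"
  unfolding o_def
  by (intro linear_on_comp[OF lhom_linear[OF \<omega>] lhom_linear[OF tlift4_lhom[OF vsC is_vspace_vtensor]]]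
      lhom_linear[OF tlift4_lhom[OF vsC is_vspace_base_field]] copentagon_quadrilinear)+

text \<open>A coproduct in one slot of \<Phi> is dual to multiplying two adjacent arguments of
  \<omega>, and a tensor factor \<open>1\<close> is dual to applying the counit to the corresponding
  argument.\<close>

lemma tpair4_pentagon_factors:
  assumes u: "u \<in> car (tpow4 C)"
  defines "A4 \<equiv> A \<otimes>\<^sub>v A \<otimes>\<^sub>v A \<otimes>\<^sub>v A" and "C3 \<equiv> C \<otimes>\<^sub>v C \<otimes>\<^sub>v C"
  shows "tpair4 p (tlift3 A A4 (\<lambda>a b c. tlift A A A4 (\<lambda>c1 c2. tens4 A a b c1 c2) (comult A c)) \<Phi>) u
      = (\<omega> \<circ> tlift4 C C3 (\<lambda>x y z w. tens3 C x y (amult C z w))) u"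
    and "tpair4 p (tlift3 A A4 (\<lambda>a b c. tlift A A A4 (\<lambda>a1 a2. tens4 A a1 a2 b c) (comult A a)) \<Phi>) u
      = (\<omega> \<circ> tlift4 C C3 (\<lambda>x y z w. tens3 C (amult C x y) z w)) u"
    and "tpair4 p (tlift3 A A4 (\<lambda>a b c. tlift A A A4 (\<lambda>b1 b2. tens4 A a b1 b2 c) (comult A b)) \<Phi>) u
      = (\<omega> \<circ> tlift4 C C3 (\<lambda>x y z w. tens3 C x (amult C y z) w)) u"
    and "tpair4 p (tlift3 A A4 (\<lambda>a b c. tens4 A (aone A) a b c) \<Phi>) u
      = tlift4 C base_field (\<lambda>x y z w. counit C x * \<omega> (tens3 C y z w)) u"
    and "tpair4 p (tlift3 A A4 (\<lambda>a b c. tens4 A a b c (aone A)) \<Phi>) u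
      = tlift4 C base_field (\<lambda>x y z w. \<omega> (tens3 C x y z) * counit C w) u"
proof -
  note mem = bilinear_on_mem[OF prealgebraD(2)[OF preC]]
  note q = tlift4_tens4[OF vsC is_vspace_vtensor copentagon_quadrilinear(1)]
    tlift4_tens4[OF vsC is_vspace_vtensor copentagon_quadrilinear(2)]
    tlift4_tens4[OF vsC is_vspace_vtensor copentagon_quadrilinear(3)]
    tlift4_tens4[OF vsC is_vspace_base_field copentagon_quadrilinear(4)]
    tlift4_tens4[OF vsC is_vspace_base_field copentagon_quadrilinear(5)]
  note \<Delta>m = precoalgebraD(4)[OF coA]
  have split: "comult A a (\<lambda>a1 a2. k * (p a1 x * p a2 y)) = k * p a (amult C x y)"
    if "a \<in> car A" "x \<in> car C" "y \<in> car C" for a x y k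
    using that tensor_apply_mult[OF vsA vsA bilinear_on_product[OF bilinear_on_left[OF pb] bilinear_on_left[OF pb]] \<Delta>m]
    by (simp add: measuringD(2)[OF m2])
  have ap: "tpair4 p (tlift A A (tpow4 A) F (comult A a)) (tens4 C x y z w)
      = comult A a (\<lambda>a1 a2. tpair4 p (F a1 a2) (tens4 C x y z w))"
    if "bilinear_on A A (tpow4 A) F" "a \<in> car A" "x \<in> car C" "y \<in> car C" "z \<in> car C" "w \<in> car C"
    for F a x y z w
    by (rule tlift_apply[OF vsA vsA is_vspace_vtensor that(1) bilinear_on_left[OF p4 tens4_mem[OF that(3-)]] \<Delta>m[OF that(2)]])
  note cong = tensor_apply_cong[OF vsA vsA \<Delta>m]
  show "tpair4 p (tlift3 A A4 (\<lambda>a b c. tlift A A A4 (\<lambda>c1 c2. tens4 A a b c1 c2) (comult A c)) \<Phi>) u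
      = (\<omega> \<circ> tlift4 C C3 (\<lambda>x y z w. tens3 C x y (amult C z w))) u"
    unfolding A4_def C3_def
  proof (rule tpair4_tlift3[OF pentagon_trilinear(1) copentagon_linear(1) _ _ _ u,
        where k = "\<lambda>x y z w. 1" and K = "\<lambda>x y z w. tens3 C x y (amult C z w)"])
    fix a b c x y z w assume el: "a \<in> car A" "b \<in> car A" "c \<in> car A" "x \<in> car C" "y \<in> car C" "z \<in> car C" "w \<in> car C"
    have "comult A c (\<lambda>c1 c2. tpair4 p (tens4 A a b c1 c2) (tens4 C x y z w))
      = comult A c (\<lambda>c1 c2. (p a x * p b y) * (p c1 z * p c2 w))"
      by (rule cong[OF el(3)]) (simp add: tpair4_tens4[OF vsA vsC pb] el)
    then show "tpair4 p (tlift A A (tpow4 A) (\<lambda>c1 c2. tens4 A a b c1 c2) (comult A c)) (tens4 C x y z w)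
      = 1 * tpair3 p (tens3 A a b c) (tens3 C x y (amult C z w))"
      by (simp add: ap tens4_slices split el mem tpair3_tens3[OF vsA vsC pb])
  qed (simp_all add: tens3_mem mem q)
  show "tpair4 p (tlift3 A A4 (\<lambda>a b c. tlift A A A4 (\<lambda>a1 a2. tens4 A a1 a2 b c) (comult A a)) \<Phi>) u
      = (\<omega> \<circ> tlift4 C C3 (\<lambda>x y z w. tens3 C (amult C x y) z w)) u"
    unfolding A4_def C3_def
  proof (rule tpair4_tlift3[OF pentagon_trilinear(2) copentagon_linear(2) _ _ _ u,
        where k = "\<lambda>x y z w. 1" and K = "\<lambda>x y z w. tens3 C (amult C x y) z w"])
    fix a b c x y z w assume el: "a \<in> car A" "b \<in> car A" "c \<in> car A" "x \<in> car C" "y \<in> car C" "z \<in> car C" "w \<in> car C"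
    have "comult A a (\<lambda>c1 c2. tpair4 p (tens4 A c1 c2 b c) (tens4 C x y z w))
      = comult A a (\<lambda>c1 c2. (p b z * p c w) * (p c1 x * p c2 y))"
      by (rule cong[OF el(1)]) (simp add: tpair4_tens4[OF vsA vsC pb] el)
    then show "tpair4 p (tlift A A (tpow4 A) (\<lambda>a1 a2. tens4 A a1 a2 b c) (comult A a)) (tens4 C x y z w)
      = 1 * tpair3 p (tens3 A a b c) (tens3 C (amult C x y) z w)"
      by (simp add: ap tens4_slices split el mem tpair3_tens3[OF vsA vsC pb])
  qed (simp_all add: tens3_mem mem q)
  show "tpair4 p (tlift3 A A4 (\<lambda>a b c. tlift A A A4 (\<lambda>b1 b2. tens4 A a b1 b2 c) (comult A b)) \<Phi>) u
      = (\<omega> \<circ> tlift4 C C3 (\<lambda>x y z w. tens3 C x (amult C y z) w)) u"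
    unfolding A4_def C3_def
  proof (rule tpair4_tlift3[OF pentagon_trilinear(3) copentagon_linear(3) _ _ _ u,
        where k = "\<lambda>x y z w. 1" and K = "\<lambda>x y z w. tens3 C x (amult C y z) w"])
    fix a b c x y z w assume el: "a \<in> car A" "b \<in> car A" "c \<in> car A" "x \<in> car C" "y \<in> car C" "z \<in> car C" "w \<in> car C"
    have "comult A b (\<lambda>c1 c2. tpair4 p (tens4 A a c1 c2 c) (tens4 C x y z w))
      = comult A b (\<lambda>c1 c2. (p a x * p c w) * (p c1 y * p c2 z))"
      by (rule cong[OF el(2)]) (simp add: tpair4_tens4[OF vsA vsC pb] el)
    then show "tpair4 p (tlift A A (tpow4 A) (\<lambda>b1 b2. tens4 A a b1 b2 c) (comult A b)) (tens4 C x y z w)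
      = 1 * tpair3 p (tens3 A a b c) (tens3 C x (amult C y z) w)"
      by (simp add: ap tens4_slices split el mem tpair3_tens3[OF vsA vsC pb])
  qed (simp_all add: tens3_mem mem q)
  show "tpair4 p (tlift3 A A4 (\<lambda>a b c. tens4 A (aone A) a b c) \<Phi>) u
      = tlift4 C base_field (\<lambda>x y z w. counit C x * \<omega> (tens3 C y z w)) u"
    unfolding A4_def
    by (rule tpair4_tlift3[OF pentagon_trilinear(4) copentagon_linear(4) _ _ _ u,
          where k = "\<lambda>x y z w. counit C x" and K = "\<lambda>x y z w. tens3 C y z w"])
      (simp_all add: tens3_mem q tpair4_tens4[OF vsA vsC pb] tpair3_tens3[OF vsA vsC pb]
        prebialgebraD(12)[OF A] measuringD(3)[OF m1])
  show "tpair4 p (tlift3 A A4 (\<lambda>a b c. tens4 A a b c (aone A)) \<Phi>) u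
      = tlift4 C base_field (\<lambda>x y z w. \<omega> (tens3 C x y z) * counit C w) u"
    unfolding A4_def
    by (rule tpair4_tlift3[OF pentagon_trilinear(5) copentagon_linear(5) _ _ _ u,
          where k = "\<lambda>x y z w. counit C w" and K = "\<lambda>x y z w. tens3 C x y z"])
      (simp_all add: tens3_mem q tpair4_tens4[OF vsA vsC pb] tpair3_tens3[OF vsA vsC pb]
        prebialgebraD(12)[OF A] measuringD(3)[OF m1])
qed

text \<open>The pairing turns products in the fourth tensor power into convolutions in the same
  order, so the sides of the two pentagons match factor by factor. Nondegeneracy does not enter
  yet.\<close>

lemma pentagon_mem:
  "pentagon_lhs A \<Phi> \<in> car (tpow4 A)" "pentagon_rhs A \<Phi> \<in> car (tpow4 A)"
  and tpair4_pentagon: "u \<in> car (tpow4 C) \<Longrightarrow> tpair4 p (pentagon_lhs A \<Phi>) u = copentagon_lhs C \<omega> u"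
    "u \<in> car (tpow4 C) \<Longrightarrow> tpair4 p (pentagon_rhs A \<Phi>) u = copentagon_rhs C \<omega> u"
  and copentagon_lhom: "copentagon_lhs C \<omega> \<in> lhom (tpow4 C) base_field"
    "copentagon_rhs C \<omega> \<in> lhom (tpow4 C) base_field"
proof -
  note mem = linear_on_mem[OF tlift3_linear[OF vsA is_vspace_vtensor pentagon_trilinear(1)] \<Phi>]
    linear_on_mem[OF tlift3_linear[OF vsA is_vspace_vtensor pentagon_trilinear(2)] \<Phi>]
    linear_on_mem[OF tlift3_linear[OF vsA is_vspace_vtensor pentagon_trilinear(3)] \<Phi>]
    linear_on_mem[OF tlift3_linear[OF vsA is_vspace_vtensor pentagon_trilinear(4)] \<Phi>]
    linear_on_mem[OF tlift3_linear[OF vsA is_vspace_vtensor pentagon_trilinear(5)] \<Phi>]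
  note mm = bilinear_on_mem[OF prealgebraD(2)[OF pre4], simplified]
  note cl = conv_ground_lhom[OF co4, simplified]
  note mc = measuring_conv[OF co4 measuring4, simplified]
  note lin = copentagon_linear and fac = tpair4_pentagon_factors
  show "pentagon_lhs A \<Phi> \<in> car (tpow4 A)" "pentagon_rhs A \<Phi> \<in> car (tpow4 A)"
    unfolding pentagon_lhs_def pentagon_rhs_def Let_def by (simp_all add: mem mm)
  show "copentagon_lhs C \<omega> \<in> lhom (tpow4 C) base_field"
    using cl[OF lin(1,2)] by (simp add: copentagon_lhs_def Let_def)
  note inner = lhom_linear[OF cl[OF lin(4,3)]]
  show "copentagon_rhs C \<omega> \<in> lhom (tpow4 C) base_field"
    using cl[OF inner lin(5)] by (simp add: copentagon_rhs_def Let_def)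
  show "tpair4 p (pentagon_lhs A \<Phi>) u = copentagon_lhs C \<omega> u" if u: "u \<in> car (tpow4 C)"
    using mc[OF mem(1,2) lin(1) fac(1) lin(2) fac(2) u]
    by (simp add: pentagon_lhs_def copentagon_lhs_def Let_def o_def)
  show "tpair4 p (pentagon_rhs A \<Phi>) u = copentagon_rhs C \<omega> u" if u: "u \<in> car (tpow4 C)"
    using mc[OF mm[OF mem(4,3)] mem(5) inner mc[OF mem(4,3) lin(4) fac(4) lin(3) fac(3)] lin(5) fac(5) u]
    by (simp add: pentagon_rhs_def copentagon_rhs_def Let_def o_def)
qed

section \<open>Normalisation of the reassociator\<close>

lemma counit_slices_trilinear:
  "trilinear_on A (tpow2 A) (\<lambda>a b c. fscl (counit A a) (tens A A b c))"
  "trilinear_on A (tpow2 A) (\<lambda>a b c. fscl (counit A b) (tens A A a c))"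
  "trilinear_on A (tpow2 A) (\<lambda>a b c. fscl (counit A c) (tens A A a b))"
proof -
  note s = linear_on_scl[OF is_vspace_vtensor bilinear_on_left[OF tens_bilinear], simplified]
    linear_on_scl[OF is_vspace_vtensor bilinear_on_right[OF tens_bilinear], simplified]
    linear_on_scl_left[OF is_vspace_vtensor precoalgebraD(3)[OF coA], simplified]
  show "trilinear_on A (tpow2 A) (\<lambda>a b c. fscl (counit A a) (tens A A b c))"
    "trilinear_on A (tpow2 A) (\<lambda>a b c. fscl (counit A b) (tens A A a c))"
    "trilinear_on A (tpow2 A) (\<lambda>a b c. fscl (counit A c) (tens A A a b))"
    by (rule trilinear_onI; simp add: s tens_mem)+
qed

private lemmas counit_slices_mem =
  linear_on_mem[OF tlift3_linear[OF vsA is_vspace_vtensor counit_slices_trilinear(1)] \<Phi>]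
  linear_on_mem[OF tlift3_linear[OF vsA is_vspace_vtensor counit_slices_trilinear(2)] \<Phi>]
  linear_on_mem[OF tlift3_linear[OF vsA is_vspace_vtensor counit_slices_trilinear(3)] \<Phi>]

text \<open>The counit of \<open>A\<close> is the pairing with the unit of \<open>C\<close>, so
  applying it in one slot of \<Phi> amounts to placing \<open>1\<close> in that argument of
  \<omega>.\<close>

lemma tpair_counit_slices:
  assumes x: "x \<in> car C" and y: "y \<in> car C"
  shows "tpair p p (tlift3 A (tpow2 A) (\<lambda>a b c. fscl (counit A a) (tens A A b c)) \<Phi>) (tens C C x y)
      = \<omega> (tens3 C (aone C) x y)"
    and "tpair p p (tlift3 A (tpow2 A) (\<lambda>a b c. fscl (counit A b) (tens A A a c)) \<Phi>) (tens C C x y)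
      = \<omega> (tens3 C x (aone C) y)"
    and "tpair p p (tlift3 A (tpow2 A) (\<lambda>a b c. fscl (counit A c) (tens A A a b)) \<Phi>) (tens C C x y)
      = \<omega> (tens3 C x y (aone C))"
proof -
  note one = prebialgebraD(12)[OF C]
  have *: "tpair p p (tlift3 A (tpow2 A) G \<Phi>) (tens C C x y) = tpair3 p \<Phi> K"
    if G: "trilinear_on A (tpow2 A) G" and K: "K \<in> car (tpow3 C)"
      and eq: "\<And>a b c. a \<in> car A \<Longrightarrow> b \<in> car A \<Longrightarrow> c \<in> car A \<Longrightarrow>
        tpair p p (G a b c) (tens C C x y) = tpair3 p (tens3 A a b c) K" for G K
    by (rule tensor3_ext[OF vsA linear_on_comp[OF bilinear_on_left[OF tpair2_bilinear[OF vsA vsC pb] tens_mem[OF x y]]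
            tlift3_linear[OF vsA is_vspace_vtensor G]] bilinear_on_left[OF p3 K] _ \<Phi>])
      (simp add: tlift3_tens3[OF vsA is_vspace_vtensor G] eq)
  have sc: "tpair p p (fscl k (tens A A a b)) (tens C C x y) = k * (p a x * p b y)"
    if "a \<in> car A" "b \<in> car A" for a b k
    using linear_on_scale[OF bilinear_on_left[OF tpair2_bilinear[OF vsA vsC pb] tens_mem[OF x y]] tens_mem[OF that]]
    by (simp add: tpair_tens[OF vsA vsA vsC vsC pb pb] that x y)
  note simps = sc tpair3_tens3[OF vsA vsC pb] x y one measuringD(3)[OF m2]
  show "tpair p p (tlift3 A (tpow2 A) (\<lambda>a b c. fscl (counit A a) (tens A A b c)) \<Phi>) (tens C C x y)
      = \<omega> (tens3 C (aone C) x y)"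
    "tpair p p (tlift3 A (tpow2 A) (\<lambda>a b c. fscl (counit A b) (tens A A a c)) \<Phi>) (tens C C x y)
      = \<omega> (tens3 C x (aone C) y)"
    "tpair p p (tlift3 A (tpow2 A) (\<lambda>a b c. fscl (counit A c) (tens A A a b)) \<Phi>) (tens C C x y)
      = \<omega> (tens3 C x y (aone C))"
    using *[OF counit_slices_trilinear(1) tens3_mem[OF one x y]] *[OF counit_slices_trilinear(2) tens3_mem[OF x one y]]
      *[OF counit_slices_trilinear(3) tens3_mem[OF x y one]]
    by (simp_all add: simps \<Phi>\<omega> tens3_mem)
qed

lemma tpair_one: "x \<in> car C \<Longrightarrow> y \<in> car C \<Longrightarrow>
    tpair p p (tens A A (aone A) (aone A)) (tens C C x y) = counit C x * counit C y"
  by (simp add: tpair_tens[OF vsA vsA vsC vsC pb pb] prebialgebraD(12)[OF A] measuringD(3)[OF m1])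

section \<open>Quasi-coassociativity and quasi-associativity\<close>

lemma triple_product_trilinear:
  "trilinear_on C C (\<lambda>x y z. amult C (amult C x y) z)" "trilinear_on C C (\<lambda>x y z. amult C x (amult C y z))"
proof -
  note m = prealgebraD(2)[OF preC]
  note l = bilinear_on_left[OF m] bilinear_on_right[OF m] bilinear_on_mem[OF m]
    linear_on_comp[OF bilinear_on_left[OF m] bilinear_on_left[OF m]]
    linear_on_comp[OF bilinear_on_left[OF m] bilinear_on_right[OF m]]
    linear_on_comp[OF bilinear_on_right[OF m] bilinear_on_left[OF m]]
    linear_on_comp[OF bilinear_on_right[OF m] bilinear_on_right[OF m]]
  show "trilinear_on C C (\<lambda>x y z. amult C (amult C x y) z)" "trilinear_on C C (\<lambda>x y z. amult C x (amult C y z))"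
    by (rule trilinear_onI; simp add: l)+
qed

private lemmas triple_product_lin = tlift3_linear[OF vsC vsC triple_product_trilinear(1)]
  tlift3_linear[OF vsC vsC triple_product_trilinear(2)]

lemma ulin_omega_linear: "linear_on (tpow3 C) C (ulin C \<circ> \<omega>)"
  unfolding o_def ulin_def by (intro linear_on_scl_left vsC lhom_linear[OF \<omega>] prebialgebraD(12)[OF C])

lemma quasi_assoc_lhom:
  "conv (bpow3 C) C (ulin C \<circ> \<omega>) (tlift3 C C (\<lambda>x y z. amult C (amult C x y) z)) \<in> lhom (tpow3 C) C"
  "conv (bpow3 C) C (tlift3 C C (\<lambda>x y z. amult C x (amult C y z))) (ulin C \<circ> \<omega>) \<in> lhom (tpow3 C) C"
  using conv_lhom[OF co3 preC, of "ulin C \<circ> \<omega>"] conv_lhom[OF co3 preC, of _ "ulin C \<circ> \<omega>"]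
    ulin_omega_linear triple_product_lin by simp_all

lemma comult_left_right_mem:
  "a \<in> car A \<Longrightarrow> comult_left A (comult A a) \<in> car (tpow3 A)"
  "a \<in> car A \<Longrightarrow> comult_right A (comult A a) \<in> car (tpow3 A)"
  by (rule linear_on_mem[OF comult_left_linear[OF coA] precoalgebraD(4)[OF coA]]
      linear_on_mem[OF comult_right_linear[OF coA] precoalgebraD(4)[OF coA]]; assumption)+

text \<open>The axiom for \<omega> takes values in \<open>C\<close>, so it is seen only through the
  functionals \<open>p a\<close>. Under them the iterated coproduct of \<open>a\<close> becomes a
  triple product, and \<Phi> becomes \<omega>, embedded into \<open>C\<close> as multiples of the
  unit.\<close>

lemma tpair3_quasi_assoc:
  assumes a: "a \<in> car A" and u: "u \<in> car (tpow3 C)"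
  shows "tpair3 p (amult (bpow3 A) \<Phi> (comult_left A (comult A a))) u
      = p a (conv (bpow3 C) C (ulin C \<circ> \<omega>) (tlift3 C C (\<lambda>x y z. amult C (amult C x y) z)) u)"
    and "tpair3 p (amult (bpow3 A) (comult_right A (comult A a)) \<Phi>) u
      = p a (conv (bpow3 C) C (tlift3 C C (\<lambda>x y z. amult C x (amult C y z))) (ulin C \<circ> \<omega>) u)"
proof -
  let ?C3 = "C \<otimes>\<^sub>v C \<otimes>\<^sub>v C"
  let ?L = "tlift3 C C (\<lambda>x y z. amult C (amult C x y) z)" and ?R = "tlift3 C C (\<lambda>x y z. amult C x (amult C y z))"
  note m = prealgebraD(2)[OF preC]
  note pa = bilinear_on_right[OF pb a]
  have tri: "tpair3 p (comult_left A (comult A a)) v = p a (?L v)"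
    "tpair3 p (comult_right A (comult A a)) v = p a (?R v)" if v: "v \<in> car ?C3" for v
    by (rule tensor3_ext[OF vsC bilinear_on_right[OF p3 comult_left_right_mem(1)[OF a]]
          linear_on_comp[OF pa triple_product_lin(1)] _ v],
        simp add: tpair3_comult_left_right[OF A C p a] tlift3_tens3[OF vsC vsC triple_product_trilinear(1)],
        rule tensor3_ext[OF vsC bilinear_on_right[OF p3 comult_left_right_mem(2)[OF a]]
          linear_on_comp[OF pa triple_product_lin(2)] _ v],
        simp add: tpair3_comult_left_right[OF A C p a] tlift3_tens3[OF vsC vsC triple_product_trilinear(2)])
  \<comment> \<open>Multiplying by a multiple of the unit is scaling, which turns the
    \<open>C\<close>-valued convolution back into a scalar one.\<close>
  have sc: "p a (amult C (ulin C k) x) = k * p a x" "p a (amult C x (ulin C k)) = p a x * k" if "x \<in> car C" for k x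
    using that linear_on_scale[OF bilinear_on_left[OF m that] prebialgebraD(12)[OF C], of k]
      linear_on_scale[OF bilinear_on_right[OF m that] prebialgebraD(12)[OF C], of k]
      linear_on_scale[OF pa that, of k] prebialgebraD(10,11)[OF C that]
    by (simp_all add: ulin_def mult.commute)
  have \<Delta>u: "comult (bpow3 C) u \<in> car (?C3 \<otimes>\<^sub>v ?C3)"
    using precoalgebraD(4)[OF co3] u by simp
  note mult = measuringD(2)[OF measuring3, simplified]
  note cv = conv_apply(1)[OF co3 preC _ _ pa, simplified]
  note cong = tensor_apply_cong[OF is_vspace_vtensor is_vspace_vtensor \<Delta>u]
  show "tpair3 p (amult (bpow3 A) \<Phi> (comult_left A (comult A a))) u
      = p a (conv (bpow3 C) C (ulin C \<circ> \<omega>) ?L u)"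
    unfolding mult[OF \<Phi> comult_left_right_mem(1)[OF a] u] cv[OF ulin_omega_linear triple_product_lin(1) u]
    by (rule cong) (simp add: tri \<Phi>\<omega> sc linear_on_mem[OF triple_product_lin(1)])
  show "tpair3 p (amult (bpow3 A) (comult_right A (comult A a)) \<Phi>) u
      = p a (conv (bpow3 C) C ?R (ulin C \<circ> \<omega>) u)"
    unfolding mult[OF comult_left_right_mem(2)[OF a] \<Phi> u] cv[OF triple_product_lin(2) ulin_omega_linear u]
    by (rule cong) (simp add: tri \<Phi>\<omega> sc linear_on_mem[OF triple_product_lin(2)])
qed

section \<open>Transfer of the axioms in both directions\<close>

text \<open>Invertibility, pentagon and normalisation concern functionals on tensor powers of
  \<open>C\<close>, and evaluation decides them. Separation of \<open>C\<close> by \<open>A\<close>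
  is used for quasi-associativity, whose two sides are elements of \<open>C\<close>.\<close>

lemma DQBialg_if_QBialg:
  assumes Q: "(A, \<Phi>) \<in> QBialg" and C': "C \<in> NAlgCoalg" and nd: "nondegenerate C A (\<lambda>x a. p a x)"
  shows "(C, \<omega>) \<in> DQBialg"
proof -
  let ?C3 = "C \<otimes>\<^sub>b C \<otimes>\<^sub>b C" and ?A3 = "A \<otimes>\<^sub>b A \<otimes>\<^sub>b A"
  have inv: "invertible_in ?A3 \<Phi>" and pent: "pentagon_lhs A \<Phi> = pentagon_rhs A \<Phi>"
    and cu: "tlift3 A (tpow2 A) (\<lambda>a b c. fscl (counit A a) (tens A A b c)) \<Phi> = tens A A (aone A) (aone A)"
      "tlift3 A (tpow2 A) (\<lambda>a b c. fscl (counit A b) (tens A A a c)) \<Phi> = tens A A (aone A) (aone A)"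
      "tlift3 A (tpow2 A) (\<lambda>a b c. fscl (counit A c) (tens A A a b)) \<Phi> = tens A A (aone A) (aone A)"
    and qa: "\<And>a. a \<in> car A \<Longrightarrow> amult ?A3 \<Phi> (comult_left A (comult A a)) = amult ?A3 (comult_right A (comult A a)) \<Phi>"
    using Q by (auto simp: QBialg_def pentagon_lhs_def pentagon_rhs_def Let_def)
  obtain \<Psi> where \<Psi>: "\<Psi> \<in> car (tpow3 A)" "amult ?A3 \<Phi> \<Psi> = aone ?A3" "amult ?A3 \<Psi> \<Phi> = aone ?A3"
    using inv unfolding invertible_in_def by auto
  \<comment> \<open>The convolution inverse of \<omega> is the pairing with the inverse of \<Phi>,
    cut off outside the carrier to be a normalised functional.\<close>
  define \<psi> where "\<psi> u = (if u \<in> car (tpow3 C) then tpair3 p \<Psi> u else 0)" for u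
  have \<psi>: "\<psi> \<in> lhom (tpow3 C) base_field"
    using bilinear_on_right[OF p3 \<Psi>(1)] linear_on_cong[of "C \<otimes>\<^sub>v C \<otimes>\<^sub>v C" \<psi> "tpair3 p \<Psi>" base_field]
    by (simp add: lhom_def \<psi>_def)
  note mc = measuring_conv[OF co3 measuring3, simplified]
  have \<epsilon>: "counit ?C3 \<in> lhom (tpow3 C) base_field"
    using co3 by (simp add: precoalgebra_def)
  note cl = conv_ground_lhom[OF co3, simplified]
  have one: "tpair3 p (aone ?A3) u = counit ?C3 u" if "u \<in> car (tpow3 C)" for u
    using measuringD(3)[OF measuring3, of u] that by simp
  have "conv ?C3 ground \<omega> \<psi> = counit ?C3"
  proof (rule lhom_eqI[OF cl[OF lhom_linear[OF \<omega>] lhom_linear[OF \<psi>]] \<epsilon>])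
    fix u assume u: "u \<in> car (tpow3 C)"
    have "tpair3 p (amult ?A3 \<Phi> \<Psi>) u = conv ?C3 ground \<omega> \<psi> u"
      by (rule mc[OF \<Phi> \<Psi>(1) lhom_linear[OF \<omega>] \<Phi>\<omega> lhom_linear[OF \<psi>] _ u]) (simp_all add: \<psi>_def)
    then show "conv ?C3 ground \<omega> \<psi> u = counit ?C3 u" unfolding \<Psi> one[OF u] by (rule sym)
  qed
  moreover have "conv ?C3 ground \<psi> \<omega> = counit ?C3"
  proof (rule lhom_eqI[OF cl[OF lhom_linear[OF \<psi>] lhom_linear[OF \<omega>]] \<epsilon>])
    fix u assume u: "u \<in> car (tpow3 C)"
    have "tpair3 p (amult ?A3 \<Psi> \<Phi>) u = conv ?C3 ground \<psi> \<omega> u"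
      by (rule mc[OF \<Psi>(1) \<Phi> lhom_linear[OF \<psi>] _ lhom_linear[OF \<omega>] \<Phi>\<omega> u]) (simp_all add: \<psi>_def)
    then show "conv ?C3 ground \<psi> \<omega> u = counit ?C3 u" unfolding \<Psi> one[OF u] by (rule sym)
  qed
  ultimately have cinv: "conv_invertible ?C3 \<omega>"
    using \<psi> \<omega> by (auto simp: conv_invertible_def)
  have copent: "copentagon_lhs C \<omega> = copentagon_rhs C \<omega>"
    by (rule lhom_eqI[OF copentagon_lhom]) (simp add: tpair4_pentagon[symmetric] pent)
  \<comment> \<open>One counit axiom for \<Phi> answers each possible position of the unit among
    \<open>h\<close>, \<open>k\<close> and \<open>l\<close>.\<close>
  have norm: "\<omega> (tens3 C h k l) = counit C h * counit C k * counit C l"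
    if "h \<in> car C" "k \<in> car C" "l \<in> car C" "aone C \<in> {h, k, l}" for h k l
    using that tpair_counit_slices(1)[of k l] tpair_counit_slices(2)[of h l] tpair_counit_slices(3)[of h k]
    unfolding cu by (auto simp: tpair_one prebialgebraD(9)[OF C])
  have "conv ?C3 C (ulin C \<circ> \<omega>) (tlift3 C C (\<lambda>x y z. amult C (amult C x y) z))
    = conv ?C3 C (tlift3 C C (\<lambda>x y z. amult C x (amult C y z))) (ulin C \<circ> \<omega>)"
  proof (rule lhom_eqI[OF quasi_assoc_lhom])
    fix u assume u: "u \<in> car (tpow3 C)"
    show "conv ?C3 C (ulin C \<circ> \<omega>) (tlift3 C C (\<lambda>x y z. amult C (amult C x y) z)) u
      = conv ?C3 C (tlift3 C C (\<lambda>x y z. amult C x (amult C y z))) (ulin C \<circ> \<omega>) u"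
      by (rule nondegenerate_eqI[OF nd measuringD(1)[OF m2] vsC linear_on_mem[OF lhom_linear[OF quasi_assoc_lhom(1)] u]
            linear_on_mem[OF lhom_linear[OF quasi_assoc_lhom(2)] u]])
        (simp only: tpair3_quasi_assoc[OF _ u, symmetric] qa)
  qed
  with cinv copent norm C' show ?thesis
    by (simp add: DQBialg_def copentagon_lhs_def copentagon_rhs_def Let_def)
qed

text \<open>Here both sides of each equation are tensors over \<open>A\<close>, and separation by
  tensor powers of \<open>C\<close> reduces them to the axioms for \<omega>. The inverse of \<Phi>
  has to be supplied, because the convolution inverse of \<omega> comes with no tensor over
  \<open>A\<close> that represents it.\<close>

lemma QBialg_if_DQBialg:
  assumes Q: "(C, \<omega>) \<in> DQBialg" and A': "A \<in> NCoalgAlg" and nd: "nondegenerate A C p"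
    and inv: "invertible_in (bpow3 A) \<Phi>"
  shows "(A, \<Phi>) \<in> QBialg"
proof -
  let ?C3 = "C \<otimes>\<^sub>b C \<otimes>\<^sub>b C" and ?A3 = "A \<otimes>\<^sub>b A \<otimes>\<^sub>b A"
  have copent: "copentagon_lhs C \<omega> = copentagon_rhs C \<omega>"
    and norm: "\<And>h k l. h \<in> car C \<Longrightarrow> k \<in> car C \<Longrightarrow> l \<in> car C \<Longrightarrow> aone C \<in> {h, k, l} \<Longrightarrow>
      \<omega> (tens3 C h k l) = counit C h * counit C k * counit C l"
    and qa: "conv ?C3 C (ulin C \<circ> \<omega>) (tlift3 C C (\<lambda>x y z. amult C (amult C x y) z))
      = conv ?C3 C (tlift3 C C (\<lambda>x y z. amult C x (amult C y z))) (ulin C \<circ> \<omega>)"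
    using Q by (auto simp: DQBialg_def copentagon_lhs_def copentagon_rhs_def Let_def)
  have pent: "pentagon_lhs A \<Phi> = pentagon_rhs A \<Phi>"
    by (rule tensor4_eqI[OF vsA vsC pb nd pentagon_mem]) (simp add: tpair4_pentagon copent)
  have one: "tens A A (aone A) (aone A) \<in> car (tpow2 A)" by (simp add: tens_mem prebialgebraD(12)[OF A])
  have cu: "tlift3 A (tpow2 A) (\<lambda>a b c. fscl (counit A a) (tens A A b c)) \<Phi> = tens A A (aone A) (aone A)"
      "tlift3 A (tpow2 A) (\<lambda>a b c. fscl (counit A b) (tens A A a c)) \<Phi> = tens A A (aone A) (aone A)"
      "tlift3 A (tpow2 A) (\<lambda>a b c. fscl (counit A c) (tens A A a b)) \<Phi> = tens A A (aone A) (aone A)"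
    by (rule tensor2_eqI[OF vsA vsC pb nd counit_slices_mem(1) one]
        tensor2_eqI[OF vsA vsC pb nd counit_slices_mem(2) one]
        tensor2_eqI[OF vsA vsC pb nd counit_slices_mem(3) one];
      simp add: tpair_counit_slices tpair_one norm prebialgebraD(9,12)[OF C])+
  note mm = bilinear_on_mem[OF prealgebraD(2)[OF pre3], simplified]
  have "amult ?A3 \<Phi> (comult_left A (comult A a)) = amult ?A3 (comult_right A (comult A a)) \<Phi>"
    if a: "a \<in> car A" for a
    by (rule tensor3_eqI[OF vsA vsC pb nd mm[OF \<Phi> comult_left_right_mem(1)[OF a]]
          mm[OF comult_left_right_mem(2)[OF a] \<Phi>]])
      (simp only: tpair3_quasi_assoc[OF a tens3_mem] qa)
  with pent cu inv A' show ?thesis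
    by (simp add: QBialg_def pentagon_lhs_def pentagon_rhs_def Let_def)
qed

end


section \<open>The induced adjunction\<close>

context
  fixes U :: "('k::field, 'a::ab_group_add) bistruct"
  assumes U: "prebialgebra U"
begin

private lemmas preU = prebialgebraD(3)[OF U]
private lemmas vsU = prebialgebraD(5)[OF U]
private lemmas vsD = is_vspace_bullet[OF preU]
private lemmas ab = app_bullet(1)[OF preU]
private lemmas ba = measuringD(1)[OF conjunct1[OF bipairing_flip[OF bipairing_app[OF U], unfolded bipairing_def]]]

section \<open>Reassociators of dual objects and splitness\<close>

lemma triple_product_form:
  assumes "f \<in> car (bullet U)" "g \<in> car (bullet U)" "h \<in> car (bullet U)"
  shows "trilinear_on U base_field (\<lambda>x y z. f x * g y * h z)"
    and "u \<in> car (tpow3 U) \<Longrightarrow>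
      tlift3 U base_field (\<lambda>x y z. f x * g y * h z) u = tpair3 app (tens3 (bullet U) f g h) u"
    and "u \<in> car (tpow3 U) \<Longrightarrow>
      tlift3 U base_field (\<lambda>x y z. f x * g y * h z) u = tpair3 (\<lambda>x f. f x) u (tens3 (bullet U) f g h)"
proof -
  show tri: "trilinear_on U base_field (\<lambda>x y z. f x * g y * h z)"
    by (intro trilinear_onI linear_on_mult_left linear_on_mult_right bullet_linear[OF preU] assms)
  note lin = tlift3_linear[OF vsU is_vspace_base_field tri]
  show "tlift3 U base_field (\<lambda>x y z. f x * g y * h z) u = tpair3 app (tens3 (bullet U) f g h) u"
    if "u \<in> car (tpow3 U)"
    by (rule tensor3_ext[OF vsU lin bilinear_on_right[OF tpair3_bilinear[OF vsD vsU ab] tens3_mem[OF assms]] _ that])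
      (simp add: tlift3_tens3[OF vsU is_vspace_base_field tri] tpair3_tens3[OF vsD vsU ab] assms)
  show "tlift3 U base_field (\<lambda>x y z. f x * g y * h z) u = tpair3 (\<lambda>x f. f x) u (tens3 (bullet U) f g h)"
    if "u \<in> car (tpow3 U)"
    by (rule tensor3_ext[OF vsU lin bilinear_on_left[OF tpair3_bilinear[OF vsU vsD ba] tens3_mem[OF assms]] _ that])
      (simp add: tlift3_tens3[OF vsU is_vspace_base_field tri] tpair3_tens3[OF vsU vsD ba] assms)
qed

text \<open>Brings the reassociator of \<open>QBialg_circ\<close> into the form required for the
  transfer: a normalised functional that is the pairing with \<Phi>.\<close>

lemma
  assumes \<Phi>: "\<Phi> \<in> car (tpow3 U)"
  shows QBialg_circ_lhom: "snd (QBialg_circ (U, \<Phi>)) \<in> lhom (tpow3 (bullet U)) base_field"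
    and QBialg_circ_apply: "u \<in> car (tpow3 (bullet U)) \<Longrightarrow>
      tpair3 (\<lambda>x f. f x) \<Phi> u = snd (QBialg_circ (U, \<Phi>)) u"
proof -
  let ?D = "bullet U"
  note b = bilinear_on_right[OF tpair3_bilinear[OF vsU vsD ba] \<Phi>]
  note tri = trilinear_on_comp[OF tens3_trilinear b]
  have eq: "snd (QBialg_circ (U, \<Phi>)) = tlift3 ?D base_field (\<lambda>f g h. tpair3 (\<lambda>x f. f x) \<Phi> (tens3 ?D f g h))"
    by (simp add: QBialg_circ_def triple_product_form(3)[OF _ _ _ \<Phi>] cong: tlift3_cong)
  show "snd (QBialg_circ (U, \<Phi>)) \<in> lhom (tpow3 ?D) base_field"
    unfolding eq by (rule tlift3_lhom[OF vsD is_vspace_base_field tri])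
  show "tpair3 (\<lambda>x f. f x) \<Phi> u = snd (QBialg_circ (U, \<Phi>)) u" if u: "u \<in> car (tpow3 ?D)"
    unfolding eq
    by (rule tensor3_ext[OF vsD b tlift3_linear[OF vsD is_vspace_base_field tri] _ u])
      (simp add: tlift3_tens3[OF vsD is_vspace_base_field tri])
qed

text \<open>\<zeta> is the tensor pairing induced by evaluation, with value \<open>0\<close> off the
  carrier. Its injectivity is then nondegeneracy of the third tensor power.\<close>

lemma zeta_eq:
  assumes t: "t \<in> car (tpow3 (bullet U))"
  shows "zeta U t = (\<lambda>u. if u \<in> car (tpow3 U) then tpair3 app t u else 0)"
proof -
  let ?D = "bullet U" and ?V = "dual (tpow3 U)"
  define R where "R s = (\<lambda>u. if u \<in> car (tpow3 U) then tpair3 app s u else 0)" for s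
  note pb = tpair3_bilinear[OF vsD vsU ab]
  have R: "linear_on (tpow3 ?D) ?V R"
  proof (rule linear_onI)
    fix s assume s: "s \<in> car (tpow3 ?D)"
    show "R s \<in> car ?V"
      using bilinear_on_right[OF pb s] linear_on_cong[OF _ is_vspace_vtensor,
          of "U \<otimes>\<^sub>v U" U "R s" "tpair3 app s" base_field]
      by (simp add: lhom_def R_def)
  qed (auto simp: R_def fun_eq_iff linear_on_add[OF bilinear_on_left[OF pb]]
      linear_on_scale[OF bilinear_on_left[OF pb], simplified])
  note tri = trilinear_on_comp[OF tens3_trilinear R]
  have "tlift3 U base_field (\<lambda>x y z. f x * g y * h z) = R (tens3 ?D f g h)"
    if "f \<in> car ?D" "g \<in> car ?D" "h \<in> car ?D" for f g h
    using lhom_outside[OF tlift3_lhom[OF vsU is_vspace_base_field triple_product_form(1)[OF that]]]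
    by (auto simp: R_def fun_eq_iff triple_product_form(2)[OF that])
  then have "zeta U = tlift3 ?D ?V (\<lambda>f g h. R (tens3 ?D f g h))"
    unfolding zeta_def by (rule tlift3_cong)
  then have "zeta U t = tlift3 ?D ?V (\<lambda>f g h. R (tens3 ?D f g h)) t" by simp
  also have "\<dots> = R t"
    by (rule tensor3_ext[OF vsD tlift3_linear[OF vsD is_vspace_dual tri] R _ t])
      (simp add: tlift3_tens3[OF vsD is_vspace_dual tri])
  finally show ?thesis by (simp add: R_def)
qed

lemma splits_iff:
  assumes \<omega>: "\<omega> \<in> lhom (tpow3 U) base_field"
  shows "splits U \<omega> \<Phi> \<longleftrightarrow> invertible_in (bpow3 (bullet U)) \<Phi> \<and>
    (\<forall>u\<in>car (tpow3 U). tpair3 app \<Phi> u = \<omega> u)"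
proof -
  have "(\<lambda>u. if u \<in> car (tpow3 U) then F u else 0) = \<omega> \<longleftrightarrow> (\<forall>u\<in>car (tpow3 U). F u = \<omega> u)" for F
    using lhom_outside[OF \<omega>] unfolding fun_eq_iff by metis
  then show ?thesis by (auto simp: splits_def invertible_in_def zeta_eq)
qed

text \<open>Injectivity of \<zeta>. It turns the definite description in
  \<open>SDQBialg_bullet\<close> into any chosen witness of splitness.\<close>

lemma splits_unique:
  assumes "splits U \<omega> \<Phi>" "splits U \<omega> \<Psi>"
  shows "\<Phi> = \<Psi>"
proof -
  have mem: "\<Phi> \<in> car (tpow3 (bullet U))" "\<Psi> \<in> car (tpow3 (bullet U))"
    using assms by (simp_all add: splits_def invertible_in_def)
  have "zeta U \<Phi> = zeta U \<Psi>" using assms by (simp add: splits_def)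
  then have "tpair3 app \<Phi> u = tpair3 app \<Psi> u" if "u \<in> car (tpow3 U)" for u
    using that by (simp add: zeta_eq mem fun_eq_iff) metis
  then show ?thesis
    by (intro tensor3_eqI[OF vsD vsU ab app_bullet(2)[OF preU] mem]) (simp add: tens3_mem)
qed

end

lemma QBialgD:
  assumes "(H, \<Phi>) \<in> QBialg"
  shows "H \<in> NCoalgAlg" "prebialgebra H" "\<Phi> \<in> car (tpow3 H)" "invertible_in (bpow3 H) \<Phi>"
  using assms by (auto simp: QBialg_def NCoalgAlg_iff invertible_in_def Let_def)

lemma DQBialgD:
  assumes "(U, \<omega>) \<in> DQBialg"
  shows "U \<in> NAlgCoalg" "prebialgebra U" "\<omega> \<in> lhom (tpow3 U) base_field"
  using assms by (auto simp: DQBialg_def NAlgCoalg_iff conv_invertible_def Let_def)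

lemma SDQBialgE:
  assumes "(U, \<omega>) \<in> SDQBialg"
  obtains \<Phi> where "(U, \<omega>) \<in> DQBialg" "SDQBialg_bullet (U, \<omega>) = (bullet U, \<Phi>)"
    "\<Phi> \<in> car (tpow3 (bullet U))" "invertible_in (bpow3 (bullet U)) \<Phi>"
    "\<forall>u\<in>car (tpow3 U). tpair3 app \<Phi> u = \<omega> u"
proof -
  from assms obtain \<Phi> where D: "(U, \<omega>) \<in> DQBialg" and s: "splits U \<omega> \<Phi>" by (auto simp: SDQBialg_def)
  have "(THE \<Phi>. splits U \<omega> \<Phi>) = \<Phi>"
    by (rule the_equality[where P = "splits U \<omega>", OF s]) (rule splits_unique[OF DQBialgD(2)[OF D] _ s])
  then have eq: "SDQBialg_bullet (U, \<omega>) = (bullet U, \<Phi>)" by (simp add: SDQBialg_bullet_def)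
  have inv: "invertible_in (bpow3 (bullet U)) \<Phi>"
    and ev: "\<forall>u\<in>car (tpow3 U). tpair3 app \<Phi> u = \<omega> u"
    using s unfolding splits_iff[OF DQBialgD(2,3)[OF D]] by blast+
  have "\<Phi> \<in> car (tpow3 (bullet U))" using inv by (simp add: invertible_in_def)
  from that[OF D eq this inv ev] show thesis .
qed

text \<open>The splitting tensor is the image of \<Phi> under the third tensor power of the unit
  \<xi>. Pairing \<xi> of \<open>a\<close> with \<open>f\<close> gives \<open>f a\<close>, so this
  image represents \<omega>, and the image of the inverse of \<Phi> is its inverse.\<close>

lemma QBialg_circ_SDQBialg:
  assumes "(H, \<Phi>) \<in> QBialg"
  shows "QBialg_circ (H, \<Phi>) \<in> SDQBialg"
proof -
  note H = QBialgD[OF assms]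
  let ?C = "bullet H" and ?q = "\<lambda>x f. f x"
  define \<omega> where "\<omega> = snd (QBialg_circ (H, \<Phi>))"
  have QC: "QBialg_circ (H, \<Phi>) = (?C, \<omega>)" by (simp add: \<omega>_def QBialg_circ_def)
  note pre = prebialgebraD(3)[OF H(2)] and C = prebialgebra_bullet[OF H(2)]
  note vsH = prebialgebraD(5)[OF H(2)] and vsC = prebialgebraD(5)[OF C] and preC = prebialgebraD(3)[OF C]
    and coC = prebialgebraD(4)[OF C]
  have \<omega>: "\<omega> \<in> lhom (tpow3 ?C) base_field"
    "\<And>u. u \<in> car (tpow3 ?C) \<Longrightarrow> tpair3 ?q \<Phi> u = \<omega> u"
    unfolding \<omega>_def by (rule QBialg_circ_lhom[OF H(2,3)], rule QBialg_circ_apply[OF H(2,3)])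
  note bp = bipairing_flip[OF bipairing_app[OF H(2)]]
  have "(?C, \<omega>) \<in> DQBialg"
    by (rule DQBialg_if_QBialg[OF H(2) C bp H(3) \<omega> assms bullet_NAlgCoalg[OF H(1)] app_bullet(2)[OF pre]])
  moreover have "splits ?C \<omega> (tmap3 H (bullet ?C) (evaluation H) \<Phi>)"
    unfolding splits_iff[OF C \<omega>(1)]
  proof
    let ?B = "bullet ?C" and ?\<xi> = "evaluation H"
    have B: "prebialgebra ?B" by (rule prebialgebra_bullet[OF C])
    note preB = prebialgebraD(3)[OF B] and vsB = prebialgebraD(5)[OF B]
    have lin: "linear_on H ?B ?\<xi>"
      using evaluation_bihom[OF H(2)] by (simp add: bihom_def algebra_hom_def lhom_def)
    note ab = app_bullet[OF preC]
    note mem = linear_on_mem[OF lhom_linear[OF tmap3_lhom[OF vsH vsB lin]]]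
    have tp: "tpair3 app (tmap3 H ?B ?\<xi> t) u = tpair3 ?q t u"
      if "t \<in> car (tpow3 H)" "u \<in> car (tpow3 ?C)" for t u
      unfolding tpair3_tmap3_left[OF vsH vsB lin vsC that ab(1)]
      by (rule tpair3_cong[OF vsH vsC that]) (simp add: evaluation_def)
    show "\<forall>u\<in>car (tpow3 ?C). tpair3 app (tmap3 H ?B ?\<xi> \<Phi>) u = \<omega> u"
      by (simp add: tp H(3) \<omega>(2))
    let ?B3 = "?B \<otimes>\<^sub>b ?B \<otimes>\<^sub>b ?B" and ?C3 = "?C \<otimes>\<^sub>b ?C \<otimes>\<^sub>b ?C" and ?H3 = "H \<otimes>\<^sub>b H \<otimes>\<^sub>b H"
    note mB = measuring_btensor[OF prealgebra_btensor[OF preB preB] preB precoalgebra_btensor[OF coC coC] coC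
        measuring_btensor[OF preB preB coC coC measuring_bullet[OF C] measuring_bullet[OF C]] measuring_bullet[OF C]]
    have mq: "measuring H ?C ?q" using bp by (simp add: bipairing_def)
    note mH = measuring_btensor[OF prealgebra_btensor[OF pre pre] pre precoalgebra_btensor[OF coC coC] coC
        measuring_btensor[OF pre pre coC coC mq mq] mq]
    note co3 = precoalgebra_btensor[OF precoalgebra_btensor[OF coC coC] coC]
    note cong = tensor_apply_cong[OF is_vspace_vtensor is_vspace_vtensor precoalgebraD(4)[OF co3, simplified]]
    note pB3 = prealgebra_btensor[OF prealgebra_btensor[OF preB preB] preB]
    note mm = bilinear_on_mem[OF prealgebraD(2)[OF pB3], simplified]
    \<comment> \<open>Tensors over the double dual are separated by tensors over \<open>?C\<close>.
      After pairing, the product on either side is the same convolution, so the relation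
      \<open>s t = 1\<close> in the third tensor power of \<open>H\<close> carries over.\<close>
    have prod: "amult ?B3 (tmap3 H ?B ?\<xi> s) (tmap3 H ?B ?\<xi> t) = aone ?B3"
      if s: "s \<in> car (tpow3 H)" and t: "t \<in> car (tpow3 H)" and one: "amult ?H3 s t = aone ?H3" for s t
    proof (rule tensor3_eqI[OF vsB vsC ab mm[OF mem[OF s] mem[OF t]]])
      show "aone ?B3 \<in> car (tpow3 ?B)" using prealgebraD(3)[OF pB3] by simp
      fix x y z assume "x \<in> car ?C" "y \<in> car ?C" "z \<in> car ?C"
      then have u: "tens3 ?C x y z \<in> car (tpow3 ?C)" by (rule tens3_mem)
      have "tpair3 app (amult ?B3 (tmap3 H ?B ?\<xi> s) (tmap3 H ?B ?\<xi> t)) (tens3 ?C x y z)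
        = comult ?C3 (tens3 ?C x y z) (\<lambda>v w. tpair3 app (tmap3 H ?B ?\<xi> s) v * tpair3 app (tmap3 H ?B ?\<xi> t) w)"
        using measuringD(2)[OF mB, simplified, OF mem[OF s] mem[OF t] u] .
      also have "\<dots> = comult ?C3 (tens3 ?C x y z) (\<lambda>v w. tpair3 ?q s v * tpair3 ?q t w)"
        by (rule cong[OF u]) (simp add: tp s t)
      also have "\<dots> = tpair3 ?q (amult ?H3 s t) (tens3 ?C x y z)"
        using measuringD(2)[OF mH, simplified, OF s t u] by (rule sym)
      also have "\<dots> = counit ?C3 (tens3 ?C x y z)"
        unfolding one using measuringD(3)[OF mH] u by simp
      also have "\<dots> = tpair3 app (aone ?B3) (tens3 ?C x y z)"
        using measuringD(3)[OF mB] u by simp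
      finally show "tpair3 app (amult ?B3 (tmap3 H ?B ?\<xi> s) (tmap3 H ?B ?\<xi> t)) (tens3 ?C x y z)
        = tpair3 app (aone ?B3) (tens3 ?C x y z)" .
    qed
    from H(4) obtain \<Psi> where "\<Psi> \<in> car (tpow3 H)" "amult ?H3 \<Phi> \<Psi> = aone ?H3" "amult ?H3 \<Psi> \<Phi> = aone ?H3"
      unfolding invertible_in_def by auto
    then show "invertible_in ?B3 (tmap3 H ?B ?\<xi> \<Phi>)"
      unfolding invertible_in_def using prod H(3) mem by auto
  qed
  ultimately show ?thesis unfolding QC SDQBialg_def by blast
qed

lemma SDQBialg_bullet_QBialg:
  assumes "(U, \<omega>) \<in> SDQBialg"
  shows "SDQBialg_bullet (U, \<omega>) \<in> QBialg"
proof -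
  from assms obtain \<Phi> where \<Phi>: "(U, \<omega>) \<in> DQBialg" "SDQBialg_bullet (U, \<omega>) = (bullet U, \<Phi>)"
    "\<Phi> \<in> car (tpow3 (bullet U))" "invertible_in (bpow3 (bullet U)) \<Phi>"
    "\<forall>u\<in>car (tpow3 U). tpair3 app \<Phi> u = \<omega> u"
    by (rule SDQBialgE)
  note U = DQBialgD[OF \<Phi>(1)]
  show ?thesis
    unfolding \<Phi>(2)
    by (rule QBialg_if_DQBialg[OF prebialgebra_bullet[OF U(2)] U(2) bipairing_app[OF U(2)] \<Phi>(3) U(3) \<Phi>(5)[rule_format] \<Phi>(1)
          bullet_NCoalgAlg[OF U(1)] app_bullet(2)[OF prebialgebraD(3)[OF U(2)]] \<Phi>(4)])
qed

section \<open>Morphisms and the restricted bijection\<close>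

text \<open>The image of \<Phi> under \<open>f\<close> and the splitting tensor of \<omega> are
  compared by pairing with tensors over \<open>U\<close>. What remains is a scalar condition on the
  pairing \<open>f\<close> alone, unchanged when its two arguments are exchanged; together with the
  next lemma it lets \<open>adjunct\<close> restrict to the smaller hom-sets.\<close>

lemma QBialg_hom_bullet_iff:
  assumes H: "(H, \<Phi>) \<in> QBialg" and U: "(U, \<omega>) \<in> SDQBialg"
  shows "f \<in> QBialg_hom (H, \<Phi>) (SDQBialg_bullet (U, \<omega>)) \<longleftrightarrow>
    f \<in> bihom H (bullet U) \<and> (\<forall>u\<in>car (tpow3 U). tpair3 f \<Phi> u = \<omega> u)"
proof (cases "f \<in> bihom H (bullet U)")
  case True
  from U obtain \<Psi> where \<Psi>: "(U, \<omega>) \<in> DQBialg" "SDQBialg_bullet (U, \<omega>) = (bullet U, \<Psi>)"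
    "\<Psi> \<in> car (tpow3 (bullet U))"
    "invertible_in (bpow3 (bullet U)) \<Psi>"
    "\<forall>u\<in>car (tpow3 U). tpair3 app \<Psi> u = \<omega> u"
    by (rule SDQBialgE)
  note pU = DQBialgD(2)[OF \<Psi>(1)] and pH = QBialgD(2)[OF H]
  note preU = prebialgebraD(3)[OF pU]
  note ab = app_bullet[OF preU] and vsD = is_vspace_bullet[OF preU] and vsU = prebialgebraD(5)[OF pU]
    and vsH = prebialgebraD(5)[OF pH]
  have lin: "linear_on H (bullet U) f" using True by (simp add: bihom_def algebra_hom_def lhom_def)
  have tp: "tpair3 app (tmap3 H (bullet U) f \<Phi>) u = tpair3 f \<Phi> u" if "u \<in> car (tpow3 U)" for u
    by (rule tpair3_tmap3_left[OF vsH vsD lin vsU QBialgD(3)[OF H] that ab(1)])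
  note mem = linear_on_mem[OF lhom_linear[OF tmap3_lhom[OF vsH vsD lin]] QBialgD(3)[OF H]]
  have "tmap3 H (bullet U) f \<Phi> = \<Psi> \<longleftrightarrow> (\<forall>u\<in>car (tpow3 U). tpair3 f \<Phi> u = \<omega> u)"
  proof
    assume "tmap3 H (bullet U) f \<Phi> = \<Psi>"
    then show "\<forall>u\<in>car (tpow3 U). tpair3 f \<Phi> u = \<omega> u" by (simp add: tp[symmetric] \<Psi>(5))
  next
    assume "\<forall>u\<in>car (tpow3 U). tpair3 f \<Phi> u = \<omega> u"
    then show "tmap3 H (bullet U) f \<Phi> = \<Psi>"
      by (intro tensor3_eqI[OF vsD vsU ab mem \<Psi>(3)]) (simp add: tp \<Psi>(5) tens3_mem)
  qed
  then show ?thesis using True by (simp add: QBialg_hom_def \<Psi>(2))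
next
  case False
  moreover have "fst (SDQBialg_bullet (U, \<omega>)) = bullet U" by (simp add: SDQBialg_bullet_def)
  ultimately show ?thesis by (simp add: QBialg_hom_def)
qed

text \<open>The same scalar condition, reached from the other side: the reassociator of
  \<open>QBialg_circ\<close> is the pairing with \<Phi>, and the map \<open>g\<close> moves from its
  argument into the pairing.\<close>

lemma DQBialg_hom_circ_iff:
  assumes H: "(H, \<Phi>) \<in> QBialg" and U: "(U, \<omega>) \<in> SDQBialg"
  shows "g \<in> DQBialg_hom (U, \<omega>) (QBialg_circ (H, \<Phi>)) \<longleftrightarrow>
    g \<in> bihom U (bullet H) \<and> (\<forall>u\<in>car (tpow3 U). tpair3 (adjunct g) \<Phi> u = \<omega> u)"
proof (cases "g \<in> bihom U (bullet H)")
  case True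
  have D: "(U, \<omega>) \<in> DQBialg" using U by (simp add: SDQBialg_def)
  note pU = DQBialgD(2)[OF D] and pH = QBialgD(2)[OF H]
  note preH = prebialgebraD(3)[OF pH]
  note vsD = is_vspace_bullet[OF preH] and vsU = prebialgebraD(5)[OF pU] and vsH = prebialgebraD(5)[OF pH]
  let ?C = "bullet H"
  have ba: "bilinear_on H ?C base_field (\<lambda>x f. f x)"
    using bipairing_flip[OF bipairing_app[OF pH]] by (simp add: bipairing_def measuring_def)
  have lin: "linear_on U ?C g" using True by (simp add: bihom_def algebra_hom_def lhom_def)
  note tm = tmap3_lhom[OF vsU vsD lin] and \<omega>H = QBialg_circ_lhom[OF pH QBialgD(3)[OF H]]
  have cl: "snd (QBialg_circ (H, \<Phi>)) \<circ> tmap3 U ?C g \<in> lhom (tpow3 U) base_field"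
    using linear_on_comp[OF lhom_linear[OF \<omega>H] lhom_linear[OF tm]] lhom_outside[OF tm]
      linear_on_zero[OF lhom_linear[OF \<omega>H] is_vspace_vtensor]
    by (auto simp: lhom_def o_def)
  have tp: "(snd (QBialg_circ (H, \<Phi>)) \<circ> tmap3 U ?C g) u = tpair3 (adjunct g) \<Phi> u"
    if u: "u \<in> car (tpow3 U)" for u
    using QBialg_circ_apply[OF pH QBialgD(3)[OF H] linear_on_mem[OF lhom_linear[OF tm] u]]
      tpair3_tmap3_right[OF vsU vsD lin vsH u QBialgD(3)[OF H] ba]
    by (simp add: adjunct_def)
  have "snd (QBialg_circ (H, \<Phi>)) \<circ> tmap3 U ?C g = \<omega> \<longleftrightarrow>
    (\<forall>u\<in>car (tpow3 U). tpair3 (adjunct g) \<Phi> u = \<omega> u)"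
    using lhom_eqI[OF cl DQBialgD(3)[OF D]] tp by metis
  moreover have "fst (QBialg_circ (H, \<Phi>)) = ?C" by (simp add: QBialg_circ_def)
  ultimately show ?thesis using True by (simp add: DQBialg_hom_def)
next
  case False
  moreover have "fst (QBialg_circ (H, \<Phi>)) = bullet H" by (simp add: QBialg_circ_def)
  ultimately show ?thesis by (simp add: DQBialg_hom_def)
qed

lemma fst_QBialg_circ [simp]: "fst (QBialg_circ X) = bullet (fst X)"
  and fst_SDQBialg_bullet [simp]: "fst (SDQBialg_bullet Y) = bullet (fst Y)"
  by (simp_all add: QBialg_circ_def SDQBialg_bullet_def case_prod_beta)

lemma adjunct_QBialg_hom_bij_betw:
  assumes X: "X \<in> QBialg" and Y: "Y \<in> SDQBialg"
  shows "bij_betw adjunct (QBialg_hom X (SDQBialg_bullet Y)) (DQBialg_hom Y (QBialg_circ X))"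
proof -
  obtain H \<Phi> U \<omega> where XY: "X = (H, \<Phi>)" "Y = (U, \<omega>)" by (cases X, cases Y)
  have H: "(H, \<Phi>) \<in> QBialg" and U: "(U, \<omega>) \<in> SDQBialg" using X Y XY by auto
  have p: "prebialgebra H" "prebialgebra U"
    using QBialgD(2)[OF H] U DQBialgD(2)[of U \<omega>] by (simp_all add: SDQBialg_def)
  show ?thesis
    unfolding XY
    by (rule bij_betw_byWitness[of _ adjunct])
      (auto simp: QBialg_hom_bullet_iff[OF H U] DQBialg_hom_circ_iff[OF H U] adjunct_bihom p)
qed

text \<open>The scalar criterion applies with the dual of \<open>X'\<close> as the split object. The
  adjunct of the transpose sends \<open>a\<close> to evaluation at \<open>f a\<close>, so pairing
  with the reassociator of \<open>X\<close> is pairing with its image under \<open>f\<close>, which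
  is the reassociator of \<open>X'\<close>.\<close>

lemma transpose_map_DQBialg_hom:
  assumes X: "X \<in> QBialg" and X': "X' \<in> QBialg" and f: "f \<in> QBialg_hom X X'"
  shows "transpose_map (fst X') f \<in> DQBialg_hom (QBialg_circ X') (QBialg_circ X)"
proof -
  obtain H \<Phi> H' \<Phi>' where XX: "X = (H, \<Phi>)" "X' = (H', \<Phi>')" by (cases X, cases X')
  have H: "(H, \<Phi>) \<in> QBialg" and H': "(H', \<Phi>') \<in> QBialg" using X X' XX by auto
  note p = QBialgD(2)[OF H] and p' = QBialgD(2)[OF H']
  have fb: "f \<in> bihom H H'" and f\<Phi>: "tmap3 H H' f \<Phi> = \<Phi>'" using f by (simp_all add: XX QBialg_hom_def)
  have lin: "linear_on H H' f" using fb by (simp add: bihom_def algebra_hom_def lhom_def)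
  let ?C = "bullet H'"
  obtain \<omega> where QC: "QBialg_circ (H', \<Phi>') = (?C, \<omega>)" by (simp add: QBialg_circ_def)
  note vsC = is_vspace_bullet[OF prebialgebraD(3)[OF p']]
  have ba: "bilinear_on H' ?C base_field (\<lambda>x f. f x)"
    using bipairing_flip[OF bipairing_app[OF p']] by (simp add: bipairing_def measuring_def)
  have "tpair3 (adjunct (transpose_map H' f)) \<Phi> u = \<omega> u"
    if u: "u \<in> car (tpow3 ?C)" for u
  proof -
    have "tpair3 (adjunct (transpose_map H' f)) \<Phi> u = tpair3 (\<lambda>a h. h (f a)) \<Phi> u"
      by (rule tpair3_cong[OF prebialgebraD(5)[OF p] vsC QBialgD(3)[OF H] u])
        (simp add: adjunct_def transpose_map_def)
    also have "\<dots> = tpair3 (\<lambda>x f. f x) (tmap3 H H' f \<Phi>) u"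
      by (rule tpair3_tmap3_left[OF prebialgebraD(5)[OF p] prebialgebraD(5)[OF p'] lin vsC QBialgD(3)[OF H] u ba, symmetric])
    also have "\<dots> = \<omega> u"
      unfolding f\<Phi> using QBialg_circ_apply[OF p' QBialgD(3)[OF H'] u] by (simp add: QC)
    finally show ?thesis .
  qed
  then show ?thesis
    using DQBialg_hom_circ_iff[OF H QBialg_circ_SDQBialg[OF H', unfolded QC], of "transpose_map H' f"]
      transpose_map_bihom[OF p p' fb] by (simp add: XX QC)
qed

text \<open>The scalar criterion applies with the dual of \<open>Y'\<close> as the quasi-bialgebra.
  The transpose moves \<open>f\<close> to the other argument of the pairing, where the condition
  becomes compatibility of \<open>f\<close> with the reassociators.\<close>

lemma transpose_map_QBialg_hom:
  assumes Y: "Y \<in> SDQBialg" and Y': "Y' \<in> SDQBialg" and f: "f \<in> DQBialg_hom Y Y'"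
  shows "transpose_map (fst Y') f \<in> QBialg_hom (SDQBialg_bullet Y') (SDQBialg_bullet Y)"
proof -
  obtain U \<omega> U' \<omega>' where YY: "Y = (U, \<omega>)" "Y' = (U', \<omega>')" by (cases Y, cases Y')
  have U: "(U, \<omega>) \<in> SDQBialg" and U': "(U', \<omega>') \<in> SDQBialg" using Y Y' YY by auto
  from U' obtain \<Psi> where \<Psi>: "(U', \<omega>') \<in> DQBialg" "SDQBialg_bullet (U', \<omega>') = (bullet U', \<Psi>)"
    "\<Psi> \<in> car (tpow3 (bullet U'))"
    "invertible_in (bpow3 (bullet U')) \<Psi>"
    "\<forall>u\<in>car (tpow3 U'). tpair3 app \<Psi> u = \<omega>' u"
    by (rule SDQBialgE)
  have D: "(U, \<omega>) \<in> DQBialg" using U by (simp add: SDQBialg_def)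
  note p = DQBialgD(2)[OF D] and p' = DQBialgD(2)[OF \<Psi>(1)]
  have fb: "f \<in> bihom U U'" and f\<omega>: "\<omega>' \<circ> tmap3 U U' f = \<omega>" using f by (simp_all add: YY DQBialg_hom_def)
  have lin: "linear_on U U' f" using fb by (simp add: bihom_def algebra_hom_def lhom_def)
  note vsD = is_vspace_bullet[OF prebialgebraD(3)[OF p']] and vsU = prebialgebraD(5)[OF p] and vsU' = prebialgebraD(5)[OF p']
  have "tpair3 (transpose_map U' f) \<Psi> u = \<omega> u" if u: "u \<in> car (tpow3 U)" for u
  proof -
    have "tpair3 (transpose_map U' f) \<Psi> u = tpair3 (\<lambda>h x. h (f x)) \<Psi> u"
      by (rule tpair3_cong[OF vsD vsU \<Psi>(3) u]) (simp add: transpose_map_def)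
    also have "\<dots> = tpair3 app \<Psi> (tmap3 U U' f u)"
      by (rule tpair3_tmap3_right[OF vsU vsU' lin vsD u \<Psi>(3) app_bullet(1)[OF prebialgebraD(3)[OF p']], symmetric])
    also have "\<dots> = \<omega> u"
      using \<Psi>(5)[rule_format, OF linear_on_mem[OF lhom_linear[OF tmap3_lhom[OF vsU vsU' lin]] u]] fun_cong[OF f\<omega>, of u] by simp
    finally show ?thesis .
  qed
  then show ?thesis
    using QBialg_hom_bullet_iff[OF SDQBialg_bullet_QBialg[OF U', unfolded \<Psi>(2)] U, of "transpose_map U' f"]
      transpose_map_bihom[OF p p' fb] unfolding YY by (simp add: \<Psi>(2))
qed

text \<open>For the evaluation map the scalar criterion is the formula that defines the reassociator
  of the dual.\<close>

lemma evaluation_QBialg_hom: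
  assumes X: "X \<in> QBialg"
  shows "evaluation (fst X) \<in> QBialg_hom X (SDQBialg_bullet (QBialg_circ X))"
proof -
  obtain H \<Phi> where XX: "X = (H, \<Phi>)" by (cases X)
  have H: "(H, \<Phi>) \<in> QBialg" using X XX by simp
  note p = QBialgD(2)[OF H]
  obtain \<omega> where QC: "QBialg_circ (H, \<Phi>) = (bullet H, \<omega>)" by (simp add: QBialg_circ_def)
  have "tpair3 (evaluation H) \<Phi> u = \<omega> u"
    if u: "u \<in> car (tpow3 (bullet H))" for u
    using QBialg_circ_apply[OF p QBialgD(3)[OF H] u]
      tpair3_cong[OF prebialgebraD(5)[OF p] is_vspace_bullet[OF prebialgebraD(3)[OF p]] QBialgD(3)[OF H] u,
        of "evaluation H" "\<lambda>x f. f x"]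
    by (simp add: evaluation_def QC)
  then show ?thesis
    using QBialg_hom_bullet_iff[OF H QBialg_circ_SDQBialg[OF H, unfolded QC], of "evaluation H"]
      evaluation_bihom[OF p] by (simp add: XX QC)
qed

text \<open>The adjunct of evaluation is the identity of the dual, so the scalar criterion says that
  the splitting tensor represents \<omega>.\<close>

lemma evaluation_DQBialg_hom:
  assumes Y: "Y \<in> SDQBialg"
  shows "evaluation (fst Y) \<in> DQBialg_hom Y (QBialg_circ (SDQBialg_bullet Y))"
proof -
  obtain U \<omega> where YY: "Y = (U, \<omega>)" by (cases Y)
  have U: "(U, \<omega>) \<in> SDQBialg" using Y YY by simp
  from U obtain \<Phi> where \<Phi>: "(U, \<omega>) \<in> DQBialg" "SDQBialg_bullet (U, \<omega>) = (bullet U, \<Phi>)"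
    "\<Phi> \<in> car (tpow3 (bullet U))"
    "invertible_in (bpow3 (bullet U)) \<Phi>"
    "\<forall>u\<in>car (tpow3 U). tpair3 app \<Phi> u = \<omega> u"
    by (rule SDQBialgE)
  note p = DQBialgD(2)[OF \<Phi>(1)]
  have "tpair3 (adjunct (evaluation U)) \<Phi> u = \<omega> u" if u: "u \<in> car (tpow3 U)" for u
    unfolding \<Phi>(5)[rule_format, OF u, symmetric] adjunct_evaluation
    by (rule tpair3_cong[OF is_vspace_bullet[OF prebialgebraD(3)[OF p]] prebialgebraD(5)[OF p] \<Phi>(3) u]) simp
  then show ?thesis
    using DQBialg_hom_circ_iff[OF SDQBialg_bullet_QBialg[OF U, unfolded \<Phi>(2)] U, of "evaluation U"]
      evaluation_bihom[OF p] unfolding YY by (simp add: \<Phi>(2))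
qed

lemma QBialg_hom_bihom: "f \<in> QBialg_hom X Y \<Longrightarrow> f \<in> bihom (fst X) (fst Y)"
  and DQBialg_hom_bihom: "g \<in> DQBialg_hom X' Y' \<Longrightarrow> g \<in> bihom (fst X') (fst Y')"
  by (simp_all add: QBialg_hom_def DQBialg_hom_def)

lemma NCoalgAlg_prebialgebra: "A \<in> NCoalgAlg \<Longrightarrow> prebialgebra A"
  and NAlgCoalg_prebialgebra: "C \<in> NAlgCoalg \<Longrightarrow> prebialgebra C"
  and QBialg_prebialgebra: "X \<in> QBialg \<Longrightarrow> prebialgebra (fst X)"
  and SDQBialg_prebialgebra: "Y \<in> SDQBialg \<Longrightarrow> prebialgebra (fst Y)"
  using QBialgD(2)[of "fst X" "snd X"] DQBialgD(2)[of "fst Y" "snd Y"]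
  by (auto simp: NCoalgAlg_iff NAlgCoalg_iff SDQBialg_def)

theorem theorem5p7:
  shows "
  (\<comment> \<open>the contravariant functors between \<open>NCoalgAlg\<close> and \<open>NAlgCoalg\<close>\<close>
    (\<forall>A :: ('k::field, 'a::ab_group_add) bistruct. A \<in> NCoalgAlg \<longrightarrow> circ A \<in> NAlgCoalg) \<and>
    (\<forall>(A :: ('k, 'a) bistruct) (A' :: ('k, 'b::ab_group_add) bistruct) f.
       A \<in> NCoalgAlg \<and> A' \<in> NCoalgAlg \<and> f \<in> bihom A A' \<longrightarrow>
       transpose_map A' f \<in> bihom (circ A') (circ A)) \<and>
    (\<forall>A :: ('k, 'a) bistruct. A \<in> NCoalgAlg \<longrightarrow> transpose_map A (ident A) = ident (circ A)) \<and>
    (\<forall>(A :: ('k, 'a) bistruct) (A' :: ('k, 'b) bistruct) (A'' :: ('k, 'c::ab_group_add) bistruct) f g.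
       A \<in> NCoalgAlg \<and> A' \<in> NCoalgAlg \<and> A'' \<in> NCoalgAlg \<and> f \<in> bihom A A' \<and> g \<in> bihom A' A'' \<longrightarrow>
       transpose_map A'' (g \<circ> f) = transpose_map A' f \<circ> transpose_map A'' g) \<and>
    (\<forall>C :: ('k, 'd::ab_group_add) bistruct. C \<in> NAlgCoalg \<longrightarrow> bullet C \<in> NCoalgAlg) \<and>
    (\<forall>(C :: ('k, 'd) bistruct) (C' :: ('k, 'e::ab_group_add) bistruct) f.
       C \<in> NAlgCoalg \<and> C' \<in> NAlgCoalg \<and> f \<in> bihom C C' \<longrightarrow>
       transpose_map C' f \<in> bihom (bullet C') (bullet C)) \<and>
    (\<forall>C :: ('k, 'd) bistruct. C \<in> NAlgCoalg \<longrightarrow> transpose_map C (ident C) = ident (bullet C)) \<and>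
    (\<forall>(C :: ('k, 'd) bistruct) (C' :: ('k, 'e) bistruct) (C'' :: ('k, 'f::ab_group_add) bistruct) f g.
       C \<in> NAlgCoalg \<and> C' \<in> NAlgCoalg \<and> C'' \<in> NAlgCoalg \<and> f \<in> bihom C C' \<and> g \<in> bihom C' C'' \<longrightarrow>
       transpose_map C'' (g \<circ> f) = transpose_map C' f \<circ> transpose_map C'' g)) \<and>
  (\<comment> \<open>they are adjoint: natural bijection of hom-sets, unit and counit\<close>
    (\<forall>(A :: ('k, 'a) bistruct) (C :: ('k, 'd) bistruct). A \<in> NCoalgAlg \<and> C \<in> NAlgCoalg \<longrightarrow>
       bij_betw adjunct (bihom A (bullet C)) (bihom C (circ A))) \<and>
    (\<forall>(A :: ('k, 'a) bistruct) (A' :: ('k, 'b) bistruct) (C :: ('k, 'd) bistruct) f p.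
       A \<in> NCoalgAlg \<and> A' \<in> NCoalgAlg \<and> C \<in> NAlgCoalg \<and>
       f \<in> bihom A (bullet C) \<and> p \<in> bihom A' A \<longrightarrow>
       adjunct (f \<circ> p) = transpose_map A p \<circ> adjunct f) \<and>
    (\<forall>(A :: ('k, 'a) bistruct) (C :: ('k, 'd) bistruct) (C' :: ('k, 'e) bistruct) f q.
       A \<in> NCoalgAlg \<and> C \<in> NAlgCoalg \<and> C' \<in> NAlgCoalg \<and>
       f \<in> bihom A (bullet C) \<and> q \<in> bihom C' C \<longrightarrow>
       adjunct (transpose_map C q \<circ> f) = adjunct f \<circ> q) \<and>
    (\<forall>A :: ('k, 'a) bistruct. A \<in> NCoalgAlg \<longrightarrow>
       evaluation A \<in> bihom A (bullet (circ A)) \<and> adjunct (evaluation A) = ident (circ A)) \<and>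
    (\<forall>C :: ('k, 'd) bistruct. C \<in> NAlgCoalg \<longrightarrow>
       evaluation C \<in> bihom C (circ (bullet C)) \<and> adjunct (ident (bullet C)) = evaluation C)) \<and>
  (\<comment> \<open>the induced contravariant functors between \<open>QBialg\<close> and \<open>SDQBialg\<close>\<close>
    (\<forall>X :: ('k, 'a) bistruct \<times> ('k, 'a) tensor3. X \<in> QBialg \<longrightarrow> QBialg_circ X \<in> SDQBialg) \<and>
    (\<forall>(X :: ('k, 'a) bistruct \<times> ('k, 'a) tensor3) (X' :: ('k, 'b) bistruct \<times> ('k, 'b) tensor3) f.
       X \<in> QBialg \<and> X' \<in> QBialg \<and> f \<in> QBialg_hom X X' \<longrightarrow>
       transpose_map (fst X') f \<in> DQBialg_hom (QBialg_circ X') (QBialg_circ X)) \<and>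
    (\<forall>X :: ('k, 'a) bistruct \<times> ('k, 'a) tensor3. X \<in> QBialg \<longrightarrow>
       transpose_map (fst X) (ident (fst X)) = ident (fst (QBialg_circ X))) \<and>
    (\<forall>(X :: ('k, 'a) bistruct \<times> ('k, 'a) tensor3) (X' :: ('k, 'b) bistruct \<times> ('k, 'b) tensor3)
      (X'' :: ('k, 'c) bistruct \<times> ('k, 'c) tensor3) f g.
       X \<in> QBialg \<and> X' \<in> QBialg \<and> X'' \<in> QBialg \<and> f \<in> QBialg_hom X X' \<and> g \<in> QBialg_hom X' X'' \<longrightarrow>
       transpose_map (fst X'') (g \<circ> f) = transpose_map (fst X') f \<circ> transpose_map (fst X'') g) \<and>
    (\<forall>(U :: ('k, 'd) bistruct) \<omega>. (U, \<omega>) \<in> SDQBialg \<longrightarrow> (\<exists>!\<Phi>. splits U \<omega> \<Phi>)) \<and>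
    (\<forall>Y :: ('k, 'd) bistruct \<times> (('k, 'd) tensor3 \<Rightarrow> 'k). Y \<in> SDQBialg \<longrightarrow>
       SDQBialg_bullet Y \<in> QBialg) \<and>
    (\<forall>(Y :: ('k, 'd) bistruct \<times> (('k, 'd) tensor3 \<Rightarrow> 'k))
      (Y' :: ('k, 'e) bistruct \<times> (('k, 'e) tensor3 \<Rightarrow> 'k)) f.
       Y \<in> SDQBialg \<and> Y' \<in> SDQBialg \<and> f \<in> DQBialg_hom Y Y' \<longrightarrow>
       transpose_map (fst Y') f \<in> QBialg_hom (SDQBialg_bullet Y') (SDQBialg_bullet Y)) \<and>
    (\<forall>Y :: ('k, 'd) bistruct \<times> (('k, 'd) tensor3 \<Rightarrow> 'k). Y \<in> SDQBialg \<longrightarrow>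
       transpose_map (fst Y) (ident (fst Y)) = ident (fst (SDQBialg_bullet Y))) \<and>
    (\<forall>(Y :: ('k, 'd) bistruct \<times> (('k, 'd) tensor3 \<Rightarrow> 'k))
      (Y' :: ('k, 'e) bistruct \<times> (('k, 'e) tensor3 \<Rightarrow> 'k))
      (Y'' :: ('k, 'f) bistruct \<times> (('k, 'f) tensor3 \<Rightarrow> 'k)) f g.
       Y \<in> SDQBialg \<and> Y' \<in> SDQBialg \<and> Y'' \<in> SDQBialg \<and>
       f \<in> DQBialg_hom Y Y' \<and> g \<in> DQBialg_hom Y' Y'' \<longrightarrow>
       transpose_map (fst Y'') (g \<circ> f) = transpose_map (fst Y') f \<circ> transpose_map (fst Y'') g)) \<and>
  (\<comment> \<open>the induced adjunction: the same bijection restricts to the smaller hom-sets\<close>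
    (\<forall>(X :: ('k, 'a) bistruct \<times> ('k, 'a) tensor3) (Y :: ('k, 'd) bistruct \<times> (('k, 'd) tensor3 \<Rightarrow> 'k)).
       X \<in> QBialg \<and> Y \<in> SDQBialg \<longrightarrow>
       bij_betw adjunct (QBialg_hom X (SDQBialg_bullet Y)) (DQBialg_hom Y (QBialg_circ X))) \<and>
    (\<forall>(X :: ('k, 'a) bistruct \<times> ('k, 'a) tensor3) (X' :: ('k, 'b) bistruct \<times> ('k, 'b) tensor3)
      (Y :: ('k, 'd) bistruct \<times> (('k, 'd) tensor3 \<Rightarrow> 'k)) f p.
       X \<in> QBialg \<and> X' \<in> QBialg \<and> Y \<in> SDQBialg \<and>
       f \<in> QBialg_hom X (SDQBialg_bullet Y) \<and> p \<in> QBialg_hom X' X \<longrightarrow>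
       adjunct (f \<circ> p) = transpose_map (fst X) p \<circ> adjunct f) \<and>
    (\<forall>(X :: ('k, 'a) bistruct \<times> ('k, 'a) tensor3)
      (Y :: ('k, 'd) bistruct \<times> (('k, 'd) tensor3 \<Rightarrow> 'k))
      (Y' :: ('k, 'e) bistruct \<times> (('k, 'e) tensor3 \<Rightarrow> 'k)) f q.
       X \<in> QBialg \<and> Y \<in> SDQBialg \<and> Y' \<in> SDQBialg \<and>
       f \<in> QBialg_hom X (SDQBialg_bullet Y) \<and> q \<in> DQBialg_hom Y' Y \<longrightarrow>
       adjunct (transpose_map (fst Y) q \<circ> f) = adjunct f \<circ> q) \<and>
    (\<forall>X :: ('k, 'a) bistruct \<times> ('k, 'a) tensor3. X \<in> QBialg \<longrightarrow>
       evaluation (fst X) \<in> QBialg_hom X (SDQBialg_bullet (QBialg_circ X)) \<and>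
       adjunct (evaluation (fst X)) = ident (fst (QBialg_circ X))) \<and>
    (\<forall>Y :: ('k, 'd) bistruct \<times> (('k, 'd) tensor3 \<Rightarrow> 'k). Y \<in> SDQBialg \<longrightarrow>
       evaluation (fst Y) \<in> DQBialg_hom Y (QBialg_circ (SDQBialg_bullet Y)) \<and>
       adjunct (ident (fst (SDQBialg_bullet Y))) = evaluation (fst Y)))"
proof (intro conjI allI impI, goal_cases)
  case 1
  then show ?case by (rule bullet_NAlgCoalg)
next
  case 2
  then show ?case by (elim conjE) (rule transpose_map_bihom[OF NCoalgAlg_prebialgebra NCoalgAlg_prebialgebra])
next
  case 3
  then show ?case by (rule transpose_map_ident[OF NCoalgAlg_prebialgebra])
next
  case 4
  then show ?case by (elim conjE) (rule transpose_map_comp[OF NCoalgAlg_prebialgebra NCoalgAlg_prebialgebra])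
next
  case 5
  then show ?case by (rule bullet_NCoalgAlg)
next
  case 6
  then show ?case by (elim conjE) (rule transpose_map_bihom[OF NAlgCoalg_prebialgebra NAlgCoalg_prebialgebra])
next
  case 7
  then show ?case by (rule transpose_map_ident[OF NAlgCoalg_prebialgebra])
next
  case 8
  then show ?case by (elim conjE) (rule transpose_map_comp[OF NAlgCoalg_prebialgebra NAlgCoalg_prebialgebra])
next
  case 9
  then show ?case by (elim conjE) (rule adjunct_bij_betw[OF NCoalgAlg_prebialgebra NAlgCoalg_prebialgebra])
next
  case 10
  then show ?case by (elim conjE) (rule adjunct_comp_left[OF NCoalgAlg_prebialgebra NAlgCoalg_prebialgebra])
next
  case 11
  then show ?case by (elim conjE) (rule adjunct_comp_right[OF NCoalgAlg_prebialgebra NAlgCoalg_prebialgebra])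
next
  case 12
  then show ?case by (rule evaluation_bihom[OF NCoalgAlg_prebialgebra])
next
  case 13
  then show ?case by (simp add: adjunct_evaluation)
next
  case 14
  then show ?case by (rule evaluation_bihom[OF NAlgCoalg_prebialgebra])
next
  case 15
  then show ?case by (simp add: adjunct_ident_bullet)
next
  case (16 X)
  then show ?case by (cases X) (simp add: QBialg_circ_SDQBialg)
next
  case 17
  then show ?case by (elim conjE) (rule transpose_map_DQBialg_hom)
next
  case 18
  then show ?case by (simp add: transpose_map_ident QBialg_prebialgebra SDQBialg_prebialgebra)
next
  case 19
  then show ?case by (elim conjE) (rule transpose_map_comp[OF QBialg_prebialgebra QBialg_prebialgebra QBialg_hom_bihom])
next
  case 20
  then show ?case by (auto simp: SDQBialg_def intro: splits_unique DQBialgD(2))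
next
  case (21 Y)
  then show ?case by (cases Y) (simp add: SDQBialg_bullet_QBialg)
next
  case 22
  then show ?case by (elim conjE) (rule transpose_map_QBialg_hom)
next
  case 23
  then show ?case by (simp add: transpose_map_ident QBialg_prebialgebra SDQBialg_prebialgebra)
next
  case 24
  then show ?case by (elim conjE) (rule transpose_map_comp[OF SDQBialg_prebialgebra SDQBialg_prebialgebra DQBialg_hom_bihom])
next
  case 25
  then show ?case by (elim conjE) (rule adjunct_QBialg_hom_bij_betw)
next
  case 26
  then show ?case
    by (elim conjE) (rule adjunct_comp_left[OF QBialg_prebialgebra SDQBialg_prebialgebra
          QBialg_hom_bihom[where Y = "SDQBialg_bullet _", simplified]])
next
  case 27
  then show ?case
    by (elim conjE) (rule adjunct_comp_right[OF QBialg_prebialgebra SDQBialg_prebialgebra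
          QBialg_hom_bihom[where Y = "SDQBialg_bullet _", simplified]])
next
  case 28
  then show ?case by (rule evaluation_QBialg_hom)
next
  case 29
  then show ?case by (simp add: adjunct_evaluation)
next
  case 30
  then show ?case by (rule evaluation_DQBialg_hom)
next
  case 31
  then show ?case by (simp add: adjunct_ident_bullet)
qed

end
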